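(* Assume $N\ge 2$, and for $\omega<0$ let $\Phi=\Phi(\cdot,\omega)\in H^2_{\rm NK}(\Gamma_N)$ be the positive single-lobe symmetric state (described in the context) with linearized operator $\mathcal{L}=-\Delta-\omega-6\Phi^2$. There exists $\omega_*\in(-\infty,0)$ such that $z(\mathcal{L})=N-1$ for $\omega=\omega_*$ and $z(\mathcal{L})=0$ for $\omega\ne\omega_*$. Moreover, $n(\mathcal{L})=N$ for $\omega\in(-\infty,\omega_* )$ and $n(\mathcal{L})=1$ for $\omega\in[\omega_*,0)$.
   Context: The flower graph $\Gamma_N$ consists of $N$ loops of length $2\pi$, each parameterized by $[-\pi,\pi]$, and one half-line $[0,\infty)$, all joined at a single vertex (the endpoints $\pm\pi$ of every loop and the point $0$ of the half-line are identified). A function on $\Gamma_N$ is written $\Phi=(\phi_1,\dots,\phi_N,\phi_0)$ with $\phi_j$ defined on $[-\pi,\pi]$ for $1\le j\le N$ and $\phi_0$ defined on $[0,\infty)$. Set $L^2(\Gamma_N)=L^2(-\pi,\pi)^N\times L^2(0,\infty)$ and $H^2(\Gamma_N)=H^2(-\pi,\pi)^N\times H^2(0,\infty)$. The space $H^2_{\rm NK}(\Gamma_N)$ is the set of $\Phi\in H^2(\Gamma_N)$ satisfying $$\phi_1(\pm\pi)=\dots=\phi_N(\pm\pi)=\phi_0(0),\qquad \sum_{j=1}^N\left[\phi_j'(\pi)-\phi_j'(-\pi)\right]=\phi_0'(0).$$ The Laplacian $\Delta$ acts as the second derivative on each component, with domain $H^2_{\rm NK}(\Gamma_N)$; $-\Delta$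 is self-adjoint in $L^2(\Gamma_N)$. For every $\omega<0$ there is exactly one $\Phi(\cdot,\omega)\in H^2_{\rm NK}(\Gamma_N)$, called the positive single-lobe symmetric state, which is real-valued and strictly positive on $\Gamma_N$, solves $\omega\Phi=-\Delta\Phi-2\Phi^3$, satisfies $\phi_1=\phi_2=\dots=\phi_N$ on $[-\pi,\pi]$, has $\phi_j$ even on $[-\pi,\pi]$ and monotonically decreasing on $[0,\pi]$, and has $\phi_0$ monotonically decreasing on $[0,\infty)$. The operator $\mathcal{L}=-\Delta-\omega-6\Phi^2: H^2_{\rm NK}(\Gamma_N)\subset L^2(\Gamma_N)\to L^2(\Gamma_N)$ is self-adjoint with continuous spectrum $[|\omega|,\infty)$. $n(\mathcal{L})$ denotes the number of negative eigenvalues of $\mathcal{L}$ counted with multiplicities, and $z(\mathcal{L})$ the multiplicity of the zero eigenvalue of $\mathcal{L}$ ($0$ if zero is not an eigenvalue). *)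

theory Defs
  imports "HOL-Analysis.Analysis" "HOL-Library.Function_Algebras" "HOL-Library.Extended_Nat"
begin

section \<open>Sobolev spaces on an interval\<close>

text \<open>Functions are used as representatives of Lebesgue classes: only the values in \<open>I\<close> up to
  null sets matter in this section.\<close>

definition L2_on :: "real set \<Rightarrow> (real \<Rightarrow> 'a::{banach,second_countable_topology}) set" where
  "L2_on I = {u. set_borel_measurable lebesgue I u \<and>
                 set_integrable lebesgue I (\<lambda>x. (norm (u x))\<^sup>2)}"

definition test_function :: "real set \<Rightarrow> (real \<Rightarrow> real) \<Rightarrow> bool" where
  "test_function I \<eta> \<longleftrightarrow> \<eta> C1_differentiable_on UNIV \<and>
     (\<exists>K. compact K \<and> K \<subseteq> interior I \<and> (\<forall>x. x \<notin> K \<longrightarrow> \<eta> x = 0))"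

text \<open>Meaningful for \<open>u\<close> and \<open>g\<close> in \<open>L2_on I\<close>, where both integrals converge.\<close>

definition is_weak_deriv ::
  "real set \<Rightarrow> (real \<Rightarrow> 'a::{banach,second_countable_topology}) \<Rightarrow> (real \<Rightarrow> 'a) \<Rightarrow> bool" where
  "is_weak_deriv I u g \<longleftrightarrow> (\<forall>\<eta>. test_function I \<eta> \<longrightarrow>
     (LINT x:I|lebesgue. deriv \<eta> x *\<^sub>R u x) = - (LINT x:I|lebesgue. \<eta> x *\<^sub>R g x))"

text \<open>A representative of the weak derivative; it is determined up to null sets.\<close>

definition weak_deriv ::
  "real set \<Rightarrow> (real \<Rightarrow> 'a::{banach,second_countable_topology}) \<Rightarrow> real \<Rightarrow> 'a" where
  "weak_deriv I u = (SOME g. g \<in> L2_on I \<and> is_weak_deriv I u g)"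

definition H1_on :: "real set \<Rightarrow> (real \<Rightarrow> 'a::{banach,second_countable_topology}) set" where
  "H1_on I = {u \<in> L2_on I. \<exists>g \<in> L2_on I. is_weak_deriv I u g}"

definition H2_on :: "real set \<Rightarrow> (real \<Rightarrow> 'a::{banach,second_countable_topology}) set" where
  "H2_on I = {u \<in> H1_on I. weak_deriv I u \<in> H1_on I}"


section \<open>The flower graph and its Laplacian\<close>

text \<open>Edge \<open>0\<close> is the half-line and the edges \<open>1, \<dots>, N\<close> are the loops. A function on the graph
  is a family \<open>\<Phi>\<close>, where \<open>\<Phi> j\<close> is the component on edge \<open>j\<close>.\<close>

definition edge :: "nat \<Rightarrow> real set" where
  "edge j = (if j = 0 then {0..} else {-pi..pi})"

text \<open>Elements of \<open>H\<^sup>2\<close> of the graph are represented by their continuous representatives on the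
  closed edges (these exist and are then continuously differentiable up to the endpoints),
  extended by \<open>0\<close> outside the graph. Thus every class has exactly one representative, so that
  equality and linear independence of classes are those of HOL functions.\<close>

definition flower_H2 :: "nat \<Rightarrow> (nat \<Rightarrow> real \<Rightarrow> 'a::{banach,second_countable_topology}) set" where
  "flower_H2 N = {\<Phi>. (\<forall>j\<le>N. \<Phi> j \<in> H2_on (edge j) \<and> continuous_on (edge j) (\<Phi> j)) \<and>
                      (\<forall>j x. j > N \<or> x \<notin> edge j \<longrightarrow> \<Phi> j x = 0)}"

abbreviation edge_deriv ::
  "(nat \<Rightarrow> real \<Rightarrow> 'a::{banach,second_countable_topology}) \<Rightarrow> nat \<Rightarrow> real \<Rightarrow> 'a" where
  "edge_deriv \<Phi> j x \<equiv> vector_derivative (\<Phi> j) (at x within edge j)"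

definition flower_H2_NK ::
  "nat \<Rightarrow> (nat \<Rightarrow> real \<Rightarrow> 'a::{banach,second_countable_topology}) set" where
  "flower_H2_NK N = {\<Phi> \<in> flower_H2 N.
     (\<forall>j\<in>{1..N}. \<Phi> j pi = \<Phi> 0 0 \<and> \<Phi> j (-pi) = \<Phi> 0 0) \<and>
     (\<Sum>j=1..N. edge_deriv \<Phi> j pi - edge_deriv \<Phi> j (-pi)) = edge_deriv \<Phi> 0 0}"

definition laplacian ::
  "(nat \<Rightarrow> real \<Rightarrow> 'a::{banach,second_countable_topology}) \<Rightarrow> nat \<Rightarrow> real \<Rightarrow> 'a" where
  "laplacian \<Phi> j = weak_deriv (edge j) (weak_deriv (edge j) (\<Phi> j))"

text \<open>Equality in \<open>L\<^sup>2\<close> of the graph.\<close>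

definition flower_ae_eq :: "nat \<Rightarrow> (nat \<Rightarrow> real \<Rightarrow> 'a) \<Rightarrow> (nat \<Rightarrow> real \<Rightarrow> 'a) \<Rightarrow> bool" where
  "flower_ae_eq N F G \<longleftrightarrow> (\<forall>j\<le>N. AE x in lebesgue_on (edge j). F j x = G j x)"


section \<open>The positive single-lobe symmetric state\<close>

definition positive_single_lobe_symmetric_state ::
  "nat \<Rightarrow> real \<Rightarrow> (nat \<Rightarrow> real \<Rightarrow> real) \<Rightarrow> bool" where
  "positive_single_lobe_symmetric_state N \<omega> \<Phi> \<longleftrightarrow>
     \<Phi> \<in> flower_H2_NK N \<and>
     (\<forall>j\<le>N. \<forall>x\<in>edge j. \<Phi> j x > 0) \<and>
     flower_ae_eq N (\<lambda>j x. \<omega> * \<Phi> j x) (\<lambda>j x. - laplacian \<Phi> j x - 2 * (\<Phi> j x) ^ 3) \<and>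
     (\<forall>i\<in>{1..N}. \<forall>j\<in>{1..N}. \<forall>x\<in>{-pi..pi}. \<Phi> i x = \<Phi> j x) \<and>
     (\<forall>j\<in>{1..N}. (\<forall>x\<in>{-pi..pi}. \<Phi> j (-x) = \<Phi> j x) \<and> antimono_on {0..pi} (\<Phi> j)) \<and>
     antimono_on {0..} (\<Phi> 0)"


section \<open>The linearized operator\<close>

definition linearized_op ::
  "real \<Rightarrow> (nat \<Rightarrow> real \<Rightarrow> real) \<Rightarrow> (nat \<Rightarrow> real \<Rightarrow> complex) \<Rightarrow> nat \<Rightarrow> real \<Rightarrow> complex" where
  "linearized_op \<omega> \<Phi> \<Psi> = (\<lambda>j x. - laplacian \<Psi> j x - of_real \<omega> * \<Psi> j x
                                  - 6 * (of_real (\<Phi> j x))\<^sup>2 * \<Psi> j x)"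

definition eigenspace ::
  "nat \<Rightarrow> real \<Rightarrow> (nat \<Rightarrow> real \<Rightarrow> real) \<Rightarrow> real \<Rightarrow> (nat \<Rightarrow> real \<Rightarrow> complex) set" where
  "eigenspace N \<omega> \<Phi> \<mu> =
     {\<Psi> \<in> flower_H2_NK N. flower_ae_eq N (linearized_op \<omega> \<Phi> \<Psi>) (\<lambda>j x. of_real \<mu> * \<Psi> j x)}"

definition negative_eigenvalues :: "nat \<Rightarrow> real \<Rightarrow> (nat \<Rightarrow> real \<Rightarrow> real) \<Rightarrow> real set" where
  "negative_eigenvalues N \<omega> \<Phi> = {\<mu>. \<mu> < 0 \<and> (\<exists>\<Psi> \<in> eigenspace N \<omega> \<Phi> \<mu>. \<Psi> \<noteq> 0)}"

definition cscale :: "complex \<Rightarrow> (nat \<Rightarrow> real \<Rightarrow> complex) \<Rightarrow> nat \<Rightarrow> real \<Rightarrow> complex" where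
  "cscale c \<Psi> = (\<lambda>j x. c * \<Psi> j x)"

interpretation cfun: vector_space cscale
  by unfold_locales (auto simp: cscale_def fun_eq_iff algebra_simps)

text \<open>The case distinctions below are needed because \<open>dim\<close> is \<open>0\<close> for infinite-dimensional
  spaces and sums over infinite sets are \<open>0\<close>.\<close>

definition cdimension :: "(nat \<Rightarrow> real \<Rightarrow> complex) set \<Rightarrow> enat" where
  "cdimension V = (if \<exists>B. finite B \<and> V \<subseteq> cfun.span B then enat (cfun.dim V) else \<infinity>)"

definition n_neg :: "nat \<Rightarrow> real \<Rightarrow> (nat \<Rightarrow> real \<Rightarrow> real) \<Rightarrow> enat" where
  "n_neg N \<omega> \<Phi> = (if finite (negative_eigenvalues N \<omega> \<Phi>)
      then (\<Sum>\<mu>\<in>negative_eigenvalues N \<omega> \<Phi>. cdimension (eigenspace N \<omega> \<Phi> \<mu>)) else \<infinity>)"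

definition z_zero :: "nat \<Rightarrow> real \<Rightarrow> (nat \<Rightarrow> real \<Rightarrow> real) \<Rightarrow> enat" where
  "z_zero N \<omega> \<Phi> = cdimension (eigenspace N \<omega> \<Phi> 0)"

end

(* The states are explicit up to one parameter. Scaling out \<epsilon> = sqrt (- \<omega>), a loop carries a
   solution of u'' = u - 2 u^3 on [0, \<epsilon> pi], the half-line carries a truncated soliton, and with
   z = (u at the vertex)^2 and c = 1 / (2 N) the length of the loop is an elliptic integral T z = \<epsilon> pi.
   Writing J z for the matching integral of u^2 + 2 E (E is the energy), Picard-Fuchs type identities give
   T' = - K / (2 z (1 - z) M^2) with K = 2 c z sqrt (1 - z) + (1 - 2 z) J > 0. Hence T is strictly decreasing
   and \<omega> is a monotone function of z.

   An eigenfunction for \<mu> \<le> 0 is even on every loop (the odd part is killed by Sturm comparison with u'), so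
   it is C_j s(x; \<mu>) on the j-th loop and a multiple of an explicit Jost solution on the half-line. If
   s(pi; \<mu>) = 0 the vertex conditions leave an (N - 1)-dimensional space of C's with sum zero; otherwise all C_j
   agree and \<mu> is a zero of a matching function, which has exactly one negative zero because its value at
   \<mu> = 0 is a negative multiple of K. So everything is governed by the sign of s(pi; 0), which is opposite to
   that of H = sqrt (1 - z) (1 - 2 k z) - c J, k = 1 - c^2. The function H changes sign exactly once on (0, 1):
   an explicit bound on J settles the sign for z < 1 / (2 + c), the sign is clear for z > 1 / (2 k), and H is
   decreasing in between. *)

theory Submission
  imports Defs
begin

section \<open>The fundamental lemma of the calculus of variations\<close>

text \<open>The double role of \<open>K\<close> is no coincidence. A zero mode with the same even
  profile on all loops would be tangent to the family of states at a point where the length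
  \<open>T\<close> is stationary, so the sign that makes \<open>T\<close> monotone also keeps
  \<open>matching\<close> away from zero at energy 0. What remains delicate is the sign of
  combinations of \<open>J\<close>, an integral without closed form: for \<open>T\<close>
  nonnegativity and a crude bound suffice, while \<open>J\<close> needs the majorant of
  \<open>J_upper\<close>, whose value at the vertex is elementary. The condition N >= 2 enters the
  estimates as c <= 1/4. Two choices keep the analysis elementary. Neither elliptic nor hyperbolic
  functions occur: a loop is described by its energy relation, the half-line by a Riccati function
  \<open>\<tau>\<close>. And the spectral statements rest on monotone Wronskians instead of
  variational characterizations. The definitions speak of weak derivatives picked by a choice
  operator, so everything on an edge has to be translated to classical solutions and back; this is
  the purpose of the analytic preliminaries.\<close>

lemma max0_square_deriv: "((\<lambda>s::real. (max 0 s)\<^sup>2) has_real_derivative 2 * max 0 s) (at s)"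
proof -
  consider "s < 0" | "s = 0" | "s > 0" by linarith
  then show ?thesis
  proof cases
    case 1
    have "((\<lambda>s::real. 0) has_real_derivative 2 * max 0 s) (at s)" using 1 by simp
    then show ?thesis
      by (rule has_field_derivative_transform_within_open[where S="{..<0}"]) (use 1 in auto)
  next
    case 2
    have "(\<lambda>h::real. (max 0 h)\<^sup>2 / h) \<midarrow>0\<rightarrow> 0"
    proof (rule Lim_null_comparison)
      show "(\<lambda>h::real. \<bar>h\<bar>) \<midarrow>0\<rightarrow> 0" by (auto intro!: tendsto_eq_intros)
      show "\<forall>\<^sub>F x in at 0. norm ((max 0 x)\<^sup>2 / x) \<le> \<bar>x::real\<bar>"
        by (rule always_eventually) (auto simp: max_def power2_eq_square)
    qed
    then show ?thesis using 2 by (simp add: DERIV_def)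
  next
    case 3
    have "((\<lambda>s::real. s\<^sup>2) has_real_derivative 2 * max 0 s) (at s)" using 3 by (auto intro!: derivative_eq_intros)
    then show ?thesis
      by (rule has_field_derivative_transform_within_open[where S="{0<..}"]) (use 3 in auto)
  qed
qed

text \<open>Test functions only have to be C1, so squares of positive parts suffice in place of
  smooth cut-offs. With F positive exactly on (x, y), n F / (1 + n F) stays between 0 and 1 and
  tends to the indicator of (x, y) as n grows.\<close>

definition bump :: "real \<Rightarrow> real \<Rightarrow> nat \<Rightarrow> real \<Rightarrow> real" where
  "bump x y n t = (let F = (max 0 (t - x))\<^sup>2 * (max 0 (y - t))\<^sup>2 in real n * F / (1 + real n * F))"

lemma test_functionI:
  assumes "\<And>x. (\<eta> has_real_derivative \<eta>' x) (at x)" "continuous_on UNIV \<eta>'"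
    "compact K" "K \<subseteq> interior I" "\<And>x. x \<notin> K \<Longrightarrow> \<eta> x = 0"
  shows "test_function I \<eta>"
  using assms unfolding test_function_def C1_differentiable_on_def has_real_derivative_iff_has_vector_derivative
  by blast

lemma bump_test:
  assumes "{x..y} \<subseteq> interior I"
  shows "test_function I (bump x y n)"
proof -
  define F where "F t = (max 0 (t - x))\<^sup>2 * (max 0 (y - t))\<^sup>2" for t
  define F' where "F' t = 2 * max 0 (t - x) * (max 0 (y - t))\<^sup>2 - (max 0 (t - x))\<^sup>2 * (2 * max 0 (y - t))" for t
  have F0: "F t \<ge> 0" for t by (simp add: F_def)
  have pos: "1 + real n * F t \<noteq> 0" for t using F0[of t]
    by (metis add_nonneg_eq_0_iff less_numeral_extra(1) of_nat_0_le_iff order_less_le split_mult_pos_le zero_neq_one)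
  have d1: "((\<lambda>t. (max 0 (t - x))\<^sup>2) has_real_derivative 2 * max 0 (t - x)) (at t)" for t
    using DERIV_chain'[of "\<lambda>t. t - x" 1 t UNIV, OF _ max0_square_deriv[of "t - x"]] DERIV_ident
    by (simp add: DERIV_cdivide Deriv.field_differentiable_diff[OF DERIV_ident DERIV_const, simplified])
  have d2: "((\<lambda>t. (max 0 (y - t))\<^sup>2) has_real_derivative - (2 * max 0 (y - t))) (at t)" for t
    using DERIV_chain'[of "\<lambda>t. y - t" "-1" t UNIV, OF _ max0_square_deriv[of "y - t"]] 
    by (simp add: Deriv.field_differentiable_diff[OF DERIV_const DERIV_ident, simplified])
  have dF: "(F has_real_derivative F' t) (at t)" for t
    unfolding F_def F'_def by (rule derivative_eq_intros d1 d2 refl)+ (simp add: algebra_simps)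
  have e: "bump x y n = (\<lambda>t. real n * F t / (1 + real n * F t))" by (simp add: fun_eq_iff bump_def F_def Let_def)
  show ?thesis unfolding e
  proof (rule test_functionI[where K="{x..y}"])
    show "((\<lambda>t. real n * F t / (1 + real n * F t)) has_real_derivative
      (real n * F' t * (1 + real n * F t) - real n * F t * (real n * F' t)) / (1 + real n * F t)\<^sup>2) (at t)" for t
      by (rule derivative_eq_intros dF refl pos)+ (simp add: power2_eq_square)
    have c: "continuous_on UNIV F" "continuous_on UNIV F'" unfolding F_def F'_def by (intro continuous_intros)+
    show "continuous_on UNIV (\<lambda>t. (real n * F' t * (1 + real n * F t) - real n * F t * (real n * F' t)) / (1 + real n * F t)\<^sup>2)"
      by (intro continuous_intros c) (use pos in auto)
    show "t \<notin> {x..y} \<Longrightarrow> real n * F t / (1 + real n * F t) = 0" for t by (auto simp: F_def)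
  qed (use assms in auto)
qed

lemma bump_bounds: "0 \<le> bump x y n t" "bump x y n t \<le> 1"
proof -
  define G where "G = real n * ((max 0 (t - x))\<^sup>2 * (max 0 (y - t))\<^sup>2)"
  have G: "0 \<le> G" by (simp add: G_def)
  have e: "bump x y n t = G / (1 + G)" by (simp add: bump_def Let_def G_def)
  show "0 \<le> bump x y n t" "bump x y n t \<le> 1" unfolding e using G by (simp_all add: divide_simps)
qed

lemma bump_0: "t \<notin> {x..y} \<Longrightarrow> bump x y n t = 0"
  by (auto simp: bump_def Let_def)

lemma bump_lim: 
  assumes "x < t" "t < y"
  shows "(\<lambda>n. bump x y n t) \<longlonglongrightarrow> 1"
proof -
  define F where "F = (max 0 (t - x))\<^sup>2 * (max 0 (y - t))\<^sup>2"
  have F: "F > 0" using assms by (simp add: F_def)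
  have "filterlim (\<lambda>n. 1 + F * real n) at_top sequentially"
    by (intro filterlim_tendsto_add_at_top[OF tendsto_const] filterlim_tendsto_pos_mult_at_top[OF tendsto_const F filterlim_real_sequentially])
  then have "(\<lambda>n. 1 - 1 / (1 + F * real n)) \<longlonglongrightarrow> 1 - 0"
    by (intro tendsto_diff real_tendsto_divide_at_top[OF tendsto_const] tendsto_const)
  moreover have "bump x y n t = 1 - 1 / (1 + F * real n)" for n
  proof -
    have "1 + real n * F > 0" using F by (intro add_pos_nonneg) auto
    then show ?thesis unfolding bump_def Let_def F_def[symmetric] by (simp add: field_simps)
  qed
  ultimately show ?thesis by simp
qed

text \<open>Lebesgue differentiation: almost everywhere g is the limit of its averages over
  [x, x + h], and all of these vanish.\<close>

lemma ae_zero_of_integrals: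
  fixes g :: "real \<Rightarrow> 'a::euclidean_space"
  assumes "\<And>a b. set_integrable lebesgue {a..b} g" "\<And>a b. integral {a..b} g = 0"
  shows "AE x in lebesgue. g x = 0"
proof -
  have "\<And>a b. g integrable_on cbox a b" using assms(1) set_lebesgue_integral_eq_integral(1) by (metis cbox_interval)
  then obtain N where N: "negligible N" "\<And>x e. x \<notin> N \<Longrightarrow> 0 < e \<Longrightarrow>
       \<exists>d>0. \<forall>h. 0 < h \<and> h < d \<longrightarrow> norm(integral (cbox x (x + h *\<^sub>R One)) g /\<^sub>R h ^ DIM(real) - g x) < e"
    using integrable_ccontinuous_explicit[of g] by metis
  have "g x = 0" if "x \<notin> N" for x
  proof -
    have "norm (g x) < e" if "e > 0" for e
    proof -
      obtain d where d: "d > 0" "\<And>h. 0 < h \<and> h < d \<Longrightarrow> norm(integral (cbox x (x + h *\<^sub>R One)) g /\<^sub>R h ^ DIM(real) - g x) < e"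
        using N(2)[OF \<open>x \<notin> N\<close> \<open>e > 0\<close>] by blast
      show ?thesis using d(2)[of "d/2"] d(1) assms(2) by simp
    qed
    then show ?thesis by (metis less_irrefl norm_eq_zero zero_less_norm_iff)
  qed
  then show ?thesis using N(1) by (intro AE_I'[of N]) (auto simp: negligible_iff_null_sets)
qed

text \<open>The common ground of L2 functions and continuous functions on an edge. It is enough for
  pairing with a test function, whose support is compact in the interior; intervals reaching a
  closed endpoint of I are included in the condition.\<close>

definition locint :: "real set \<Rightarrow> (real \<Rightarrow> 'a::{banach,second_countable_topology}) \<Rightarrow> bool" where
  "locint I g \<longleftrightarrow> (\<forall>a b. {a..b} \<subseteq> I \<longrightarrow> set_integrable lebesgue {a..b} g)"

lemma locintD: "locint I g \<Longrightarrow> {a..b} \<subseteq> I \<Longrightarrow> set_integrable lebesgue {a..b} g"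
  by (auto simp: locint_def)

text \<open>The point x0 is adjoined to the support so that the interval is nonempty and passes
  through a prescribed point; its union with any other interval around x0 is again an interval,
  which \<open>du_Bois_Reymond\<close> relies on.\<close>

lemma test_support:
  assumes "test_function I \<eta>" "is_interval I" "x0 \<in> interior I"
  obtains a b where "a < b" "{a..b} \<subseteq> interior I" "\<And>x. x \<notin> {a<..<b} \<Longrightarrow> \<eta> x = 0" "x0 \<in> {a<..<b}"
proof -
  obtain K where K: "compact K" "K \<subseteq> interior I" "\<And>x. x \<notin> K \<Longrightarrow> \<eta> x = 0"
    using assms unfolding test_function_def by blast
  define K' where "K' = insert x0 K"
  have K': "compact K'" "K' \<subseteq> interior I" "K' \<noteq> {}" using K assms(3) by (auto simp: K'_def)
  obtain m where m: "m \<in> K'" "\<And>x. x \<in> K' \<Longrightarrow> m \<le> x" using compact_attains_inf[OF K'(1,3)] by blast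
  obtain M where M: "M \<in> K'" "\<And>x. x \<in> K' \<Longrightarrow> x \<le> M" using compact_attains_sup[OF K'(1,3)] by blast
  obtain e1 where e1: "e1 > 0" "cball m e1 \<subseteq> interior I"
    using K'(2) m(1) open_interior open_contains_cball by (metis subsetD)
  obtain e2 where e2: "e2 > 0" "cball M e2 \<subseteq> interior I"
    using K'(2) M(1) open_interior open_contains_cball by (metis subsetD)
  define a b where "a = m - e1" and "b = M + e2"
  have "m \<le> M" using m M by blast
  then have "a < b" using e1 e2 by (simp add: a_def b_def)
  moreover have "is_interval (interior I)" using assms(2)
    using convex_interior is_interval_convex_1 by blast
  moreover have "a \<in> cball m e1" "b \<in> cball M e2" using e1 e2 by (auto simp: a_def b_def dist_real_def)
  moreover from this have "a \<in> interior I" "b \<in> interior I" using e1 e2 by blast+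
  ultimately have sub: "{a..b} \<subseteq> interior I" using mem_is_interval_1_I[of "interior I" a b] by auto
  have K'ab: "x \<in> {a<..<b}" if "x \<in> K'" for x
    using m(2)[OF that] M(2)[OF that] e1(1) e2(1) by (simp add: a_def b_def)
  show ?thesis
  proof (rule that)
    show "a < b" by fact
    show "{a..b} \<subseteq> interior I" by fact
    show "\<eta> x = 0" if "x \<notin> {a<..<b}" for x using K(3)[of x] K'ab[of x] that by (auto simp: K'_def)
    show "x0 \<in> {a<..<b}" by (rule K'ab) (simp add: K'_def)
  qed
qed

lemma LINT_support:
  fixes f :: "real \<Rightarrow> 'a::{banach,second_countable_topology}"
  assumes "A \<subseteq> I" "\<And>x. x \<notin> A \<Longrightarrow> f x = 0"
  shows "(LINT x:I|lebesgue. f x) = (LINT x:A|lebesgue. f x)"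
    and "set_integrable lebesgue I f = set_integrable lebesgue A f"
proof -
  have "indicator I x *\<^sub>R f x = indicator A x *\<^sub>R f x" for x using assms by (auto simp: indicator_def)
  then show "(LINT x:I|lebesgue. f x) = (LINT x:A|lebesgue. f x)" "set_integrable lebesgue I f = set_integrable lebesgue A f"
    unfolding set_lebesgue_integral_def set_integrable_def by presburger+
qed

lemma cont_mult_integrable:
  fixes g :: "real \<Rightarrow> 'a::{banach,second_countable_topology}"
  assumes "set_integrable lebesgue {a..b} g" "continuous_on {a..b} \<eta>"
  shows "set_integrable lebesgue {a..b} (\<lambda>x. \<eta> x *\<^sub>R g x)"
proof -
  obtain B where B: "\<And>x. x \<in> {a..b} \<Longrightarrow> norm (\<eta> x) \<le> B"
    using compact_imp_bounded[OF compact_continuous_image[OF assms(2) compact_Icc]] unfolding bounded_iff by blast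
  have m: "(\<lambda>x. indicator {a..b} x *\<^sub>R g x) \<in> borel_measurable lebesgue"
    using assms(1) unfolding set_integrable_def by simp
  have "\<eta> \<in> borel_measurable (lebesgue_on {a..b})" using assms(2)
    by (simp add: continuous_imp_measurable_on_sets_lebesgue)
  then have m2: "(\<lambda>x. indicator {a..b} x *\<^sub>R \<eta> x) \<in> borel_measurable lebesgue"
    by (subst (asm) borel_measurable_restrict_space_iff) auto
  show ?thesis
    unfolding set_integrable_def
  proof (rule Bochner_Integration.integrable_bound)
    show "integrable lebesgue (\<lambda>x. B *\<^sub>R (indicator {a..b} x *\<^sub>R g x))"
      using assms(1) unfolding set_integrable_def by (rule integrable_scaleR_right)
    have "(\<lambda>x. indicator {a..b} x *\<^sub>R \<eta> x *\<^sub>R g x) = (\<lambda>x. (indicator {a..b} x *\<^sub>R \<eta> x) *\<^sub>R (indicator {a..b} x *\<^sub>R g x))"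
      by (auto simp: indicator_def)
    then show "(\<lambda>x. indicator {a..b} x *\<^sub>R \<eta> x *\<^sub>R g x) \<in> borel_measurable lebesgue"
      using borel_measurable_scaleR[OF m2 m] by (simp only:)
    show "AE x in lebesgue. norm (indicator {a..b} x *\<^sub>R \<eta> x *\<^sub>R g x) \<le> norm (B *\<^sub>R indicator {a..b} x *\<^sub>R g x)"
      using B by (intro AE_I2) (fastforce simp: indicator_def intro!: mult_right_mono)
  qed
qed

lemma test_deriv:
  assumes "test_function I \<eta>"
  shows "(\<eta> has_real_derivative deriv \<eta> x) (at x)" "continuous_on UNIV (deriv \<eta>)" "continuous_on UNIV \<eta>"
proof -
  obtain D where D: "\<And>x. (\<eta> has_real_derivative D x) (at x)" "continuous_on UNIV D"
    using assms unfolding test_function_def C1_differentiable_on_def has_real_derivative_iff_has_vector_derivative by blast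
  have "deriv \<eta> = D" using D(1) DERIV_imp_deriv by blast
  then show "(\<eta> has_real_derivative deriv \<eta> x) (at x)" "continuous_on UNIV (deriv \<eta>)" using D by auto
  show "continuous_on UNIV \<eta>" using D(1) by (meson DERIV_isCont continuous_at_imp_continuous_on)
qed

lemma test_deriv_support:
  assumes "\<And>x. x \<notin> {a<..<b} \<Longrightarrow> \<eta> x = 0" "x \<notin> {a..b::real}"
  shows "deriv \<eta> x = (0::real)"
proof -
  have "((\<lambda>_. 0) has_real_derivative 0) (at x)" by simp
  then have "(\<eta> has_real_derivative 0) (at x)"
    by (rule has_field_derivative_transform_within_open[where S="-{a..b}"]) (use assms in auto)
  then show ?thesis by (rule DERIV_imp_deriv)
qed

lemma test_integrable:
  fixes g :: "real \<Rightarrow> 'a::{banach,second_countable_topology}"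
  assumes "test_function I \<eta>" "is_interval I" "interior I \<noteq> {}" "locint I g"
  shows "set_integrable lebesgue I (\<lambda>x. \<eta> x *\<^sub>R g x)" "set_integrable lebesgue I (\<lambda>x. deriv \<eta> x *\<^sub>R g x)"
proof -
  obtain x0 where "x0 \<in> interior I" using assms by blast
  then obtain a b where ab: "a < b" "{a..b} \<subseteq> interior I" "\<And>x. x \<notin> {a<..<b} \<Longrightarrow> \<eta> x = 0" 
    using test_support[OF assms(1,2)] by metis
  have sub: "{a..b} \<subseteq> I" using ab(2) interior_subset by blast
  have i: "set_integrable lebesgue {a..b} g" using assms(4) sub by (rule locintD)
  have s1: "\<And>x. x \<notin> {a..b} \<Longrightarrow> \<eta> x *\<^sub>R g x = 0" using ab(3) by auto
  have s2: "\<And>x. x \<notin> {a..b} \<Longrightarrow> deriv \<eta> x *\<^sub>R g x = 0" using test_deriv_support[OF ab(3)] by auto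
  show "set_integrable lebesgue I (\<lambda>x. \<eta> x *\<^sub>R g x)"
    by (subst LINT_support(2)[OF sub s1], assumption)
      (rule cont_mult_integrable[OF i continuous_on_subset[OF test_deriv(3)[OF assms(1)] subset_UNIV]])
  show "set_integrable lebesgue I (\<lambda>x. deriv \<eta> x *\<^sub>R g x)"
    by (subst LINT_support(2)[OF sub s2], assumption)
      (rule cont_mult_integrable[OF i continuous_on_subset[OF test_deriv(2)[OF assms(1)] subset_UNIV]])
qed

text \<open>Dominated convergence along the bumps shows that g has integral zero over every compact
  interval inside the interior, and Lebesgue differentiation turns this into g = 0 almost
  everywhere.\<close>

lemma fundamental_lemma_interior:
  fixes g :: "real \<Rightarrow> 'a::euclidean_space"
  assumes g: "locint I g"
    and 0: "\<And>\<eta>. test_function I \<eta> \<Longrightarrow> (LINT x:I|lebesgue. \<eta> x *\<^sub>R g x) = 0"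
  shows "AE x in lebesgue. x \<in> interior I \<longrightarrow> g x = 0"
proof -
  have int0: "integral {x..y} g = 0" if xy: "{x..y} \<subseteq> interior I" for x y
  proof (cases "x < y")
    case True
    have sub: "{x..y} \<subseteq> I" using xy interior_subset by blast
    have gi: "set_integrable lebesgue {x..y} g" using g sub by (rule locintD)
    have i1: "set_integrable lebesgue {x..y} (\<lambda>t. bump x y n t *\<^sub>R g t)" for n
      by (rule cont_mult_integrable[OF gi continuous_on_subset[OF test_deriv(3)[OF bump_test[OF xy]]]]) simp
    have z: "(LINT t:{x..y}|lebesgue. bump x y n t *\<^sub>R g t) = 0" for n
    proof -
      have "(LINT t:I|lebesgue. bump x y n t *\<^sub>R g t) = (LINT t:{x..y}|lebesgue. bump x y n t *\<^sub>R g t)"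
        by (rule LINT_support[OF sub]) (simp add: bump_0)
      then show ?thesis using 0[OF bump_test[OF xy]] by simp
    qed
    have "(\<lambda>n. LINT t:{x..y}|lebesgue. bump x y n t *\<^sub>R g t) \<longlonglongrightarrow> (LINT t:{x..y}|lebesgue. g t)"
      unfolding set_lebesgue_integral_def
    proof (rule integral_dominated_convergence[where w="\<lambda>t. norm (indicator {x..y} t *\<^sub>R g t)"])
      show "integrable lebesgue (\<lambda>t. norm (indicator {x..y} t *\<^sub>R g t))"
        using gi unfolding set_integrable_def by (rule integrable_norm)
      show "(\<lambda>x'. indicator {x..y} x' *\<^sub>R g x') \<in> borel_measurable lebesgue" using gi unfolding set_integrable_def by simp
      show "(\<lambda>x'. indicator {x..y} x' *\<^sub>R bump x y i x' *\<^sub>R g x') \<in> borel_measurable lebesgue" for i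
        using i1 unfolding set_integrable_def by simp
      show "AE x' in lebesgue. norm (indicator {x..y} x' *\<^sub>R bump x y i x' *\<^sub>R g x') \<le> norm (indicator {x..y} x' *\<^sub>R g x')" for i
        using bump_bounds by (intro AE_I2) (auto simp: indicator_def mult_left_le_one_le)
      have "AE t in lebesgue. t \<notin> {x,y}"
        by (intro AE_I'[of "{x,y}"]) (auto simp: negligible_iff_null_sets[symmetric])
      then show "AE x' in lebesgue. (\<lambda>i. indicator {x..y} x' *\<^sub>R bump x y i x' *\<^sub>R g x') \<longlonglongrightarrow> indicator {x..y} x' *\<^sub>R g x'"
      proof (rule AE_mp, intro AE_I2 impI)
        fix t assume t: "t \<notin> {x,y}"
        show "(\<lambda>i. indicator {x..y} t *\<^sub>R bump x y i t *\<^sub>R g t) \<longlonglongrightarrow> indicator {x..y} t *\<^sub>R g t"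
        proof (cases "t \<in> {x..y}")
          case True
          then have "(\<lambda>i. bump x y i t *\<^sub>R g t) \<longlonglongrightarrow> 1 *\<^sub>R g t"
            using t by (intro tendsto_intros bump_lim) auto
          then show ?thesis using True by simp
        qed simp
      qed
    qed
    then have "(LINT t:{x..y}|lebesgue. g t) = 0" unfolding z using LIMSEQ_unique[OF _ tendsto_const] by metis
    then show ?thesis using set_lebesgue_integral_eq_integral(2)[OF gi] by simp
  next
    case False
    then consider "{x..y} = {}" | "y = x" by fastforce
    then show ?thesis using integral_refl[of x g] by cases (auto simp: cbox_interval)
  qed
  \<comment> \<open>Rational endpoints keep the number of exceptional null sets countable. Cutting g
    off outside the interval gives a function on the whole line, as
    \<open>ae_zero_of_integrals\<close> requires.\<close>
  have 1: "AE x in lebesgue. {real_of_rat p..real_of_rat q} \<subseteq> interior I \<longrightarrow> x \<in> {real_of_rat p..real_of_rat q} \<longrightarrow> g x = 0" for p q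
  proof (cases "{real_of_rat p..real_of_rat q} \<subseteq> interior I")
    case True
    let ?A = "{real_of_rat p..real_of_rat q}"
    define h where "h x = (if x \<in> ?A then g x else 0)" for x
    have "?A \<subseteq> I" using True interior_subset by blast
    then have gi: "set_integrable lebesgue ?A g" using g by (intro locintD)
    have eq: "{a..b} \<inter> ?A = {max a (real_of_rat p)..min b (real_of_rat q)}" for a b by auto
    have "AE x in lebesgue. h x = 0"
    proof (rule ae_zero_of_integrals)
      fix a b
      have e: "indicator {a..b} x *\<^sub>R h x = indicator ({a..b} \<inter> ?A) x *\<^sub>R g x" for x
        by (auto simp: h_def indicator_def)
      have gi2: "set_integrable lebesgue ({a..b} \<inter> ?A) g"
        by (rule set_integrable_subset[OF gi]) auto
      show hi: "set_integrable lebesgue {a..b} h"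
        using gi2 by (simp only: set_integrable_def e)
      have "integral {a..b} h = (LINT x:{a..b}|lebesgue. h x)" using set_lebesgue_integral_eq_integral(2)[OF hi] by simp
      also have "\<dots> = (LINT x:({a..b} \<inter> ?A)|lebesgue. g x)" by (simp only: set_lebesgue_integral_def e)
      also have "\<dots> = integral ({a..b} \<inter> ?A) g" using set_lebesgue_integral_eq_integral(2)[OF gi2] by simp
      also have "\<dots> = 0" unfolding eq by (rule int0) (use True in auto)
      finally show "integral {a..b} h = 0" .
    qed
    then show ?thesis by (rule eventually_mono) (auto simp: h_def split: if_splits)
  qed auto
  have "AE x in lebesgue. \<forall>p q. {real_of_rat p..real_of_rat q} \<subseteq> interior I \<longrightarrow> x \<in> {real_of_rat p..real_of_rat q} \<longrightarrow> g x = 0"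
    using 1 by (simp add: AE_all_countable)
  then show ?thesis
  proof (rule AE_mp, intro AE_I2 impI)
    fix x assume *: "\<forall>p q. {real_of_rat p..real_of_rat q} \<subseteq> interior I \<longrightarrow> x \<in> {real_of_rat p..real_of_rat q} \<longrightarrow> g x = 0"
      and "x \<in> interior I"
    from \<open>x \<in> interior I\<close> obtain e where e: "e > 0" "cball x e \<subseteq> interior I"
      using open_contains_cball[of "interior I"] by auto
    obtain p where p: "x - e < real_of_rat p" "real_of_rat p < x" using of_rat_dense[of "x - e" x] e by auto
    obtain q where q: "x < real_of_rat q" "real_of_rat q < x + e" using of_rat_dense[of x "x+e"] e by auto
    have "{real_of_rat p..real_of_rat q} \<subseteq> cball x e" using p q by (auto simp: dist_real_def)
    then have "{real_of_rat p..real_of_rat q} \<subseteq> interior I" using e(2) by (rule subset_trans)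
    moreover have "x \<in> {real_of_rat p..real_of_rat q}" using p q by simp
    ultimately show "g x = 0" using * by blast
  qed
qed

lemma negligible_interval_boundary:
  fixes I :: "real set"
  assumes "is_interval I"
  shows "negligible (I - interior I)"
  by (rule negligible_subset[OF negligible_convex_frontier[OF is_interval_convex[OF assms]]])
    (use closure_subset in \<open>auto simp: frontier_def\<close>)

lemma fundamental_lemma:
  fixes g :: "real \<Rightarrow> 'a::euclidean_space"
  assumes I: "is_interval I" and g: "locint I g"
    and 0: "\<And>\<eta>. test_function I \<eta> \<Longrightarrow> (LINT x:I|lebesgue. \<eta> x *\<^sub>R g x) = 0"
  shows "AE x in lebesgue. x \<in> I \<longrightarrow> g x = 0"
proof -
  have "AE x in lebesgue. x \<notin> I - interior I"
    using negligible_interval_boundary[OF I] by (intro AE_I'[of "I - interior I"]) (auto simp: negligible_iff_null_sets[symmetric])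
  with fundamental_lemma_interior[OF g] 0 have "AE x in lebesgue. (x \<in> interior I \<longrightarrow> g x = 0) \<and> x \<notin> I - interior I" by auto
  then show ?thesis by eventually_elim auto
qed

section \<open>Weak derivatives and classical derivatives\<close>

lemma locint_L2:
  fixes u :: "real \<Rightarrow> 'a::{banach,second_countable_topology}"
  assumes "u \<in> L2_on I"
  shows "locint I u"
  unfolding locint_def
proof (intro allI impI)
  fix a b assume ab: "{a..b} \<subseteq> I"
  have m: "(\<lambda>x. indicator I x *\<^sub>R u x) \<in> borel_measurable lebesgue" and
    i: "set_integrable lebesgue I (\<lambda>x. (norm (u x))\<^sup>2)"
    using assms by (auto simp: L2_on_def set_borel_measurable_def)
  have i2: "set_integrable lebesgue {a..b} (\<lambda>x. (norm (u x))\<^sup>2)"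
    by (rule set_integrable_subset[OF i]) (use ab in auto)
  have i3: "set_integrable lebesgue {a..b} (\<lambda>x. 1::real)"
    by (rule absolutely_integrable_continuous_real) (rule continuous_on_const)
  show "set_integrable lebesgue {a..b} u"
    unfolding set_integrable_def
  proof (rule Bochner_Integration.integrable_bound)
    show "integrable lebesgue (\<lambda>x. indicator {a..b} x *\<^sub>R ((norm (u x))\<^sup>2 + 1))"
      using set_integral_add(1)[OF i2 i3] unfolding set_integrable_def .
    have m3: "(\<lambda>x. indicator {a..b} x :: real) \<in> borel_measurable lebesgue" by (rule borel_measurable_indicator) simp
    have "(\<lambda>x. indicator {a..b} x *\<^sub>R u x) = (\<lambda>x. (indicator {a..b} x :: real) *\<^sub>R indicator I x *\<^sub>R u x)"
      using ab by (fastforce simp: indicator_def)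
    then show "(\<lambda>x. indicator {a..b} x *\<^sub>R u x) \<in> borel_measurable lebesgue"
      using borel_measurable_scaleR[OF m3 m] by (simp only:)
    have "t \<le> t\<^sup>2 + 1" for t :: real
      using zero_le_power2[of "t - 1/2"] by (simp add: power2_eq_square algebra_simps)
    then show "AE x in lebesgue. norm (indicator {a..b} x *\<^sub>R u x) \<le> norm (indicator {a..b} x *\<^sub>R ((norm (u x))\<^sup>2 + 1))"
      by (intro AE_I2) (auto simp: indicator_def)
  qed
qed

lemma cont_locint: "continuous_on I u \<Longrightarrow> locint I u"
  for u :: "real \<Rightarrow> 'a::euclidean_space"
  unfolding locint_def by (meson absolutely_integrable_continuous_real continuous_on_subset)

lemma locint_diff: "locint I u \<Longrightarrow> locint I v \<Longrightarrow> locint I (\<lambda>x. u x - v x)"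
  unfolding locint_def by (auto intro: set_integral_diff)

lemma cont_L2: "continuous_on {a..b} u \<Longrightarrow> u \<in> L2_on {a..b}"
  for u :: "real \<Rightarrow> 'a::euclidean_space"
  unfolding L2_on_def
proof safe
  assume c: "continuous_on {a..b} u"
  show "set_borel_measurable lebesgue {a..b} u"
    using absolutely_integrable_continuous_real[OF c] unfolding set_integrable_def set_borel_measurable_def by auto
  show "set_integrable lebesgue {a..b} (\<lambda>x. (norm (u x))\<^sup>2)"
    by (intro absolutely_integrable_continuous_real continuous_intros c)
qed

lemma antiderivative_UNIV:
  fixes f :: "real \<Rightarrow> real"
  assumes "continuous_on UNIV f"
  obtains F where "\<And>x. (F has_real_derivative f x) (at x)"
proof -
  have "\<exists>F. \<forall>x::real. -\<infinity> < ereal x \<longrightarrow> ereal x < \<infinity> \<longrightarrow> (F has_vector_derivative f x) (at x)"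
    by (rule einterval_antiderivative) (use assms in \<open>auto simp: continuous_on_eq_continuous_at\<close>)
  then show ?thesis using that by (auto simp: has_real_derivative_iff_has_vector_derivative)
qed

lemma deriv_zero_const:
  fixes F :: "real \<Rightarrow> real"
  assumes "\<And>x. x \<in> S \<Longrightarrow> (F has_real_derivative 0) (at x)" "convex S" "x \<in> S" "y \<in> S"
  shows "F x = F y"
proof -
  obtain c where "\<And>x. x \<in> S \<Longrightarrow> F x = c"
    using has_field_derivative_zero_constant[OF assms(2), of F] assms(1) has_field_derivative_at_within by metis
  then show ?thesis using assms(3,4) by metis
qed

lemma bump_pos: "x < t \<Longrightarrow> t < y \<Longrightarrow> n > 0 \<Longrightarrow> bump x y n t > 0"
proof -
  define G where "G = real n * ((max 0 (t - x))\<^sup>2 * (max 0 (y - t))\<^sup>2)"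
  assume "x < t" "t < y" "n > 0"
  then have G: "0 < G" by (simp add: G_def)
  have e: "bump x y n t = G / (1 + G)" by (simp add: bump_def Let_def G_def)
  show "bump x y n t > 0" unfolding e using G by (simp add: divide_simps)
qed

lemma primitive_outside:
  fixes A :: "real \<Rightarrow> real"
  assumes "\<And>x. (A has_real_derivative \<eta> x) (at x)" "\<And>x. x \<notin> {a<..<b} \<Longrightarrow> \<eta> x = 0"
  shows "x \<le> y \<Longrightarrow> y \<le> a \<Longrightarrow> A x = A y" "b \<le> x \<Longrightarrow> x \<le> y \<Longrightarrow> A x = A y"
proof -
  have z: "(A has_real_derivative 0) (at x)" if "x \<notin> {a<..<b}" for x using assms that by metis
  show "x \<le> y \<Longrightarrow> y \<le> a \<Longrightarrow> A x = A y" by (rule deriv_zero_const[of "{..a}"]) (auto intro!: z)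
  show "b \<le> x \<Longrightarrow> x \<le> y \<Longrightarrow> A x = A y" by (rule deriv_zero_const[of "{b..}"]) (auto intro!: z)
qed

text \<open>A test function \<eta> need not be the derivative of a test function, but \<eta> - k
  \<beta> is when k balances the masses. Testing g with the primitive shows that g - C annihilates
  \<eta>, where C is the \<beta>-weighted mean of g, and the fundamental lemma applies.\<close>

lemma du_Bois_Reymond:
  fixes g :: "real \<Rightarrow> 'a::euclidean_space"
  assumes I: "is_interval I" and ne: "interior I \<noteq> {}" and g: "locint I g"
    and 0: "\<And>\<eta>. test_function I \<eta> \<Longrightarrow> (LINT x:I|lebesgue. deriv \<eta> x *\<^sub>R g x) = 0"
  obtains C where "AE x in lebesgue. x \<in> I \<longrightarrow> g x = C"
proof -
  obtain x0 where x0: "x0 \<in> interior I" using ne by blast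
  obtain e where e: "e > 0" "cball x0 e \<subseteq> interior I" using x0 open_contains_cball[of "interior I"] by auto
  define p q where "p = x0 - e" and "q = x0 + e"
  have pq: "p < q" "p < x0" "x0 < q" "{p..q} \<subseteq> interior I" using e by (auto simp: p_def q_def cball_eq_atLeastAtMost)
  define \<beta> where "\<beta> = bump p q 1"
  have tb: "test_function I \<beta>" unfolding \<beta>_def by (rule bump_test[OF pq(4)])
  have cb: "continuous_on UNIV \<beta>" using test_deriv(3)[OF tb] .
  have b0: "\<beta> x = 0" if "x \<notin> {p<..<q}" for x using that by (auto simp: \<beta>_def bump_def Let_def)
  obtain B where B: "\<And>x. (B has_real_derivative \<beta> x) (at x)" using antiderivative_UNIV[OF cb] by blast
  define m where "m = B q - B p"
  have "B p < B q"
    by (rule DERIV_pos_imp_increasing_open[OF pq(1)])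
      (use B bump_pos[of p _ q 1] in \<open>auto simp: \<beta>_def intro!: continuous_at_imp_continuous_on DERIV_isCont exI\<close>)
  then have m: "m > 0" by (simp add: m_def)
  define G where "G = (LINT x:I|lebesgue. \<beta> x *\<^sub>R g x)"
  define C where "C = (1 / m) *\<^sub>R G"
  have key: "(LINT x:I|lebesgue. \<eta> x *\<^sub>R (g x - C)) = 0" if t: "test_function I \<eta>" for \<eta>
  proof -
    obtain a b where ab: "a < b" "{a..b} \<subseteq> interior I" "\<And>x. x \<notin> {a<..<b} \<Longrightarrow> \<eta> x = 0" "x0 \<in> {a<..<b}"
      using test_support[OF t I x0] by metis
    have ce: "continuous_on UNIV \<eta>" using test_deriv(3)[OF t] .
    obtain A where A: "\<And>x. (A has_real_derivative \<eta> x) (at x)" using antiderivative_UNIV[OF ce] by blast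
    define lo hi where "lo = min a p" and "hi = max b q"
    have sub: "{lo..hi} \<subseteq> interior I"
    proof
      fix x assume "x \<in> {lo..hi}"
      then have "x \<in> {a..b} \<or> x \<in> {p..q}" using ab(4) pq(1-3) unfolding lo_def hi_def
        by (smt (verit) atLeastAtMost_iff greaterThanLessThan_iff)
      then consider "x \<in> {a..b}" | "x \<in> {p..q}" by blast
      then show "x \<in> interior I" using ab(2) pq(4) by cases auto
    qed
    have lh: "lo \<le> a" "lo \<le> p" "b \<le> hi" "q \<le> hi" "lo \<le> hi" using ab(1) by (auto simp: lo_def hi_def)
    have eta0: "\<eta> x = 0" if "x \<notin> {lo<..<hi}" for x using ab(3) that lh by auto
    have beta0: "\<beta> x = 0" if "x \<notin> {lo<..<hi}" for x using b0 that lh by auto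
    have mB: "B hi - B lo = m"
      using primitive_outside(1)[OF B b0, where x=lo and y=p] primitive_outside(2)[OF B b0, where x=q and y=hi] lh by (simp add: m_def)
    \<comment> \<open>Dividing by the mass m of \<beta> makes the total mass of \<eta> - k \<beta>
      zero, so that its primitive \<Theta> vanishes to the right of hi as well as to the left of
      lo.\<close>
    define k where "k = (A hi - A lo) / m"
    define \<Theta> where "\<Theta> x = (A x - A lo) - k * (B x - B lo)" for x
    have d: "(\<Theta> has_real_derivative (\<eta> x - k * \<beta> x)) (at x)" for x
      unfolding \<Theta>_def by (rule derivative_eq_intros A B refl)+ simp
    have tT: "test_function I \<Theta>"
    proof (rule test_functionI[where K="{lo..hi}"])
      show "(\<Theta> has_real_derivative (\<eta> x - k * \<beta> x)) (at x)" for x by (rule d)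
      show "continuous_on UNIV (\<lambda>x. \<eta> x - k * \<beta> x)" by (intro continuous_intros ce cb)
      show "\<Theta> x = 0" if "x \<notin> {lo..hi}" for x
      proof (cases "x < lo")
        case True
        then show ?thesis
          using primitive_outside(1)[OF A eta0, where x=x and y=lo] primitive_outside(1)[OF B beta0, where x=x and y=lo] by (auto simp: \<Theta>_def)
      next
        case False
        then have "A x = A hi" "B x = B hi"
          using primitive_outside(2)[OF A eta0, where x=hi and y=x] primitive_outside(2)[OF B beta0, where x=hi and y=x] that by auto
        then show ?thesis using mB m by (simp add: \<Theta>_def k_def)
      qed
    qed (use sub in auto)
    have dT: "deriv \<Theta> = (\<lambda>x. \<eta> x - k * \<beta> x)" using d DERIV_imp_deriv by blast
    note ie = test_integrable(1)[OF t I ne g] and ib = test_integrable(1)[OF tb I ne g]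
    have ib': "set_integrable lebesgue I (\<lambda>x. k *\<^sub>R (\<beta> x *\<^sub>R g x))" using ib by (rule set_integrable_scaleR_right)
    have "0 = (LINT x:I|lebesgue. \<eta> x *\<^sub>R g x - k *\<^sub>R (\<beta> x *\<^sub>R g x))"
      using 0[OF tT] unfolding dT by (simp add: scaleR_diff_left)
    also have "\<dots> = (LINT x:I|lebesgue. \<eta> x *\<^sub>R g x) - k *\<^sub>R G"
      unfolding set_integral_diff(2)[OF ie ib'] G_def set_integral_scaleR_right ..
    finally have 1: "(LINT x:I|lebesgue. \<eta> x *\<^sub>R g x) = k *\<^sub>R G" by simp
    have subI: "{lo..hi} \<subseteq> I" using sub interior_subset by blast
    have ei: "set_integrable lebesgue {lo..hi} \<eta>"
      by (rule absolutely_integrable_continuous_real[OF continuous_on_subset[OF ce subset_UNIV]])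
    have "(LINT x:I|lebesgue. \<eta> x) = (LINT x:{lo..hi}|lebesgue. \<eta> x)"
      by (rule LINT_support[OF subI]) (use eta0 in auto)
    also have "\<dots> = integral {lo..hi} \<eta>" using set_lebesgue_integral_eq_integral(2)[OF ei] .
    also have "\<dots> = A hi - A lo"
      by (intro integral_unique fundamental_theorem_of_calculus lh(5))
         (use A has_real_derivative_iff_has_vector_derivative has_vector_derivative_at_within in blast)
    finally have 2: "(LINT x:I|lebesgue. \<eta> x) = k * m" using m by (simp add: k_def)
    have eI: "set_integrable lebesgue I \<eta>"
      by (subst LINT_support(2)[OF subI]) (use ei eta0 in auto)
    have iC: "set_integrable lebesgue I (\<lambda>x. \<eta> x *\<^sub>R C)" using eI by (rule set_integrable_scaleR_left)
    have "(LINT x:I|lebesgue. \<eta> x *\<^sub>R (g x - C)) = (LINT x:I|lebesgue. \<eta> x *\<^sub>R g x) - (LINT x:I|lebesgue. \<eta> x *\<^sub>R C)"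
      unfolding scaleR_diff_right by (rule set_integral_diff(2)[OF ie iC])
    also have "(LINT x:I|lebesgue. \<eta> x *\<^sub>R C) = (LINT x:I|lebesgue. \<eta> x) *\<^sub>R C"
      using integral_scaleR_left[of C lebesgue "\<lambda>x. indicator I x *\<^sub>R \<eta> x"] eI
      unfolding set_lebesgue_integral_def set_integrable_def by simp
    finally show ?thesis unfolding 1 2 C_def using m by simp
  qed
  have lg: "locint I (\<lambda>x. g x - C)" by (intro locint_diff g cont_locint continuous_on_const)
  have "AE x in lebesgue. x \<in> I \<longrightarrow> g x - C = 0"
    using fundamental_lemma[OF I lg] key by blast
  then show ?thesis by (intro that[of C]) simp
qed

lemma classical_weak_deriv:
  fixes u :: "real \<Rightarrow> 'a::euclidean_space"
  assumes I: "is_interval I" and ne: "interior I \<noteq> {}"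
    and d: "\<And>x. x \<in> I \<Longrightarrow> (u has_vector_derivative u' x) (at x within I)"
    and c: "continuous_on I u'"
  shows "is_weak_deriv I u u'"
  unfolding is_weak_deriv_def
proof (intro allI impI)
  fix \<eta> assume t: "test_function I \<eta>"
  obtain x0 where x0: "x0 \<in> interior I" using ne by blast
  obtain a b where ab: "a < b" "{a..b} \<subseteq> interior I" "\<And>x. x \<notin> {a<..<b} \<Longrightarrow> \<eta> x = 0"
    using test_support[OF t I x0] by metis
  have sub: "{a..b} \<subseteq> I" using ab(2) interior_subset by blast
  have cu: "continuous_on I u" by (rule continuous_on_vector_derivative[OF d])
  note iu = test_integrable(2)[OF t I ne cont_locint[OF cu]] and iu' = test_integrable(1)[OF t I ne cont_locint[OF c]]
  have z: "\<And>x. x \<notin> {a..b} \<Longrightarrow> \<eta> x *\<^sub>R u' x + deriv \<eta> x *\<^sub>R u x = 0"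
    using ab(3) test_deriv_support[OF ab(3)] by auto
  have "(LINT x:I|lebesgue. deriv \<eta> x *\<^sub>R u x) + (LINT x:I|lebesgue. \<eta> x *\<^sub>R u' x)
     = (LINT x:I|lebesgue. \<eta> x *\<^sub>R u' x + deriv \<eta> x *\<^sub>R u x)"
    using set_integral_add(2)[OF iu' iu] by simp
  also have "\<dots> = (LINT x:{a..b}|lebesgue. \<eta> x *\<^sub>R u' x + deriv \<eta> x *\<^sub>R u x)"
    by (rule LINT_support(1)[OF sub z])
  also have "\<dots> = integral {a..b} (\<lambda>x. \<eta> x *\<^sub>R u' x + deriv \<eta> x *\<^sub>R u x)"
    by (intro set_lebesgue_integral_eq_integral(2) set_integrable_subset[OF set_integral_add(1)[OF iu' iu]] sub) simp
  also have "\<dots> = \<eta> b *\<^sub>R u b - \<eta> a *\<^sub>R u a"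
  proof (intro integral_unique fundamental_theorem_of_calculus)
    fix x assume x: "x \<in> {a..b}"
    have "(u has_vector_derivative u' x) (at x within {a..b})"
      using d[of x] x sub has_vector_derivative_within_subset by blast
    moreover have "(\<eta> has_field_derivative deriv \<eta> x) (at x within {a..b})"
      using test_deriv(1)[OF t] has_field_derivative_at_within by blast
    ultimately show "((\<lambda>x. \<eta> x *\<^sub>R u x) has_vector_derivative \<eta> x *\<^sub>R u' x + deriv \<eta> x *\<^sub>R u x) (at x within {a..b})"
      by (intro has_vector_derivative_scaleR)
  qed (use ab in simp)
  also have "\<dots> = 0" using ab(3) by simp
  finally show "(LINT x:I|lebesgue. deriv \<eta> x *\<^sub>R u x) = - (LINT x:I|lebesgue. \<eta> x *\<^sub>R u' x)"
    by (simp add: eq_neg_iff_add_eq_0)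
qed

lemma LINT_cong_on:
  fixes f g :: "real \<Rightarrow> 'a::{banach,second_countable_topology}"
  assumes "set_integrable lebesgue I f" "set_integrable lebesgue I g" "AE x in lebesgue. x \<in> I \<longrightarrow> f x = g x"
  shows "(LINT x:I|lebesgue. f x) = (LINT x:I|lebesgue. g x)"
  unfolding set_lebesgue_integral_def
proof (rule integral_cong_AE)
  show "AE x in lebesgue. indicator I x *\<^sub>R f x = indicator I x *\<^sub>R g x"
    using assms(3) by eventually_elim (auto simp: indicator_def)
qed (use assms(1,2) in \<open>auto simp: set_integrable_def\<close>)

lemma weak_deriv_props:
  assumes "u \<in> H1_on I"
  shows "weak_deriv I u \<in> L2_on I" "is_weak_deriv I u (weak_deriv I u)"
proof -
  have "\<exists>g. g \<in> L2_on I \<and> is_weak_deriv I u g" using assms by (auto simp: H1_on_def)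
  from someI_ex[OF this] show "weak_deriv I u \<in> L2_on I" "is_weak_deriv I u (weak_deriv I u)"
    by (auto simp: weak_deriv_def)
qed

lemma antiderivative_on:
  fixes c :: "real \<Rightarrow> 'a::banach"
  assumes I: "I = {a..} \<or> (a < b \<and> I = {a..b})" and c: "continuous_on I c"
  obtains F where "\<And>x. x \<in> I \<Longrightarrow> (F has_vector_derivative c x) (at x within I)"
proof (rule that)
  fix x assume x: "x \<in> I"
  obtain d where s: "{a..d} \<subseteq> I" "x \<in> {a..d}" "at x within {a..d} = at x within I"
  proof (cases "I = {a..}")
    case True
    \<comment> \<open>On the half-line the fundamental theorem is applied on [a, x + 1], which
      contains the same points near x as the half-line.\<close>
    have "at x within {a..x+1} = at x within I"
      by (rule at_within_nhd[of x "{..<x+1}"]) (unfold True, auto)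
    then show ?thesis using that[of "x + 1"] x True by auto
  next
    case False
    then show ?thesis using that[of b] I x by auto
  qed
  have "((\<lambda>x. integral {a..x} c) has_vector_derivative c x) (at x within {a..d})"
    by (rule integral_has_vector_derivative[OF continuous_on_subset[OF c s(1)] s(2)])
  then show "((\<lambda>x. integral {a..x} c) has_vector_derivative c x) (at x within I)" unfolding s(3) .
qed

text \<open>Inside the interior the two functions differ on an open null set, which must be empty;
  the remaining points are limits of interior points.\<close>

lemma cont_AE_eq:
  fixes f g :: "real \<Rightarrow> 'a::euclidean_space"
  assumes cf: "continuous_on I f" and cg: "continuous_on I g" and ae: "AE x in lebesgue. x \<in> I \<longrightarrow> f x = g x"
    and I: "I \<subseteq> closure (interior I)" and x: "x \<in> I"
  shows "f x = g x"
proof -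
  have int: "f y = g y" if y: "y \<in> interior I" for y
  proof (rule ccontr)
    assume ne: "f y \<noteq> g y"
    define S where "S = {z \<in> interior I. f z - g z \<in> - {0}}"
    have "continuous_on (interior I) (\<lambda>z. f z - g z)"
      by (intro continuous_intros continuous_on_subset[OF cf] continuous_on_subset[OF cg] interior_subset)
    then have "open S" unfolding S_def
      using continuous_open_preimage[of "interior I" "\<lambda>z. f z - g z" "- {0}"] by (auto simp: vimage_def Int_def)
    moreover have "negligible S"
    proof -
      have "AE x in lebesgue. x \<notin> S" using ae by eventually_elim (use interior_subset in \<open>auto simp: S_def\<close>)
      then obtain N where "N \<in> null_sets lebesgue" "{x \<in> space lebesgue. \<not> x \<notin> S} \<subseteq> N" by (rule AE_E3) auto
      then show ?thesis by (auto simp: negligible_iff_null_sets[symmetric] intro: negligible_subset)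
    qed
    moreover have "y \<in> S" using y ne by (simp add: S_def)
    ultimately show False using open_not_negligible by blast
  qed
  show ?thesis
  proof -
    obtain X where X: "\<And>n. X n \<in> interior I" "X \<longlonglongrightarrow> x" using I x closure_sequential by blast
    then have XI: "\<And>n. X n \<in> I" using interior_subset by blast
    have "(\<lambda>n. f (X n)) \<longlonglongrightarrow> f x" "(\<lambda>n. g (X n)) \<longlonglongrightarrow> g x"
      using continuous_on_sequentially[of I f] continuous_on_sequentially[of I g] cf cg x X XI by (auto simp: o_def)
    moreover have "(\<lambda>n. f (X n)) = (\<lambda>n. g (X n))" using int X by auto
    ultimately show ?thesis using LIMSEQ_unique by metis
  qed
qed

lemma cont_set_borel_measurable:
  fixes u :: "real \<Rightarrow> 'a::euclidean_space"
  assumes "continuous_on I u" "I \<in> sets lebesgue"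
  shows "set_borel_measurable lebesgue I u"
  using continuous_imp_measurable_on_sets_lebesgue[OF assms] assms(2)
  unfolding set_borel_measurable_def by (subst (asm) borel_measurable_restrict_space_iff) auto

text \<open>The disjunction covers both kinds of edges, so that the regularity results are proved
  once for the half-line and the loops.\<close>

lemma edge_shape:
  assumes I: "I = {a..} \<or> (a < b \<and> I = {a..b::real})"
  shows "is_interval I" "interior I \<noteq> {}" "I \<subseteq> closure (interior I)" "I \<in> sets lebesgue" "a \<in> I"
  using I by (auto simp: is_interval_ci is_interval_cc)

text \<open>Integrating c twice gives a classical function with second derivative c. By du
  Bois-Reymond the weak derivative of u differs from the first integral by a constant, and after
  absorbing it u differs from the second integral by a constant. Membership of u' in L2 is recorded
  because it is what forces decay on the half-line.\<close>

lemma H2_regularity: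
  fixes u :: "real \<Rightarrow> 'a::euclidean_space"
  assumes I: "I = {a..} \<or> (a < b \<and> I = {a..b})"
    and u: "u \<in> H2_on I" and cu: "continuous_on I u" and c: "continuous_on I c"
    and ae: "AE x in lebesgue. x \<in> I \<longrightarrow> weak_deriv I (weak_deriv I u) x = c x"
  obtains u' where "\<And>x. x \<in> I \<Longrightarrow> (u has_vector_derivative u' x) (at x within I)"
    "\<And>x. x \<in> I \<Longrightarrow> (u' has_vector_derivative c x) (at x within I)" "u' \<in> L2_on I"
proof -
  note E = edge_shape[OF I]
  define g where "g = weak_deriv I u"
  define h where "h = weak_deriv I g"
  have g: "g \<in> L2_on I" "is_weak_deriv I u g" and h: "h \<in> L2_on I" "is_weak_deriv I g h"
    using u weak_deriv_props[of u I] weak_deriv_props[of g I] by (auto simp: H2_on_def g_def h_def)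
  obtain V1 where V1: "\<And>x. x \<in> I \<Longrightarrow> (V1 has_vector_derivative c x) (at x within I)" using antiderivative_on[OF I c] by blast
  have cV1: "continuous_on I V1" by (rule continuous_on_vector_derivative[OF V1])
  obtain V where V: "\<And>x. x \<in> I \<Longrightarrow> (V has_vector_derivative V1 x) (at x within I)" using antiderivative_on[OF I cV1] by blast
  have cV: "continuous_on I V" by (rule continuous_on_vector_derivative[OF V])
  note wV1 = classical_weak_deriv[OF E(1,2) V1 c]
  note lg = locint_L2[OF g(1)] and lh = locint_L2[OF h(1)]
  have lu: "locint I u" by (rule cont_locint[OF cu])
  have 1: "(LINT x:I|lebesgue. deriv \<eta> x *\<^sub>R (g x - V1 x)) = 0" if t: "test_function I \<eta>" for \<eta>
  proof -
    have "(LINT x:I|lebesgue. \<eta> x *\<^sub>R h x) = (LINT x:I|lebesgue. \<eta> x *\<^sub>R c x)"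
      by (rule LINT_cong_on[OF test_integrable(1)[OF t E(1,2) lh] test_integrable(1)[OF t E(1,2) cont_locint[OF c]]])
        (use ae in eventually_elim, simp add: h_def g_def)
    then have "(LINT x:I|lebesgue. deriv \<eta> x *\<^sub>R g x) = (LINT x:I|lebesgue. deriv \<eta> x *\<^sub>R V1 x)"
      using h(2) wV1 t unfolding is_weak_deriv_def by simp
    then show ?thesis unfolding scaleR_diff_right
      by (subst set_integral_diff(2)[OF test_integrable(2)[OF t E(1,2) lg] test_integrable(2)[OF t E(1,2) cont_locint[OF cV1]]]) simp
  qed
  obtain C where C: "AE x in lebesgue. x \<in> I \<longrightarrow> g x - V1 x = C"
    using du_Bois_Reymond[OF E(1,2) locint_diff[OF lg cont_locint[OF cV1]] 1] by blast
  define W1 where "W1 x = V1 x + C" for x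
  define W where "W x = V x + x *\<^sub>R C" for x
  have W1: "(W1 has_vector_derivative c x) (at x within I)" if "x \<in> I" for x
    unfolding W1_def using has_vector_derivative_add[OF V1[OF that] has_vector_derivative_const[of C]] by simp
  have W: "(W has_vector_derivative W1 x) (at x within I)" if "x \<in> I" for x
    unfolding W1_def W_def
    by (rule has_vector_derivative_add[OF V[OF that]]) (auto intro!: derivative_eq_intros simp: has_vector_derivative_def)
  have cW1: "continuous_on I W1" and cW: "continuous_on I W"
    unfolding W1_def W_def by (intro continuous_intros cV1 cV)+
  note wW = classical_weak_deriv[OF E(1,2) W cW1]
  have gW1: "AE x in lebesgue. x \<in> I \<longrightarrow> g x = W1 x" using C by eventually_elim (auto simp: W1_def algebra_simps)
  have 2: "(LINT x:I|lebesgue. deriv \<eta> x *\<^sub>R (u x - W x)) = 0" if t: "test_function I \<eta>" for \<eta>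
  proof -
    have "(LINT x:I|lebesgue. \<eta> x *\<^sub>R g x) = (LINT x:I|lebesgue. \<eta> x *\<^sub>R W1 x)"
      by (rule LINT_cong_on[OF test_integrable(1)[OF t E(1,2) lg] test_integrable(1)[OF t E(1,2) cont_locint[OF cW1]]])
        (use gW1 in eventually_elim, simp)
    then have "(LINT x:I|lebesgue. deriv \<eta> x *\<^sub>R u x) = (LINT x:I|lebesgue. deriv \<eta> x *\<^sub>R W x)"
      using g(2) wW t unfolding is_weak_deriv_def by simp
    then show ?thesis unfolding scaleR_diff_right
      by (subst set_integral_diff(2)[OF test_integrable(2)[OF t E(1,2) lu] test_integrable(2)[OF t E(1,2) cont_locint[OF cW]]]) simp
  qed
  obtain D where D: "AE x in lebesgue. x \<in> I \<longrightarrow> u x - W x = D"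
    using du_Bois_Reymond[OF E(1,2) locint_diff[OF lu cont_locint[OF cW]] 2] by blast
  have uW: "u x = W x + D" if "x \<in> I" for x
    by (rule cont_AE_eq[OF cu _ _ E(3) that]) (intro continuous_intros cW, use D in eventually_elim, auto simp: algebra_simps)
  show ?thesis
  proof (rule that)
    fix x assume x: "x \<in> I"
    show "(W1 has_vector_derivative c x) (at x within I)" by (rule W1[OF x])
    have "((\<lambda>x. W x + D) has_vector_derivative W1 x) (at x within I)"
      using has_vector_derivative_add[OF W[OF x] has_vector_derivative_const[of D]] by simp
    then show "(u has_vector_derivative W1 x) (at x within I)"
      by (rule has_vector_derivative_transform[rotated -1]) (use x uW in auto)
  next
    have m: "set_borel_measurable lebesgue I W1" by (rule cont_set_borel_measurable[OF cW1 E(4)])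
    have "set_integrable lebesgue I (\<lambda>x. (norm (W1 x))\<^sup>2)"
      unfolding set_integrable_def
    proof (rule integrable_cong_AE_imp)
      show "integrable lebesgue (\<lambda>x. indicator I x *\<^sub>R (norm (g x))\<^sup>2)"
        using g(1) unfolding L2_on_def set_integrable_def by auto
      show "(\<lambda>x. indicator I x *\<^sub>R (norm (W1 x))\<^sup>2) \<in> borel_measurable lebesgue"
        using cont_set_borel_measurable[of I "\<lambda>x. (norm (W1 x))\<^sup>2", OF _ E(4)] cW1 unfolding set_borel_measurable_def
        by (simp only: continuous_on_power continuous_on_norm)
      show "AE x in lebesgue. indicator I x *\<^sub>R (norm (g x))\<^sup>2 = indicator I x *\<^sub>R (norm (W1 x))\<^sup>2"
        using gW1 by eventually_elim (auto simp: indicator_def)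
    qed
    then show "W1 \<in> L2_on I" using m by (simp add: L2_on_def)
  qed
qed

text \<open>Converse of \<open>H2_regularity\<close>. \<open>weak_deriv\<close> returns some
  representative, equal to u' only almost everywhere; since test integrals do not see null sets, c
  is still a weak derivative of that representative.\<close>

lemma classical_H2:
  fixes u :: "real \<Rightarrow> 'a::euclidean_space"
  assumes I: "I = {a..} \<or> (a < b \<and> I = {a..b})"
    and u: "\<And>x. x \<in> I \<Longrightarrow> (u has_vector_derivative u' x) (at x within I)"
    and u': "\<And>x. x \<in> I \<Longrightarrow> (u' has_vector_derivative c x) (at x within I)"
    and c: "continuous_on I c" and L: "u \<in> L2_on I" "u' \<in> L2_on I" "c \<in> L2_on I"
  shows "u \<in> H2_on I" "AE x in lebesgue. x \<in> I \<longrightarrow> weak_deriv I (weak_deriv I u) x = c x"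
proof -
  note E = edge_shape[OF I]
  have cu': "continuous_on I u'" by (rule continuous_on_vector_derivative[OF u'])
  note wu = classical_weak_deriv[OF E(1,2) u cu'] and wu' = classical_weak_deriv[OF E(1,2) u' c]
  have H1: "u \<in> H1_on I" using L wu by (auto simp: H1_on_def)
  have uniq: "AE x in lebesgue. x \<in> I \<longrightarrow> f x = k x"
    if "is_weak_deriv I v f" "is_weak_deriv I v k" "f \<in> L2_on I" "k \<in> L2_on I" for v f k :: "real \<Rightarrow> 'a"
  proof -
    note lf = locint_L2[OF that(3)] and lk = locint_L2[OF that(4)]
    have "AE x in lebesgue. x \<in> I \<longrightarrow> f x - k x = 0"
    proof (rule fundamental_lemma[OF E(1) locint_diff[OF lf lk]])
      fix \<eta> assume t: "test_function I \<eta>"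
      show "(LINT x:I|lebesgue. \<eta> x *\<^sub>R (f x - k x)) = 0"
      proof -
        have "- (LINT x:I|lebesgue. \<eta> x *\<^sub>R f x) = - (LINT x:I|lebesgue. \<eta> x *\<^sub>R k x)"
          using that(1)[unfolded is_weak_deriv_def, rule_format, OF t] that(2)[unfolded is_weak_deriv_def, rule_format, OF t]
          by (rule trans[OF sym])
        then show ?thesis unfolding scaleR_diff_right
          by (subst set_integral_diff(2)[OF test_integrable(1)[OF t E(1,2) lf] test_integrable(1)[OF t E(1,2) lk]]) simp
      qed
    qed
    then show ?thesis by simp
  qed
  define g where "g = weak_deriv I u"
  have g: "g \<in> L2_on I" "is_weak_deriv I u g" using weak_deriv_props[OF H1] by (auto simp: g_def)
  have ae: "AE x in lebesgue. x \<in> I \<longrightarrow> g x = u' x" by (rule uniq[OF g(2) wu g(1) L(2)])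
  have wg: "is_weak_deriv I g c"
    unfolding is_weak_deriv_def
  proof (intro allI impI)
    fix \<eta> assume t: "test_function I \<eta>"
    have "(LINT x:I|lebesgue. deriv \<eta> x *\<^sub>R g x) = (LINT x:I|lebesgue. deriv \<eta> x *\<^sub>R u' x)"
      by (rule LINT_cong_on[OF test_integrable(2)[OF t E(1,2) locint_L2[OF g(1)]] test_integrable(2)[OF t E(1,2) locint_L2[OF L(2)]]])
        (use ae in eventually_elim, simp)
    then show "(LINT x:I|lebesgue. deriv \<eta> x *\<^sub>R g x) = - (LINT x:I|lebesgue. \<eta> x *\<^sub>R c x)"
      using wu' t unfolding is_weak_deriv_def by simp
  qed
  have Hg: "g \<in> H1_on I" using g wg L(3) by (auto simp: H1_on_def)
  then show "u \<in> H2_on I" using H1 by (simp add: H2_on_def g_def)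
  have "AE x in lebesgue. x \<in> I \<longrightarrow> weak_deriv I g x = c x"
    by (rule uniq[OF weak_deriv_props(2)[OF Hg] wg weak_deriv_props(1)[OF Hg] L(3)])
  then show "AE x in lebesgue. x \<in> I \<longrightarrow> weak_deriv I (weak_deriv I u) x = c x" by (simp add: g_def)
qed

section \<open>The period curve\<close>

text \<open>Differentiation under the integral sign combined with a reduction: the differentiated
  integrand is an exact derivative in r plus a multiple of a second integrand j. Applied crosswise
  to \<open>T\<close> and \<open>J\<close>, it expresses each derivative by boundary terms and the
  other integral.\<close>

lemma deriv_integral_split:
  fixes f fz :: "real \<Rightarrow> real \<Rightarrow> real"
  assumes U: "open U" "convex U" "z0 \<in> U"
    and d: "\<And>z r. z \<in> U \<Longrightarrow> r \<in> {0..1} \<Longrightarrow> ((\<lambda>z. f z r) has_real_derivative fz z r) (at z)"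
    and cfz: "continuous_on (U \<times> {0..1}) (\<lambda>(z, r). fz z r)"
    and cf: "\<And>z. z \<in> U \<Longrightarrow> continuous_on {0..1} (f z)"
    and G: "\<And>r. r \<in> {0..1} \<Longrightarrow> (G has_real_derivative fz z0 r - a * j r) (at r)"
    and j: "continuous_on {0..1} j"
  shows "((\<lambda>z. integral {0..1} (f z)) has_real_derivative G 1 - G 0 + a * integral {0..1} j) (at z0)"
proof -
  have "((\<lambda>z. integral (cbox 0 1) (f z)) has_real_derivative integral (cbox 0 1) (fz z0)) (at z0 within U)"
  proof (rule leibniz_rule_field_derivative)
    show "continuous_on (U \<times> cbox 0 1) (\<lambda>(z, r). fz z r)" unfolding cbox_interval by (rule cfz)
    show "\<And>x t. x \<in> U \<Longrightarrow> t \<in> cbox 0 1 \<Longrightarrow> ((\<lambda>x. f x t) has_real_derivative fz x t) (at x within U)"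
      by (rule has_field_derivative_at_within, rule d) auto
    show "\<And>x. x \<in> U \<Longrightarrow> f x integrable_on cbox 0 1"
      by (simp add: integrable_continuous_real cf)
    show "z0 \<in> U" "convex U" by (fact U)+
  qed
  then have 1: "((\<lambda>z. integral {0..1} (f z)) has_real_derivative integral {0..1} (fz z0)) (at z0)"
    by (simp add: at_within_open[OF U(3,1)])
  have "((\<lambda>r. fz z0 r - a * j r) has_integral G 1 - G 0) {0..1}"
    by (rule fundamental_theorem_of_calculus, simp, unfold has_real_derivative_iff_has_vector_derivative[symmetric],
        rule has_field_derivative_at_within, rule G)
  moreover have "((\<lambda>r. a * j r) has_integral a * integral {0..1} j) {0..1}"
    by (intro has_integral_mult_right integrable_integral integrable_continuous_real j)
  ultimately have "((\<lambda>r. (fz z0 r - a * j r) + a * j r) has_integral G 1 - G 0 + a * integral {0..1} j) {0..1}"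
    by (rule has_integral_add)
  then have "integral {0..1} (fz z0) = G 1 - G 0 + a * integral {0..1} j" by (simp add: integral_unique)
  with 1 show ?thesis by simp
qed

section \<open>Integrands of the elliptic integrals and their reduction modulo exact
  derivatives\<close>

definition Qf :: "real \<Rightarrow> real \<Rightarrow> real" where "Qf P t = (P - t\<^sup>2) * (2 * P - 1 - t\<^sup>2)"
text \<open>With t^2 = P - u^2 and the energy relation p^2 = (P - u^2) (u^2 + P - 1),
  \<open>Qf\<close> equals u^2 (u^2 + P - 1), and \<open>hf P t\<close> dt is \<epsilon> dx along a
  loop. Using t instead of u removes the inverse square root singularity at the turning point in the
  middle of the loop.\<close>

definition hf :: "real \<Rightarrow> real \<Rightarrow> real" where "hf P t = 1 / sqrt (Qf P t)"
definition hP :: "real \<Rightarrow> real \<Rightarrow> real" where "hP P t = - (4 * P - 1 - 3 * t\<^sup>2) / (2 * (Qf P t * sqrt (Qf P t)))"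
definition ht :: "real \<Rightarrow> real \<Rightarrow> real" where "ht P t = - (4 * t ^ 3 - 2 * (3 * P - 1) * t) / (2 * (Qf P t * sqrt (Qf P t)))"
text \<open>Since 2 P^2 - P - t^2 = u^2 - 2 P (1 - P), this is the weight u^2 + 2 E along the loop,
  with E = - P (1 - P).\<close>

definition jf :: "real \<Rightarrow> real \<Rightarrow> real" where "jf P t = (2 * P\<^sup>2 - P - t\<^sup>2) * hf P t"
definition jP :: "real \<Rightarrow> real \<Rightarrow> real" where "jP P t = (4 * P - 1) * hf P t + (2 * P\<^sup>2 - P - t\<^sup>2) * hP P t"
definition jt :: "real \<Rightarrow> real \<Rightarrow> real" where "jt P t = - 2 * t * hf P t + (2 * P\<^sup>2 - P - t\<^sup>2) * ht P t"

lemma hf_curve: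
  assumes p: "(p has_real_derivative p') (at z)" and \<tau>: "(\<tau> has_real_derivative \<tau>') (at z)" and Q: "Qf (p z) (\<tau> z) > 0"
  shows "((\<lambda>z. hf (p z) (\<tau> z)) has_real_derivative hP (p z) (\<tau> z) * p' + ht (p z) (\<tau> z) * \<tau>') (at z)"
proof -
  have dQ: "((\<lambda>z. Qf (p z) (\<tau> z)) has_real_derivative
      (4 * p z - 1 - 3 * (\<tau> z)\<^sup>2) * p' + (4 * \<tau> z ^ 3 - 2 * (3 * p z - 1) * \<tau> z) * \<tau>') (at z)"
    unfolding Qf_def
    by (rule derivative_eq_intros p \<tau> refl)+ (simp add: algebra_simps power2_eq_square power3_eq_cube)
  have ne: "sqrt (Qf (p z) (\<tau> z)) \<noteq> 0" using Q by simp
  have s: "sqrt (Qf (p z) (\<tau> z)) * sqrt (Qf (p z) (\<tau> z)) = Qf (p z) (\<tau> z)" using Q by simp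
  have aux: "- ((A * p' + B * \<tau>') * (inverse D / 2)) / R = - A / (2 * (R * D)) * p' + - B / (2 * (R * D)) * \<tau>'"
    if "D \<noteq> 0" "R \<noteq> 0" for A B D R :: real
    using that by (simp add: field_simps)
  have "((\<lambda>z. 1 / sqrt (Qf (p z) (\<tau> z))) has_real_derivative
     - (((4 * p z - 1 - 3 * (\<tau> z)\<^sup>2) * p' + (4 * \<tau> z ^ 3 - 2 * (3 * p z - 1) * \<tau> z) * \<tau>') * (inverse (sqrt (Qf (p z) (\<tau> z))) / 2))
        / (sqrt (Qf (p z) (\<tau> z)) * sqrt (Qf (p z) (\<tau> z)))) (at z)"
    by (rule derivative_eq_intros DERIV_chain2[OF DERIV_real_sqrt[OF Q] dQ] refl ne)+ (simp add: field_simps)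
  then show ?thesis
    unfolding hf_def hP_def ht_def s
    by (rule DERIV_cong) (rule aux, use Q in auto)
qed

lemma jf_curve:
  assumes p: "(p has_real_derivative p') (at z)" and \<tau>: "(\<tau> has_real_derivative \<tau>') (at z)" and Q: "Qf (p z) (\<tau> z) > 0"
  shows "((\<lambda>z. jf (p z) (\<tau> z)) has_real_derivative jP (p z) (\<tau> z) * p' + jt (p z) (\<tau> z) * \<tau>') (at z)"
  unfolding jf_def jP_def jt_def
  by (rule derivative_eq_intros p \<tau> hf_curve[OF p \<tau> Q] refl)+ (simp add: algebra_simps)

text \<open>Modulo derivatives in t, the parameter derivative of \<open>hf\<close> is a multiple of
  \<open>jf\<close> alone; the constant in \<open>jf\<close> is what removes the \<open>hf\<close>
  term and makes the derivative of \<open>T\<close> depend on \<open>J\<close> only. After clearing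
  2 Q sqrt Q the claim is a polynomial identity in P and t.\<close>

lemma hP_split:
  assumes Q: "Qf P t > 0" and P: "P \<noteq> 0" "P \<noteq> 1" "2 * P \<noteq> 1"
  defines "\<alpha> \<equiv> 1 / (2 * P * (1 - P) * (2 * P - 1))"
  shows "((\<lambda>t. \<alpha> * (t * (2 * P\<^sup>2 - 4 * P + 1 + t\<^sup>2) * hf P t)) has_real_derivative hP P t - \<alpha> * jf P t) (at t)"
proof -
  have d: "((\<lambda>t. hf P t) has_real_derivative ht P t) (at t)"
    using hf_curve[of "\<lambda>_. P" 0 t "\<lambda>t. t" 1] Q by simp
  define D where "D = sqrt (Qf P t)"
  have D: "D > 0" "D * D = Qf P t" using Q by (auto simp: D_def)
  have aux: "d * X - Y = Z \<Longrightarrow> d \<noteq> 0 \<Longrightarrow> X - 1 / d * Y = 1 / d * Z" for d X Y Z :: real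
    by (drule sym) (simp add: diff_divide_distrib)
  have "2 * P * (1 - P) * (2 * P - 1) * (- (4 * P - 1 - 3 * t\<^sup>2)) - 2 * (2 * P\<^sup>2 - P - t\<^sup>2) * Qf P t
    = 2 * (2 * P\<^sup>2 - 4 * P + 1 + 3 * t\<^sup>2) * Qf P t - t * (2 * P\<^sup>2 - 4 * P + 1 + t\<^sup>2) * (4 * t ^ 3 - 2 * (3 * P - 1) * t)"
    unfolding Qf_def by algebra
  then have id: "- (4 * P - 1 - 3 * t\<^sup>2) - \<alpha> * (2 * (2 * P\<^sup>2 - P - t\<^sup>2) * Qf P t)
    = \<alpha> * (2 * (2 * P\<^sup>2 - 4 * P + 1 + 3 * t\<^sup>2) * Qf P t - t * (2 * P\<^sup>2 - 4 * P + 1 + t\<^sup>2) * (4 * t ^ 3 - 2 * (3 * P - 1) * t))"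
    using P aux[of "2 * P * (1 - P) * (2 * P - 1)"] unfolding \<alpha>_def by simp
  have "((\<lambda>t. \<alpha> * (t * (2 * P\<^sup>2 - 4 * P + 1 + t\<^sup>2) * hf P t)) has_real_derivative
     \<alpha> * ((2 * P\<^sup>2 - 4 * P + 1 + 3 * t\<^sup>2) * hf P t + t * (2 * P\<^sup>2 - 4 * P + 1 + t\<^sup>2) * ht P t)) (at t)"
    by (rule derivative_eq_intros d refl)+ (simp add: algebra_simps power2_eq_square)
  moreover have "\<alpha> * ((2 * P\<^sup>2 - 4 * P + 1 + 3 * t\<^sup>2) * hf P t + t * (2 * P\<^sup>2 - 4 * P + 1 + t\<^sup>2) * ht P t)
     = (\<alpha> * (2 * (2 * P\<^sup>2 - 4 * P + 1 + 3 * t\<^sup>2) * Qf P t - t * (2 * P\<^sup>2 - 4 * P + 1 + t\<^sup>2) * (4 * t ^ 3 - 2 * (3 * P - 1) * t))) / (2 * (Qf P t * D))"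
    unfolding hf_def ht_def D_def[symmetric] using D Q by (simp add: field_simps)
  moreover have "hP P t - \<alpha> * jf P t = (- (4 * P - 1 - 3 * t\<^sup>2) - \<alpha> * (2 * (2 * P\<^sup>2 - P - t\<^sup>2) * Qf P t)) / (2 * (Qf P t * D))"
    unfolding hP_def jf_def hf_def D_def[symmetric] using D Q by (simp add: field_simps)
  ultimately show ?thesis by (simp only: id)
qed

text \<open>The companion relation for \<open>jf\<close>, with only \<open>hf\<close> left over:
  \<open>T\<close> and \<open>J\<close> satisfy a closed linear system whose inhomogeneities are
  boundary terms.\<close>

lemma jP_split:
  assumes Q: "Qf P t > 0"
  shows "((\<lambda>t. (1 - P) * t * hf P t) has_real_derivative jP P t - (3/2 * (2 * P - 1)) * hf P t) (at t)"
proof -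
  have d: "((\<lambda>t. hf P t) has_real_derivative ht P t) (at t)"
    using hf_curve[of "\<lambda>_. P" 0 t "\<lambda>t. t" 1] Q by simp
  define D where "D = sqrt (Qf P t)"
  have D: "D > 0" "D * D = Qf P t" using Q by (auto simp: D_def)
  have id: "(2 * P + 1) * Qf P t - (2 * P\<^sup>2 - P - t\<^sup>2) * (4 * P - 1 - 3 * t\<^sup>2)
    = 2 * (1 - P) * Qf P t - (1 - P) * t * (4 * t ^ 3 - 2 * (3 * P - 1) * t)"
    unfolding Qf_def by algebra
  have "((\<lambda>t. (1 - P) * t * hf P t) has_real_derivative (1 - P) * hf P t + (1 - P) * t * ht P t) (at t)"
    by (rule derivative_eq_intros d refl)+ (simp add: algebra_simps)
  moreover have "(1 - P) * hf P t + (1 - P) * t * ht P t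
      = (2 * (1 - P) * Qf P t - (1 - P) * t * (4 * t ^ 3 - 2 * (3 * P - 1) * t)) / (2 * (Qf P t * D))"
    unfolding hf_def ht_def D_def[symmetric] using D Q by (simp add: field_simps)
  moreover have "jP P t - (3/2 * (2 * P - 1)) * hf P t
     = ((2 * P + 1) * Qf P t - (2 * P\<^sup>2 - P - t\<^sup>2) * (4 * P - 1 - 3 * t\<^sup>2)) / (2 * (Qf P t * D))"
    unfolding jP_def hP_def hf_def D_def[symmetric] using D Q by (simp add: field_simps)
  ultimately show ?thesis by (simp only: id)
qed

locale period_curve =
  fixes c :: real
  assumes c0: "0 < c" and c1: "c \<le> 1 / 4"
begin

definition k2 :: real where "k2 = 1 - c\<^sup>2"
text \<open>The larger root P of P (1 - P) = \<open>k2\<close> z (1 - z) is (1 + \<open>M z\<close>)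
  / 2. The equation is conservation of energy between the middle of a loop, where the square of u is
  P, and the vertex, where Kirchhoff's condition fixes the square of the slope to c^2 z (1 -
  z).\<close>

definition M :: "real \<Rightarrow> real" where "M z = sqrt (1 - 4 * k2 * (z * (1 - z)))"
definition P :: "real \<Rightarrow> real" where "P z = (1 + M z) / 2"
definition P' :: "real \<Rightarrow> real" where "P' z = - k2 * (1 - 2 * z) / M z"
definition \<rho> :: "real \<Rightarrow> real" where "\<rho> z = sqrt (P z - z)"
definition \<rho>' :: "real \<Rightarrow> real" where "\<rho>' z = (P' z - 1) / (2 * \<rho> z)"
definition T :: "real \<Rightarrow> real" where "T z = integral {0..1} (\<lambda>r. \<rho> z * hf (P z) (\<rho> z * r))"
definition J :: "real \<Rightarrow> real" where "J z = integral {0..1} (\<lambda>r. \<rho> z * jf (P z) (\<rho> z * r))"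

lemma k2_bounds: "15 / 16 \<le> k2" "k2 < 1"
proof -
  have "c\<^sup>2 \<le> (1/4)\<^sup>2" using c0 c1 by (intro power_mono) auto
  then show "15 / 16 \<le> k2" by (simp add: k2_def power2_eq_square)
  show "k2 < 1" using c0 by (simp add: k2_def)
qed

context
  fixes z :: real
  assumes z: "0 < z" "z < 1"
begin

lemma zz: "0 < z * (1 - z)" "z * (1 - z) \<le> 1 / 4"
proof -
  show "0 < z * (1 - z)" using z by simp
  show "z * (1 - z) \<le> 1 / 4" using zero_le_power2[of "z - 1/2"] by (simp add: power2_eq_square algebra_simps)
qed

lemma M_sq: "(M z)\<^sup>2 = 1 - 4 * k2 * (z * (1 - z))" and M_pos: "0 < M z" and M_lt: "M z < 1"
proof -
  have "4 * k2 * (z * (1 - z)) < 1"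
    using mult_strict_right_mono[OF k2_bounds(2), of "z * (1 - z)"] zz by linarith
  then show M_sq_M: "(M z)\<^sup>2 = 1 - 4 * k2 * (z * (1 - z))" "0 < M z" by (auto simp: M_def)
  have "4 * k2 * (z * (1 - z)) > 0" using zz k2_bounds by simp
  then show "M z < 1" using M_sq_M by (intro power2_less_imp_less[of "M z" 1]) auto
qed

lemma P_bounds: "1 / 2 < P z" "P z < 1" "2 * P z - 1 = M z" using M_pos M_lt by (auto simp: P_def field_simps)

lemma P_eq: "P z * (1 - P z) = k2 * (z * (1 - z))"
  using M_sq unfolding P_def by (simp add: power2_eq_square field_simps)

lemma P_prod: "(P z - z) * (P z + z - 1) = c\<^sup>2 * (z * (1 - z))"
  using P_eq unfolding k2_def by (simp add: power2_eq_square algebra_simps)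

text \<open>The two factors in \<open>P_prod\<close> have positive product and positive sum, hence
  both are positive.\<close>

lemma P_gt: "z < P z" "0 < P z + z - 1"
proof -
  have "0 < (P z - z) * (P z + z - 1)" unfolding P_prod using zz c0 by simp
  moreover have "(P z - z) + (P z + z - 1) > 0" using P_bounds by simp
  ultimately show "z < P z" "0 < P z + z - 1" by (auto simp: zero_less_mult_iff)
qed

lemma \<rho>_pos: "0 < \<rho> z" and \<rho>_sq: "(\<rho> z)\<^sup>2 = P z - z" using P_gt by (auto simp: \<rho>_def)

lemma t_bounds:
  assumes "r \<in> {0..1}"
  shows "0 \<le> (\<rho> z * r)\<^sup>2" "(\<rho> z * r)\<^sup>2 \<le> P z - z"
    "Qf (P z) (\<rho> z) \<le> Qf (P z) (\<rho> z * r)" "0 < Qf (P z) (\<rho> z * r)"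
proof -
  have "r\<^sup>2 \<le> 1" using assms by (auto simp: abs_square_le_1)
  then show 1: "(\<rho> z * r)\<^sup>2 \<le> P z - z" unfolding power_mult_distrib \<rho>_sq using P_gt by (simp add: mult_left_le)
  show "Qf (P z) (\<rho> z) \<le> Qf (P z) (\<rho> z * r)" unfolding Qf_def
    using 1 P_gt z unfolding \<rho>_sq by (intro mult_mono) auto
  show "0 < Qf (P z) (\<rho> z * r)" unfolding Qf_def
    using 1 P_gt z by (intro mult_pos_pos) auto
qed simp

lemma Q_end: "Qf (P z) (\<rho> z) = z * (P z + z - 1)"
  unfolding Qf_def \<rho>_sq by (simp add: algebra_simps)

text \<open>\<open>P_prod\<close> makes the endpoint value of the radicand elementary up to \<rho>,
  and this \<rho> cancels in the boundary terms of T' and J'.\<close>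

lemma Q_end': "sqrt (Qf (P z) (\<rho> z)) = c * z * sqrt (1 - z) / \<rho> z"
proof (rule real_sqrt_unique)
  have "(\<rho> z)\<^sup>2 * (z * (P z + z - 1)) = c\<^sup>2 * z\<^sup>2 * (1 - z)"
    unfolding \<rho>_sq by (subst mult.left_commute) (simp add: P_prod power2_eq_square)
  then show "(c * z * sqrt (1 - z) / \<rho> z)\<^sup>2 = Qf (P z) (\<rho> z)"
    unfolding Q_end using z \<rho>_pos by (simp add: power_mult_distrib power_divide field_simps)
  show "0 \<le> c * z * sqrt (1 - z) / \<rho> z" using c0 z \<rho>_pos by simp
qed

lemma hf_end: "hf (P z) (\<rho> z) = \<rho> z / (c * z * sqrt (1 - z))"
  unfolding hf_def Q_end' by simp

lemma P_deriv: "(P has_real_derivative P' z) (at z)"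
proof -
  have pos: "1 - 4 * k2 * (z * (1 - z)) > 0" using M_sq M_pos zero_less_power[of "M z" 2] by linarith
  have "((\<lambda>z. 1 - 4 * k2 * (z * (1 - z))) has_real_derivative - 4 * k2 * (1 - 2 * z)) (at z)"
    by (auto intro!: derivative_eq_intros simp: algebra_simps)
  from DERIV_chain2[OF DERIV_real_sqrt[OF pos] this]
  have "(M has_real_derivative inverse (M z) / 2 * (- 4 * k2 * (1 - 2 * z))) (at z)"
    unfolding M_def .
  then show ?thesis unfolding P_def P'_def
    using M_pos by (auto intro!: derivative_eq_intros simp: field_simps)
qed

lemma \<rho>_deriv: "(\<rho> has_real_derivative \<rho>' z) (at z)"
proof -
  have pos: "P z - z > 0" using P_gt by simp
  have "((\<lambda>z. P z - z) has_real_derivative P' z - 1) (at z)"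
    by (rule derivative_eq_intros P_deriv refl)+
  from DERIV_chain2[OF DERIV_real_sqrt[OF pos] this]
  show ?thesis unfolding \<rho>_def \<rho>'_def by (simp add: field_simps)
qed

end

lemma cont_curve: "continuous_on {0<..<1} P" "continuous_on {0<..<1} \<rho>"
    "continuous_on {0<..<1} P'" "continuous_on {0<..<1} \<rho>'"
proof -
  have M: "continuous_on {0<..<1} M" unfolding M_def by (intro continuous_intros)
  show P: "continuous_on {0<..<1} P" unfolding P_def by (intro continuous_intros M) auto
  show \<rho>: "continuous_on {0<..<1} \<rho>" unfolding \<rho>_def by (intro continuous_intros P)
  show P': "continuous_on {0<..<1} P'" unfolding P'_def by (intro continuous_intros M) (metis M_pos greaterThanLessThan_iff less_irrefl)
  show "continuous_on {0<..<1} \<rho>'" unfolding \<rho>'_def by (intro continuous_intros \<rho> P') (metis \<rho>_pos greaterThanLessThan_iff less_irrefl mult_eq_0_iff zero_neq_numeral)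
qed

lemma cont_curve_pair:
  "continuous_on ({0<..<1} \<times> {0..1}) (\<lambda>(z, r). P z)"
  "continuous_on ({0<..<1} \<times> {0..1}) (\<lambda>(z, r). \<rho> z)"
  "continuous_on ({0<..<1} \<times> {0..1}) (\<lambda>(z, r). P' z)"
  "continuous_on ({0<..<1} \<times> {0..1}) (\<lambda>(z, r). \<rho>' z)"
  unfolding case_prod_beta
  by (intro continuous_on_compose2[OF cont_curve(1)] continuous_on_compose2[OF cont_curve(2)]
      continuous_on_compose2[OF cont_curve(3)] continuous_on_compose2[OF cont_curve(4)] continuous_on_fst continuous_on_id, auto)+

lemma cont_kernels:
  assumes p: "continuous_on S p" and t: "continuous_on S t" and Q: "\<And>x. x \<in> S \<Longrightarrow> 0 < Qf (p x) (t x)"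
  shows "continuous_on S (\<lambda>x. hf (p x) (t x))" "continuous_on S (\<lambda>x. hP (p x) (t x))" "continuous_on S (\<lambda>x. ht (p x) (t x))"
    "continuous_on S (\<lambda>x. jf (p x) (t x))" "continuous_on S (\<lambda>x. jP (p x) (t x))" "continuous_on S (\<lambda>x. jt (p x) (t x))"
proof -
  have cQ: "continuous_on S (\<lambda>x. Qf (p x) (t x))" unfolding Qf_def by (intro continuous_intros p t)
  have ne: "\<forall>x\<in>S. Qf (p x) (t x) \<noteq> 0" using Q by force
  show h: "continuous_on S (\<lambda>x. hf (p x) (t x))" "continuous_on S (\<lambda>x. hP (p x) (t x))" "continuous_on S (\<lambda>x. ht (p x) (t x))"
    unfolding hf_def hP_def ht_def by (intro continuous_intros p t cQ; use ne in force)+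
  show "continuous_on S (\<lambda>x. jf (p x) (t x))" "continuous_on S (\<lambda>x. jP (p x) (t x))" "continuous_on S (\<lambda>x. jt (p x) (t x))"
    unfolding jf_def jP_def jt_def by (intro continuous_intros p t h)+
qed

lemma T_deriv_raw:
  assumes z: "0 < z" "z < 1"
  defines "\<alpha> \<equiv> 1 / (2 * P z * (1 - P z) * (2 * P z - 1))"
  shows "(T has_real_derivative
    \<rho>' z * hf (P z) (\<rho> z) + P' z * (\<alpha> * (\<rho> z * (2 * (P z)\<^sup>2 - 4 * P z + 1 + (\<rho> z)\<^sup>2) * hf (P z) (\<rho> z))) + P' z * \<alpha> * J z) (at z)"
proof -
  define fz where "fz z r = \<rho>' z * hf (P z) (\<rho> z * r) + \<rho> z * (hP (P z) (\<rho> z * r) * P' z + ht (P z) (\<rho> z * r) * (\<rho>' z * r))" for z r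
  define B where "B t = \<alpha> * (t * (2 * (P z)\<^sup>2 - 4 * P z + 1 + t\<^sup>2) * hf (P z) t)" for t
  \<comment> \<open>The variation of \<rho> is itself an exact derivative in r, namely that of
    \<rho>' r hf, as expected for a moving endpoint. The second summand is the exact part from
    \<open>hP_split\<close>.\<close>
  define G where "G r = \<rho>' z * r * hf (P z) (\<rho> z * r) + P' z * B (\<rho> z * r)" for r
  have "((\<lambda>z. integral {0..1} (\<lambda>r. \<rho> z * hf (P z) (\<rho> z * r))) has_real_derivative
      G 1 - G 0 + P' z * \<alpha> * integral {0..1} (\<lambda>r. \<rho> z * jf (P z) (\<rho> z * r))) (at z)"
  proof (rule deriv_integral_split[where U="{0<..<1}" and fz=fz])
    show "open {0<..<1::real}" "convex {0<..<1::real}" "z \<in> {0<..<1}" using z by auto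
    fix x r assume x: "x \<in> {0<..<1::real}" and r: "r \<in> {0..1::real}"
    then have xx: "0 < x" "x < 1" by auto
    have "((\<lambda>x. \<rho> x * r) has_real_derivative \<rho>' x * r) (at x)" using \<rho>_deriv[OF xx] by (rule DERIV_cmult_right)
    note h = hf_curve[OF P_deriv[OF xx] this t_bounds(4)[OF xx r]]
    show "((\<lambda>z. \<rho> z * hf (P z) (\<rho> z * r)) has_real_derivative fz x r) (at x)"
      unfolding fz_def by (rule DERIV_cong[OF DERIV_mult[OF \<rho>_deriv[OF xx] h]]) (simp add: algebra_simps)
  next
    have Q: "0 < Qf (case x of (z, r) \<Rightarrow> P z) (case x of (z, r) \<Rightarrow> \<rho> z * r)" if "x \<in> {0<..<1} \<times> {0..1}" for x
      using that t_bounds(4) by auto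
    have ct: "continuous_on ({0<..<1} \<times> {0..1}) (\<lambda>(z, r). \<rho> z * r)"
      using cont_curve_pair(2) by (auto simp: case_prod_beta intro!: continuous_intros)
    note K = cont_kernels[OF cont_curve_pair(1) ct Q]
    show "continuous_on ({0<..<1} \<times> {0..1}) (\<lambda>(z, r). fz z r)"
      using K(1-3) cont_curve_pair unfolding fz_def by (auto simp: case_prod_beta intro!: continuous_intros)
  next
    fix x assume x: "x \<in> {0<..<1::real}"
    then have xx: "0 < x" "x < 1" by auto
    show "continuous_on {0..1} (\<lambda>r. \<rho> x * hf (P x) (\<rho> x * r))"
      by (intro continuous_intros cont_kernels t_bounds(4)[OF xx])
  next
    show "continuous_on {0..1} (\<lambda>r. \<rho> z * jf (P z) (\<rho> z * r))"
      by (intro continuous_intros cont_kernels t_bounds(4)[OF z])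
    fix r assume r: "r \<in> {0..1::real}"
    note Q = t_bounds(4)[OF z r]
    have d1: "((\<lambda>r. \<rho> z * r) has_real_derivative \<rho> z) (at r)" by (auto intro!: derivative_eq_intros)
    have d2: "((\<lambda>r. hf (P z) (\<rho> z * r)) has_real_derivative ht (P z) (\<rho> z * r) * \<rho> z) (at r)"
      using hf_curve[OF DERIV_const d1 Q] by simp
    have "(B has_real_derivative hP (P z) (\<rho> z * r) - \<alpha> * jf (P z) (\<rho> z * r)) (at (\<rho> z * r))"
      unfolding B_def \<alpha>_def using hP_split[OF Q] P_bounds[OF z] by auto
    from DERIV_chain2[OF this d1]
    have d3: "((\<lambda>r. B (\<rho> z * r)) has_real_derivative (hP (P z) (\<rho> z * r) - \<alpha> * jf (P z) (\<rho> z * r)) * \<rho> z) (at r)" .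
    show "(G has_real_derivative fz z r - P' z * \<alpha> * (\<rho> z * jf (P z) (\<rho> z * r))) (at r)"
      unfolding G_def fz_def
      by (rule derivative_eq_intros d2 d3 refl)+ (simp add: algebra_simps)
  qed
  then show ?thesis unfolding T_def[abs_def] J_def G_def B_def by simp
qed

lemma J_deriv_raw:
  assumes z: "0 < z" "z < 1"
  shows "(J has_real_derivative
    \<rho>' z * jf (P z) (\<rho> z) + P' z * ((1 - P z) * \<rho> z * hf (P z) (\<rho> z)) + P' z * (3/2 * (2 * P z - 1)) * T z) (at z)"
proof -
  define fz where "fz z r = \<rho>' z * jf (P z) (\<rho> z * r) + \<rho> z * (jP (P z) (\<rho> z * r) * P' z + jt (P z) (\<rho> z * r) * (\<rho>' z * r))" for z r
  define B where "B t = (1 - P z) * t * hf (P z) t" for t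
  define G where "G r = \<rho>' z * r * jf (P z) (\<rho> z * r) + P' z * B (\<rho> z * r)" for r
  have "((\<lambda>z. integral {0..1} (\<lambda>r. \<rho> z * jf (P z) (\<rho> z * r))) has_real_derivative
      G 1 - G 0 + P' z * (3/2 * (2 * P z - 1)) * integral {0..1} (\<lambda>r. \<rho> z * hf (P z) (\<rho> z * r))) (at z)"
  proof (rule deriv_integral_split[where U="{0<..<1}" and fz=fz])
    show "open {0<..<1::real}" "convex {0<..<1::real}" "z \<in> {0<..<1}" using z by auto
    fix x r assume x: "x \<in> {0<..<1::real}" and r: "r \<in> {0..1::real}"
    then have xx: "0 < x" "x < 1" by auto
    have "((\<lambda>x. \<rho> x * r) has_real_derivative \<rho>' x * r) (at x)" using \<rho>_deriv[OF xx] by (rule DERIV_cmult_right)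
    note h = jf_curve[OF P_deriv[OF xx] this t_bounds(4)[OF xx r]]
    show "((\<lambda>z. \<rho> z * jf (P z) (\<rho> z * r)) has_real_derivative fz x r) (at x)"
      unfolding fz_def by (rule DERIV_cong[OF DERIV_mult[OF \<rho>_deriv[OF xx] h]]) (simp add: algebra_simps)
  next
    have Q: "0 < Qf (case x of (z, r) \<Rightarrow> P z) (case x of (z, r) \<Rightarrow> \<rho> z * r)" if "x \<in> {0<..<1} \<times> {0..1}" for x
      using that t_bounds(4) by auto
    have ct: "continuous_on ({0<..<1} \<times> {0..1}) (\<lambda>(z, r). \<rho> z * r)"
      using cont_curve_pair(2) by (auto simp: case_prod_beta intro!: continuous_intros)
    note K = cont_kernels[OF cont_curve_pair(1) ct Q]
    show "continuous_on ({0<..<1} \<times> {0..1}) (\<lambda>(z, r). fz z r)"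
      using K(4-6) cont_curve_pair unfolding fz_def by (auto simp: case_prod_beta intro!: continuous_intros)
  next
    fix x assume x: "x \<in> {0<..<1::real}"
    then have xx: "0 < x" "x < 1" by auto
    show "continuous_on {0..1} (\<lambda>r. \<rho> x * jf (P x) (\<rho> x * r))"
      by (intro continuous_intros cont_kernels t_bounds(4)[OF xx])
  next
    show "continuous_on {0..1} (\<lambda>r. \<rho> z * hf (P z) (\<rho> z * r))"
      by (intro continuous_intros cont_kernels t_bounds(4)[OF z])
    fix r assume r: "r \<in> {0..1::real}"
    note Q = t_bounds(4)[OF z r]
    have d1: "((\<lambda>r. \<rho> z * r) has_real_derivative \<rho> z) (at r)" by (auto intro!: derivative_eq_intros)
    have d2: "((\<lambda>r. jf (P z) (\<rho> z * r)) has_real_derivative jt (P z) (\<rho> z * r) * \<rho> z) (at r)"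
      using jf_curve[OF DERIV_const d1 Q] by simp
    have "(B has_real_derivative jP (P z) (\<rho> z * r) - (3/2 * (2 * P z - 1)) * hf (P z) (\<rho> z * r)) (at (\<rho> z * r))"
      unfolding B_def by (rule jP_split[OF Q])
    from DERIV_chain2[OF this d1]
    have d3: "((\<lambda>r. B (\<rho> z * r)) has_real_derivative (jP (P z) (\<rho> z * r) - (3/2 * (2 * P z - 1)) * hf (P z) (\<rho> z * r)) * \<rho> z) (at r)" .
    show "(G has_real_derivative fz z r - P' z * (3/2 * (2 * P z - 1)) * (\<rho> z * hf (P z) (\<rho> z * r))) (at r)"
      unfolding G_def fz_def
      by (rule derivative_eq_intros d2 d3 refl)+ (simp add: algebra_simps)
  qed
  then show ?thesis unfolding J_def[abs_def] T_def G_def B_def by simp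
qed

end

section \<open>Signs of \<open>K\<close> and \<open>H\<close> and monotonicity of the length\<close>

context period_curve begin

definition K :: "real \<Rightarrow> real" where "K z = 2 * c * z * sqrt (1 - z) + (1 - 2 * z) * J z"
text \<open>Up to the positive factor u(pi) sqrt (1 - z) this is the value at the vertex of the even
  zero-energy solution \<open>w\<close> constructed later on a loop.\<close>

definition H :: "real \<Rightarrow> real" where "H z = sqrt (1 - z) * (1 - 2 * k2 * z) - c * J z"

lemma J_deriv:
  assumes z: "0 < z" "z < 1"
  shows "(J has_real_derivative - (3/2 * k2 * (1 - 2 * z) * T z) - c / (2 * sqrt (1 - z))) (at z)"
proof (rule DERIV_cong[OF J_deriv_raw[OF z]])
  define s where "s = sqrt (1 - z)"
  have s: "s > 0" using z by (simp add: s_def)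
  have m: "P' z * (2 * P z - 1) = - k2 * (1 - 2 * z)"
    unfolding P_bounds(3)[OF z] P'_def using M_pos[OF z] by simp
  have jf: "jf (P z) (\<rho> z) = (2 * (P z)\<^sup>2 - 2 * P z + z) * hf (P z) (\<rho> z)"
    unfolding jf_def \<rho>_sq[OF z] by (simp add: algebra_simps)
  have 1: "\<rho>' z * jf (P z) (\<rho> z) = ((P' z - 1) / 2 * (2 * (P z)\<^sup>2 - 2 * P z + z)) / (c * z * s)"
    unfolding jf hf_end[OF z] \<rho>'_def s_def[symmetric] using \<rho>_pos[OF z] c0 z s by (simp add: field_simps)
  have 2: "P' z * ((1 - P z) * \<rho> z * hf (P z) (\<rho> z)) = (P' z * (1 - P z) * (P z - z)) / (c * z * s)"
    unfolding hf_end[OF z] \<rho>_sq[OF z, symmetric] s_def[symmetric] by (simp add: power2_eq_square)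
  have N: "(P' z - 1) / 2 * (2 * (P z)\<^sup>2 - 2 * P z + z) + P' z * (1 - P z) * (P z - z) = - (c\<^sup>2) * z / 2"
  proof -
    have "(P' z - 1) / 2 * (2 * (P z)\<^sup>2 - 2 * P z + z) + P' z * (1 - P z) * (P z - z)
        = (P' z * (2 * P z - 1)) * z / 2 + P z * (1 - P z) - z / 2"
      by (simp add: power2_eq_square field_simps)
    also have "\<dots> = - (c\<^sup>2) * z / 2"
      unfolding m P_eq[OF z] k2_def by (simp add: field_simps)
    finally show ?thesis .
  qed
  have 3: "\<rho>' z * jf (P z) (\<rho> z) + P' z * ((1 - P z) * \<rho> z * hf (P z) (\<rho> z)) = - c / (2 * s)"
    unfolding 1 2 add_divide_distrib[symmetric] N using c0 z s by (simp add: field_simps power2_eq_square)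
  have 4: "P' z * (3 / 2 * (2 * P z - 1)) * T z = 3/2 * (P' z * (2 * P z - 1)) * T z" by simp
  show "\<rho>' z * jf (P z) (\<rho> z) + P' z * ((1 - P z) * \<rho> z * hf (P z) (\<rho> z)) + P' z * (3 / 2 * (2 * P z - 1)) * T z
     = - (3/2 * k2 * (1 - 2 * z) * T z) - c / (2 * sqrt (1 - z))"
    unfolding 3 4 m s_def[symmetric] by simp
qed

text \<open>The boundary terms collapse to - 2 c z sqrt (1 - z) over the common denominator, by the
  relation P (1 - P) = \<open>k2\<close> z (1 - z) and its derivative; together with the term in J
  they form - K.\<close>

lemma T_deriv:
  assumes z: "0 < z" "z < 1"
  shows "(T has_real_derivative - K z / (2 * (z * (1 - z)) * (M z)\<^sup>2)) (at z)"
proof (rule DERIV_cong[OF T_deriv_raw[OF z]])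
  define s where "s = sqrt (1 - z)"
  have s: "s > 0" "s * s = 1 - z" using z by (auto simp: s_def)
  define m where "m = M z"
  have m: "m > 0" using M_pos[OF z] by (simp add: m_def)
  define \<alpha> where "\<alpha> = 1 / (2 * P z * (1 - P z) * (2 * P z - 1))"
  define \<beta> where "\<beta> = - (1 - 2 * z) / (2 * (z * (1 - z)) * m\<^sup>2)"
  have zz: "z * (1 - z) > 0" "k2 > 0" using z k2_bounds by auto
  have "2 * P z * (1 - P z) * (2 * P z - 1) = 2 * (k2 * (z * (1 - z))) * m"
    unfolding P_bounds(3)[OF z] m_def[symmetric] using P_eq[OF z] by simp
  then have "\<alpha> = 1 / (2 * (k2 * (z * (1 - z))) * m)" unfolding \<alpha>_def by (simp only:)
  moreover have "- k2 * y / m * (1 / (2 * (k2 * w) * m)) = - y / (2 * w * m\<^sup>2)" if "w > 0" for w y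
    using that zz(2) m by (simp add: field_simps power2_eq_square)
  ultimately have ab: "P' z * \<alpha> = \<beta>"
    unfolding P'_def \<beta>_def m_def[symmetric] using zz(1) by (simp only:)
  have mP: "m = 2 * P z - 1" using P_bounds(3)[OF z] by (simp add: m_def)
  have mP': "m * P' z = - k2 * (1 - 2 * z)" unfolding P'_def m_def[symmetric] using m by simp
  have 1: "\<rho>' z * hf (P z) (\<rho> z) = ((P' z - 1) / 2) / (c * z * s)"
    unfolding hf_end[OF z] \<rho>'_def s_def[symmetric] using \<rho>_pos[OF z] c0 z s by (simp add: field_simps)
  have 2: "\<rho> z * (2 * (P z)\<^sup>2 - 4 * P z + 1 + (\<rho> z)\<^sup>2) * hf (P z) (\<rho> z) = ((2 * (P z)\<^sup>2 - 3 * P z + 1 - z) * (P z - z)) / (c * z * s)"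
  proof -
    have "\<rho> z * (2 * (P z)\<^sup>2 - 4 * P z + 1 + (\<rho> z)\<^sup>2) * hf (P z) (\<rho> z) = ((2 * (P z)\<^sup>2 - 4 * P z + 1 + (\<rho> z)\<^sup>2) * (\<rho> z)\<^sup>2) / (c * z * s)"
      unfolding hf_end[OF z] s_def[symmetric] by (simp add: power2_eq_square)
    then show ?thesis unfolding \<rho>_sq[OF z] by (simp add: algebra_simps)
  qed
  have N: "(P' z - 1) / 2 + \<beta> * ((2 * (P z)\<^sup>2 - 3 * P z + 1 - z) * (P z - z)) = - (c\<^sup>2) * z / m\<^sup>2"
  proof -
    have "z * (1 - z) * m * (m * P' z) - z * (1 - z) * m\<^sup>2 - (1 - 2 * z) * ((2 * (P z)\<^sup>2 - 3 * P z + 1 - z) * (P z - z))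
        = - (P z * (1 - P z)) * (2 * P z - 1) * (1 - 2 * z) - z * (1 - z) * (2 * P z - 1)\<^sup>2
           - (1 - 2 * z) * ((2 * (P z)\<^sup>2 - 3 * P z + 1 - z) * (P z - z))"
      unfolding mP' P_eq[OF z] by (simp add: mP algebra_simps)
    also have "\<dots> = 2 * z * (P z * (1 - P z)) - 2 * z\<^sup>2 * (1 - z)" by algebra
    also have "\<dots> = - (2 * c\<^sup>2 * z\<^sup>2 * (1 - z))" unfolding P_eq[OF z] k2_def by (simp add: power2_eq_square algebra_simps)
    finally have *: "z * (1 - z) * m * (m * P' z) - z * (1 - z) * m\<^sup>2 - (1 - 2 * z) * ((2 * (P z)\<^sup>2 - 3 * P z + 1 - z) * (P z - z))
       = - (2 * c\<^sup>2 * z\<^sup>2 * (1 - z))" .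
    have aux: "(p - 1) / 2 + (- y / (2 * w * m\<^sup>2)) * X = (w * m * (m * p) - w * m\<^sup>2 - y * X) / (2 * w * m\<^sup>2)"
      if "w > 0" for p y w X using that m by (simp add: field_simps power2_eq_square)
    show ?thesis unfolding \<beta>_def aux[OF zz(1)] * using z m by (simp add: field_simps power2_eq_square)
  qed
  have "\<rho>' z * hf (P z) (\<rho> z) + P' z * (\<alpha> * (\<rho> z * (2 * (P z)\<^sup>2 - 4 * P z + 1 + (\<rho> z)\<^sup>2) * hf (P z) (\<rho> z)))
    = ((P' z - 1) / 2 + \<beta> * ((2 * (P z)\<^sup>2 - 3 * P z + 1 - z) * (P z - z))) / (c * z * s)"
    unfolding 1 2 ab[symmetric] by (simp add: add_divide_distrib)
  also have "\<dots> = - (2 * c * z * s) / (2 * (z * (s * s)) * m\<^sup>2)"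
    unfolding N using c0 z s m by (simp add: field_simps power2_eq_square)
  finally have 3: "\<rho>' z * hf (P z) (\<rho> z) + P' z * (\<alpha> * (\<rho> z * (2 * (P z)\<^sup>2 - 4 * P z + 1 + (\<rho> z)\<^sup>2) * hf (P z) (\<rho> z)))
     = - (2 * c * z * s) / (2 * (z * (1 - z)) * m\<^sup>2)" unfolding s(2) .
  show "\<rho>' z * hf (P z) (\<rho> z) + P' z * (1 / (2 * P z * (1 - P z) * (2 * P z - 1)) * (\<rho> z * (2 * (P z)\<^sup>2 - 4 * P z + 1 + (\<rho> z)\<^sup>2) * hf (P z) (\<rho> z)))
      + P' z * (1 / (2 * P z * (1 - P z) * (2 * P z - 1))) * J z = - K z / (2 * (z * (1 - z)) * (M z)\<^sup>2)"
    unfolding \<alpha>_def[symmetric] 3 ab m_def[symmetric] K_def s_def[symmetric] \<beta>_def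
    by (simp add: add_divide_distrib[symmetric] diff_divide_distrib[symmetric] algebra_simps)
qed

lemma kernel_cont:
  assumes z: "0 < z" "z < 1"
  shows "continuous_on {0..1} (\<lambda>r. \<rho> z * hf (P z) (\<rho> z * r))" "continuous_on {0..1} (\<lambda>r. \<rho> z * jf (P z) (\<rho> z * r))"
proof -
  show "continuous_on {0..1} (\<lambda>r. \<rho> z * hf (P z) (\<rho> z * r))" by (intro continuous_intros cont_kernels t_bounds(4)[OF z])
  show "continuous_on {0..1} (\<lambda>r. \<rho> z * jf (P z) (\<rho> z * r))" by (intro continuous_intros cont_kernels t_bounds(4)[OF z])
qed

lemma T_nonneg: 
  assumes z: "0 < z" "z < 1"
  shows "0 \<le> T z"
  unfolding T_def
  by (rule integral_nonneg[OF integrable_continuous_real[OF kernel_cont(1)[OF z]]])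
    (use \<rho>_pos[OF z] in \<open>simp add: hf_def less_imp_le[OF t_bounds(4)[OF z]]\<close>)

lemma J_nonneg:
  assumes z: "1/2 \<le> z" "z < 1"
  shows "0 \<le> J z"
  unfolding J_def
proof (rule integral_nonneg[OF integrable_continuous_real[OF kernel_cont(2)]])
  show z': "0 < z" "z < 1" using z by auto
  fix r :: real assume r: "r \<in> {0..1}"
  have "k2 * (1 - z) \<le> 1 * (1/2)" using k2_bounds z by (intro mult_mono) auto
  then have "k2 * (z * (1 - z)) \<le> z * (1/2)"
    using mult_left_mono[of "k2 * (1 - z)" "1/2" z] z by (simp add: mult.left_commute)
  then have "0 \<le> 2 * (P z)\<^sup>2 - P z - (\<rho> z * r)\<^sup>2"
    using t_bounds(2)[OF z' r] P_eq[OF z'] by (simp add: power2_eq_square algebra_simps)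
  then show "0 \<le> \<rho> z * jf (P z) (\<rho> z * r)"
    using \<rho>_pos[OF z'] t_bounds(4)[OF z' r] unfolding jf_def hf_def by simp
qed

text \<open>\<open>hf\<close> is largest at the vertex end of the loop, where its value is known
  from \<open>hf_end\<close>.\<close>

lemma T_upper:
  assumes z: "0 < z" "z < 1"
  shows "c * T z * sqrt (1 - z) \<le> (1 - z) / z"
proof -
  have "T z \<le> integral {0..1} (\<lambda>r::real. \<rho> z * hf (P z) (\<rho> z))"
    unfolding T_def
  proof (rule integral_le[OF integrable_continuous_real[OF kernel_cont(1)[OF z]]])
    fix r :: real assume r: "r \<in> {0..1}"
    have "0 < Qf (P z) (\<rho> z)" using t_bounds(4)[OF z, of 1] by simp
    then show "\<rho> z * hf (P z) (\<rho> z * r) \<le> \<rho> z * hf (P z) (\<rho> z)"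
      using t_bounds(3)[OF z r] \<rho>_pos[OF z] unfolding hf_def by (intro mult_left_mono divide_left_mono) auto
  qed auto
  also have "\<dots> = (P z - z) / (c * z * sqrt (1 - z))" using \<rho>_sq[OF z] by (simp add: hf_end[OF z] power2_eq_square)
  finally have "c * T z * sqrt (1 - z) \<le> (P z - z) / z" using c0 z by (simp add: field_simps)
  also have "\<dots> \<le> (1 - z) / z" using P_bounds(2)[OF z] z by (simp add: divide_right_mono)
  finally show ?thesis .
qed

text \<open>With s = t^2 and m = 2 P - 1, \<open>jf\<close> is the derivative of t sqrt Q plus 3 s
  (m - s) / sqrt Q, and the latter is at most 3 t sqrt (1 - P + s), the derivative of (1 - P +
  s)^(3/2). At the vertex 1 - P + s becomes 1 - z, so the majorant \<open>B\<close> yields an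
  elementary bound.\<close>

lemma J_upper:
  assumes z: "0 < z" "z < 1"
  shows "J z \<le> sqrt (1 - z) * (1 - z + c * z)"
proof -
  define B where "B t = t * sqrt (Qf (P z) t) + (1 - P z + t\<^sup>2) * sqrt (1 - P z + t\<^sup>2)" for t
  define B' where "B' t = (Qf (P z) t + t * (4 * t ^ 3 - 2 * (3 * P z - 1) * t) / 2) / sqrt (Qf (P z) t) + 3 * t * sqrt (1 - P z + t\<^sup>2)" for t
  have dB: "(B has_real_derivative B' t) (at t)" if Q: "0 < Qf (P z) t" for t
  proof -
    have dQ: "((\<lambda>t. Qf (P z) t) has_real_derivative (4 * t ^ 3 - 2 * (3 * P z - 1) * t)) (at t)"
      unfolding Qf_def by (auto intro!: derivative_eq_intros simp: algebra_simps power2_eq_square power3_eq_cube)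
    note d1 = DERIV_chain2[OF DERIV_real_sqrt[OF Q] dQ]
    have W: "0 < 1 - P z + t\<^sup>2" using P_bounds(2)[OF z] by (simp add: add_pos_nonneg)
    have dW: "((\<lambda>t. 1 - P z + t\<^sup>2) has_real_derivative 2 * t) (at t)" by (auto intro!: derivative_eq_intros)
    note d2 = DERIV_chain2[OF DERIV_real_sqrt[OF W] dW]
    have e1: "1 * D + inverse D / 2 * X * t + (2 * t * w + inverse w / 2 * (2 * t) * W) = (Q + t * X / 2) / D + 3 * t * w"
      if "D > 0" "w > 0" "D * D = Q" "w * w = W" for D w Q W X :: real
      using that(1,2) unfolding that(3,4)[symmetric] by (simp add: field_simps)
    show ?thesis unfolding B_def B'_def
      by (rule DERIV_cong[OF DERIV_add[OF DERIV_mult[OF DERIV_ident d1] DERIV_mult[OF dW d2]]])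
         (rule e1, use Q W in auto)
  qed
  have le: "jf (P z) t \<le> B' t" if t: "0 \<le> t" "t\<^sup>2 \<le> P z - z" for t
  proof -
    define s where "s = t\<^sup>2"
    define D where "D = sqrt (Qf (P z) t)"
    define w where "w = sqrt (1 - P z + s)"
    define m where "m = 2 * P z - 1"
    have f: "0 < P z - s" "0 < m - s" "0 \<le> s" "0 < 1 - P z + s" using t P_gt[OF z] P_bounds[OF z] z by (auto simp: s_def m_def add_pos_nonneg)
    have Qs: "Qf (P z) t = (P z - s) * (m - s)" by (simp add: Qf_def s_def m_def)
    have D: "D > 0" "D\<^sup>2 = (P z - s) * (m - s)" unfolding D_def Qs using f by auto
    have w: "w \<ge> 0" "w\<^sup>2 = 1 - P z + s" unfolding w_def using f by auto
    have "s * (m - s) \<le> t * w * D"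
    proof (rule power2_le_imp_le)
      \<comment> \<open>Multiplied by s (m - s), this compares the squares of the two sides of the
        goal; the gap between both sides here is the constant P (1 - P).\<close>
      have "s * (m - s) \<le> (1 - P z + s) * (P z - s)"
      proof -
        have "(1 - P z + s) * (P z - s) - s * (m - s) = P z * (1 - P z)" by (simp add: m_def algebra_simps)
        also have "\<dots> > 0" using P_bounds[OF z] by simp
        finally show ?thesis by simp
      qed
      from mult_left_mono[OF this, of "s * (m - s)"]
      show "(s * (m - s))\<^sup>2 \<le> (t * w * D)\<^sup>2"
        unfolding power_mult_distrib D w s_def[symmetric] using f by (simp add: power2_eq_square mult_ac)
      show "0 \<le> t * w * D" using t w D by simp
    qed
    moreover have "(2 * (P z)\<^sup>2 - P z - s) - (Qf (P z) t + t * (4 * t ^ 3 - 2 * (3 * P z - 1) * t) / 2) = 3 * (s * (m - s))"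
      unfolding Qf_def s_def m_def by (simp add: power2_eq_square power3_eq_cube field_simps)
    ultimately have "(2 * (P z)\<^sup>2 - P z - s) \<le> (Qf (P z) t + t * (4 * t ^ 3 - 2 * (3 * P z - 1) * t) / 2) + 3 * t * w * D" by linarith
    then have "(2 * (P z)\<^sup>2 - P z - s) / D \<le> ((Qf (P z) t + t * (4 * t ^ 3 - 2 * (3 * P z - 1) * t) / 2) + 3 * t * w * D) / D"
      using D(1) by (intro divide_right_mono) auto
    then show ?thesis unfolding jf_def B'_def hf_def D_def[symmetric] s_def[symmetric] w_def[symmetric] using D(1)
      by (simp add: add_divide_distrib)
  qed
  have I1: "((\<lambda>r. B' (\<rho> z * r) * \<rho> z) has_integral B (\<rho> z * 1) - B (\<rho> z * 0)) {0..1}"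
  proof (rule fundamental_theorem_of_calculus)
    fix r :: real assume r: "r \<in> {0..1}"
    have d1: "((\<lambda>r. \<rho> z * r) has_real_derivative \<rho> z) (at r)" by (auto intro!: derivative_eq_intros)
    show "((\<lambda>r. B (\<rho> z * r)) has_vector_derivative B' (\<rho> z * r) * \<rho> z) (at r within {0..1})"
      unfolding has_real_derivative_iff_has_vector_derivative[symmetric]
      by (rule has_field_derivative_at_within[OF DERIV_chain2[OF dB[OF t_bounds(4)[OF z r]] d1]])
  qed simp
  have I2: "((\<lambda>r. \<rho> z * jf (P z) (\<rho> z * r)) has_integral J z) {0..1}"
    unfolding J_def by (intro integrable_integral integrable_continuous_real kernel_cont z)
  have "J z \<le> B (\<rho> z * 1) - B (\<rho> z * 0)"
    by (rule has_integral_le[OF I2 I1])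
      (use le t_bounds(2)[OF z] \<rho>_pos[OF z] in \<open>auto simp: mult.commute[of "B' _"] intro!: mult_left_mono\<close>)
  also have "\<dots> = c * z * sqrt (1 - z) + (1 - z) * sqrt (1 - z) - (1 - P z) * sqrt (1 - P z)"
    unfolding B_def mult_1_right \<rho>_sq[OF z] Q_end'[OF z] using \<rho>_pos[OF z] by simp
  also have "\<dots> \<le> c * z * sqrt (1 - z) + (1 - z) * sqrt (1 - z)" using P_bounds[OF z] by simp
  also have "\<dots> = sqrt (1 - z) * (1 - z + c * z)" by (simp add: algebra_simps)
  finally show ?thesis .
qed

text \<open>For z <= 1/2 the integral J decreases towards J (1/2) >= 0. For z > 1/2 the factor 1 - 2
  z is negative, and dividing K by 2 c (2 z - 1) leaves J with a constant coefficient; the quotient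
  R decreases because T >= 0, and it is positive near 1 by \<open>J_upper\<close>.\<close>

lemma K_pos:
  assumes z: "0 < z" "z < 1"
  shows "0 < K z"
proof (cases "z \<le> 1/2")
  case True
  have "J (1/2) \<le> J z"
  proof (rule DERIV_nonpos_imp_nonincreasing[OF True])
    fix x assume x: "z \<le> x" "x \<le> 1/2"
    then have xx: "0 < x" "x < 1" using z by auto
    have "0 \<le> 3/2 * k2 * (1 - 2 * x) * T x" using T_nonneg[OF xx] k2_bounds x by simp
    moreover have "0 \<le> c / (2 * sqrt (1 - x))" using c0 xx by simp
    ultimately show "\<exists>y. (J has_real_derivative y) (at x) \<and> y \<le> 0" using J_deriv[OF xx] by (intro exI conjI) (assumption, linarith)
  qed
  then have "0 \<le> J z" using J_nonneg[of "1/2"] by simp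
  then have "0 \<le> (1 - 2 * z) * J z" using True by simp
  moreover have "0 < 2 * c * z * sqrt (1 - z)" using c0 z by simp
  ultimately show ?thesis unfolding K_def by linarith
next
  case False
  define R where "R z = z * sqrt (1 - z) / (2 * z - 1) - J z / (2 * c)" for z
  have Rnear: "0 < R x" if x: "1 - c < x" "x < 1" for x
  proof -
    have x2: "1/2 < x" using x c1 by simp
    have "J x / (2 * c) \<le> sqrt (1 - x) * (1 - x + c * x) / (2 * c)"
      using J_upper[of x] x x2 c0 by (intro divide_right_mono) auto
    then have "R x \<ge> sqrt (1 - x) * (x / (2 * x - 1) - (1 - x + c * x) / (2 * c))"
      unfolding R_def right_diff_distrib times_divide_eq_right by (simp add: mult.commute)
    moreover have "(1 - x + c * x) / (2 * c) < x / (2 * x - 1)"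
    proof -
      have cx: "c * x < c" using x c0 by simp
      have "1 - x + c * x < c + c" using x(1) cx by linarith
      then have "(1 - x + c * x) / (2 * c) < (c + c) / (2 * c)"
        using c0 by (intro divide_strict_right_mono) auto
      also have "\<dots> = 1" using c0 by simp
      also have "1 \<le> x / (2 * x - 1)" using x x2 by (simp add: field_simps)
      finally show ?thesis .
    qed
    then have "0 < sqrt (1 - x) * (x / (2 * x - 1) - (1 - x + c * x) / (2 * c))" using x by simp
    ultimately show ?thesis by linarith
  qed
  have "0 < R z"
  proof (cases "1 - c < z")
    case True
    then show ?thesis using Rnear z by simp
  next
    case nt: False
    \<comment> \<open>Any point between 1 - c and 1 would do: R is positive there, and z lies to the
      left.\<close>
    define y where "y = 1 - c / 2"
    have y: "z < y" "y < 1" "1 - c < y" using nt c0 by (auto simp: y_def)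
    have "R y < R z"
    proof (rule DERIV_neg_imp_decreasing[OF y(1)])
      fix x assume x: "z \<le> x" "x \<le> y"
      then have xx: "0 < x" "x < 1" "1/2 < x" using z y False by auto
      define s where "s = sqrt (1 - x)"
      have s: "s > 0" "s * s = 1 - x" using xx by (auto simp: s_def)
      have p: "0 < 1 - x" using xx by simp
      have ds: "((\<lambda>x. sqrt (1 - x)) has_real_derivative inverse s / 2 * (0 - 1)) (at x)"
        unfolding s_def by (rule DERIV_chain2[where f=sqrt and g="\<lambda>x. 1 - x", OF DERIV_real_sqrt[OF p]]) (rule derivative_eq_intros refl)+
      have "(R has_real_derivative ((1 * s + inverse s / 2 * (0 - 1) * x) * (2 * x - 1) - x * s * 2) / ((2 * x - 1) * (2 * x - 1))
         - (- (3/2 * k2 * (1 - 2 * x) * T x) - c / (2 * s)) / (2 * c)) (at x)"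
        unfolding R_def s_def
        by (rule DERIV_cong[OF DERIV_diff[OF DERIV_divide[OF DERIV_mult[OF DERIV_ident ds[unfolded s_def]]] DERIV_cdivide[OF J_deriv[OF xx(1,2)]]]])
          (use xx in \<open>auto intro!: derivative_eq_intros\<close>)
      \<comment> \<open>The term 1 / (4 s) from the inhomogeneity of J' cancels against the
        derivative of the elementary quotient, and both remaining contributions are
        nonpositive.\<close>
      moreover have "((1 * s + inverse s / 2 * (0 - 1) * x) * (2 * x - 1) - x * s * 2) / ((2 * x - 1) * (2 * x - 1))
         - (- (3/2 * k2 * (1 - 2 * x) * T x) - c / (2 * s)) / (2 * c)
         = (2 * x - 3) / (4 * s * (2 * x - 1)\<^sup>2) - 3/(4 * c) * (k2 * (2 * x - 1) * T x)"
      proof -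
        define q where "q = 2 * x - 1"
        have q: "q > 0" using xx by (simp add: q_def)
        have "((1 * s + inverse s / 2 * (0 - 1) * x) * q - x * s * 2) / (q * q)
          = ((2 * (s * s) - x) * q - 4 * x * (s * s)) / (2 * s * q\<^sup>2)" 
          using q s(1) by (simp add: field_simps power2_eq_square)
        also have "(2 * (s * s) - x) * q - 4 * x * (s * s) = ((2 * x - 3) - q\<^sup>2) / 2"
          unfolding s(2) q_def by (simp add: field_simps power2_eq_square)
        also have "((2 * x - 3) - q\<^sup>2) / 2 / (2 * s * q\<^sup>2) = (2 * x - 3) / (4 * s * q\<^sup>2) - 1 / (4 * s)"
          using q s(1) by (simp add: field_simps)
        finally have a: "((1 * s + inverse s / 2 * (0 - 1) * x) * q - x * s * 2) / (q * q) = (2 * x - 3) / (4 * s * q\<^sup>2) - 1 / (4 * s)" .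
        have b: "(- (3/2 * k2 * (1 - 2 * x) * T x) - c / (2 * s)) / (2 * c) = 3/(4 * c) * (k2 * q * T x) - 1 / (4 * s)"
          using c0 s(1) unfolding q_def by (simp add: field_simps)
        show ?thesis unfolding q_def[symmetric] a b by simp
      qed
      moreover have "(2 * x - 3) / (4 * s * (2 * x - 1)\<^sup>2) < 0" using xx s by (intro divide_neg_pos) auto
      moreover have "0 \<le> 3/(4 * c) * (k2 * (2 * x - 1) * T x)" using T_nonneg[OF xx(1,2)] k2_bounds xx c0 by simp
      ultimately show "\<exists>y. (R has_real_derivative y) (at x) \<and> y < 0" by (intro exI conjI) (assumption, linarith)
    qed
    then show ?thesis using Rnear y by fastforce
  qed
  then have "0 < 2 * c * (2 * z - 1) * R z" using c0 False by simp
  also have "\<dots> = K z" unfolding R_def K_def using c0 False by (simp add: field_simps)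
  finally show ?thesis .
qed

lemma T_strict_antimono:
  assumes "0 < z1" "z1 < z2" "z2 < 1"
  shows "T z2 < T z1"
proof (rule DERIV_neg_imp_decreasing[OF assms(2)])
  fix x assume "z1 \<le> x" "x \<le> z2"
  then have x: "0 < x" "x < 1" using assms by auto
  have "- K x / (2 * (x * (1 - x)) * (M x)\<^sup>2) < 0"
    using K_pos[OF x] M_pos[OF x] x by (simp add: divide_neg_pos)
  then show "\<exists>y. (T has_real_derivative y) (at x) \<and> y < 0" using T_deriv[OF x] by blast
qed

text \<open>After inserting \<open>J_upper\<close> the bracket factors as (1 - c) (1 - z (2 + c));
  the zero 1 / (2 + c) is the left end of the critical window in \<open>H_sign\<close>.\<close>

lemma H_lower:
  assumes z: "0 < z" "z < 1"
  shows "sqrt (1 - z) * ((1 - c) * (1 - z * (2 + c))) \<le> H z"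
proof -
  have "c * J z \<le> c * (sqrt (1 - z) * (1 - z + c * z))" using J_upper[OF z] c0 by simp
  moreover have "sqrt (1 - z) * (1 - 2 * k2 * z) - c * (sqrt (1 - z) * (1 - z + c * z)) = sqrt (1 - z) * ((1 - c) * (1 - z * (2 + c)))"
    unfolding k2_def by (simp add: algebra_simps power2_eq_square)
  ultimately show ?thesis unfolding H_def by linarith
qed

lemma H_deriv:
  assumes z: "0 < z" "z < 1"
  shows "(H has_real_derivative k2 / (2 * sqrt (1 - z)) * (6 * z - 5) + 3/2 * c * k2 * (1 - 2 * z) * T z) (at z)"
proof -
  define s where "s = sqrt (1 - z)"
  have s: "s > 0" "s * s = 1 - z" using z by (auto simp: s_def)
  have p: "0 < 1 - z" using z by simp
  have ds: "((\<lambda>x. sqrt (1 - x)) has_real_derivative inverse s / 2 * (0 - 1)) (at z)"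
    unfolding s_def by (rule DERIV_chain2[where f=sqrt and g="\<lambda>x. 1 - x", OF DERIV_real_sqrt[OF p]]) (rule derivative_eq_intros refl)+
  have "(H has_real_derivative (inverse s / 2 * (0 - 1)) * (1 - 2 * k2 * z) + (- 2 * k2) * s
     - c * (- (3/2 * k2 * (1 - 2 * z) * T z) - c / (2 * s))) (at z)"
    unfolding H_def s_def
    by (rule DERIV_diff[OF DERIV_mult[OF ds[unfolded s_def]] DERIV_cmult[OF J_deriv[OF z]]])
      (auto intro!: derivative_eq_intros)
  moreover have "(inverse s / 2 * (0 - 1)) * (1 - 2 * k2 * z) + (- 2 * k2) * s = (- 1 + 2 * k2 * z - 4 * k2 * (s * s)) / (2 * s)"
    using s(1) by (simp add: field_simps)
  moreover have "(- 1 + 2 * k2 * z - 4 * k2 * (s * s)) / (2 * s) + c * (c / (2 * s)) = k2 / (2 * s) * (6 * z - 5)"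
    unfolding s(2) add_divide_distrib[symmetric] times_divide_eq_right k2_def by (simp add: algebra_simps power2_eq_square)
  moreover have "A - c * (- (3/2 * k2 * (1 - 2 * z) * T z) - c / (2 * s)) = A + c * (c / (2 * s)) + 3/2 * c * k2 * (1 - 2 * z) * T z" for A
    by (simp add: algebra_simps)
  ultimately show ?thesis unfolding s_def[symmetric] by (simp only:)
qed

lemma H_sign:
  obtains zs where "0 < zs" "zs < 1" "H zs = 0" "\<And>z. 0 < z \<Longrightarrow> z < zs \<Longrightarrow> 0 < H z" "\<And>z. zs < z \<Longrightarrow> z < 1 \<Longrightarrow> H z < 0"
proof -
  define lo where "lo = 1 / (2 + c)"
  define hi where "hi = 1 / (2 * k2)"
  \<comment> \<open>The numbers come from c <= 1/4: the window from lo to hi stays within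
    [4/9, 8/15], which is narrow enough for crude bounds on H'.\<close>
  have lo: "4 / 9 \<le> lo" "lo < 1/2" using c0 c1 by (auto simp: lo_def field_simps)
  have hi: "1/2 < hi" "hi \<le> 8/15" using k2_bounds by (auto simp: hi_def field_simps)
  have below: "0 < H z" if "0 < z" "z < lo" for z
  proof -
    have "z * (2 + c) < 1" using that c0 by (simp add: lo_def field_simps)
    then have "0 < sqrt (1 - z) * ((1 - c) * (1 - z * (2 + c)))" using that lo c1 by simp
    also have "\<dots> \<le> H z" using H_lower that lo by simp
    finally show ?thesis .
  qed
  have "sqrt (1 - lo) * ((1 - c) * (1 - lo * (2 + c))) \<le> H lo" by (rule H_lower) (use lo in auto)
  then have Hlo: "0 \<le> H lo" using c0 by (simp add: lo_def)
  have above: "H z < 0" if "hi < z" "z < 1" for z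
  proof -
    have "1 - 2 * k2 * z < 0" using that k2_bounds by (simp add: hi_def field_simps)
    then have "sqrt (1 - z) * (1 - 2 * k2 * z) < 0" using that by (simp add: mult_pos_neg)
    moreover have "0 \<le> c * J z" using J_nonneg[of z] that hi c0 by simp
    ultimately show ?thesis unfolding H_def by linarith
  qed
  have "2 * k2 * hi = 1" using k2_bounds by (simp add: hi_def)
  then have Hhi: "H hi \<le> 0" using J_nonneg[of hi] hi c0 by (simp add: H_def)
  have decr: "H b < H a" if ab: "lo \<le> a" "a < b" "b \<le> hi" for a b
  proof (rule DERIV_neg_imp_decreasing[OF ab(2)])
    fix x assume "a \<le> x" "x \<le> b"
    then have x: "lo \<le> x" "x \<le> hi" "0 < x" "x < 1" using ab lo hi by auto
    define s where "s = sqrt (1 - x)"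
    have s: "s > 0" using x by (simp add: s_def)
    have "(6 * x - 5) + 3 * (1 - 2 * x) * (c * T x * s) < 0"
    proof (cases "x \<le> 1/2")
      case True
      \<comment> \<open>From x >= 4/9 the bound of \<open>T_upper\<close> is at most 5/4, so the
        positive term is at most 5/12 against 6 x - 5 <= - 2.\<close>
      have "c * T x * s \<le> (1 - x) / x" using T_upper x by (simp add: s_def)
      also have "\<dots> \<le> 5/4" using x lo by (simp add: field_simps)
      finally have "3 * (1 - 2 * x) * (c * T x * s) \<le> 3 * (1 - 2 * x) * (5/4)" using True by (intro mult_left_mono) auto
      also have "\<dots> \<le> 3 * (1/9) * (5/4)" using x lo by simp
      finally show ?thesis using True by simp
    next
      case False
      have "0 \<le> c * T x * s" using c0 s T_nonneg x by simp
      then have "3 * (1 - 2 * x) * (c * T x * s) \<le> 0" using False by (simp add: mult_nonpos_nonneg)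
      then show ?thesis using x hi by simp
    qed
    then have "k2 / (2 * s) * ((6 * x - 5) + 3 * (1 - 2 * x) * (c * T x * s)) < 0"
      using s k2_bounds by (intro mult_pos_neg divide_pos_pos) auto
    moreover have "k2 / (2 * s) * ((6 * x - 5) + 3 * (1 - 2 * x) * (c * T x * s))
       = k2 / (2 * sqrt (1 - x)) * (6 * x - 5) + 3/2 * c * k2 * (1 - 2 * x) * T x"
      using s unfolding s_def[symmetric] by (simp add: field_simps)
    ultimately show "\<exists>y. (H has_real_derivative y) (at x) \<and> y < 0" using H_deriv[OF x(3,4)] by (intro exI conjI) auto
  qed
  have "\<exists>x\<ge>lo. x \<le> hi \<and> H x = 0"
  proof (rule IVT2'[of H hi 0 lo, OF Hhi Hlo])
    show "lo \<le> hi" using lo hi by simp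
    show "continuous_on {lo..hi} H"
      by (rule DERIV_continuous_on[OF has_field_derivative_at_within[OF H_deriv]]) (use lo hi in auto)
  qed
  then obtain zs where zs: "lo \<le> zs" "zs \<le> hi" "H zs = 0" by blast
  show ?thesis
  proof (rule that[of zs])
    show "0 < H z" if "0 < z" "z < zs" for z
      using below[of z] decr[of z zs] that zs by (cases "z < lo") auto
    show "H z < 0" if "zs < z" "z < 1" for z
      using above[of z] decr[of zs z] that zs by (cases "hi < z") auto
  qed (use zs lo hi in auto)
qed

end

section \<open>Linear second-order equations\<close>

text \<open>Derivatives are taken within closed intervals throughout, one-sided at the ends, while
  signs are known only in the interior; hence this form of the monotonicity criterion.\<close>

lemma within_nondecreasing:
  fixes f :: "real \<Rightarrow> real"
  assumes "a \<le> b" and d: "\<And>x. x \<in> {a..b} \<Longrightarrow> (f has_real_derivative f' x) (at x within {a..b})"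
    and nn: "\<And>x. x \<in> {a<..<b} \<Longrightarrow> 0 \<le> f' x"
  shows "f a \<le> f b"
proof (cases "a = b")
  case False
  then have ab: "a < b" using assms(1) by simp
  have "\<exists>x\<in>{a<..<b}. f b - f a = f' x * (b - a)"
    by (rule mvt_simple[OF ab]) (use d in \<open>auto simp: has_field_derivative_def\<close>)
  then obtain x where x: "x \<in> {a<..<b}" "f b - f a = f' x * (b - a)" by blast
  have "0 \<le> f' x * (b - a)" using nn[OF x(1)] ab by simp
  then show ?thesis using x(2) by simp
qed simp

lemma within_increasing:
  fixes f :: "real \<Rightarrow> real"
  assumes ab: "a < b" and d: "\<And>x. x \<in> {a..b} \<Longrightarrow> (f has_real_derivative f' x) (at x within {a..b})"
    and pos: "\<And>x. x \<in> {a<..<b} \<Longrightarrow> 0 < f' x"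
  shows "f a < f b"
proof -
  have "\<exists>x\<in>{a<..<b}. f b - f a = f' x * (b - a)"
    by (rule mvt_simple[OF ab]) (use d in \<open>auto simp: has_field_derivative_def\<close>)
  then obtain x where x: "x \<in> {a<..<b}" "f b - f a = f' x * (b - a)" by blast
  have "0 < f' x * (b - a)" using pos[OF x(1)] ab by simp
  then show ?thesis using x(2) by simp
qed

text \<open>The equation y'' = q y as a first-order system. Carrying y' as a separate function makes
  initial data and Wronskians plain values, also at the ends of a closed interval.\<close>

definition lin_sol :: "real set \<Rightarrow> (real \<Rightarrow> real) \<Rightarrow> (real \<Rightarrow> real) \<Rightarrow> (real \<Rightarrow> real) \<Rightarrow> bool" where
  "lin_sol S q y y' \<longleftrightarrow> (\<forall>x\<in>S. (y has_real_derivative y' x) (at x within S) \<and> (y' has_real_derivative q x * y x) (at x within S))"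

lemma lin_solD:
  assumes "lin_sol S q y y'" "x \<in> S"
  shows "(y has_real_derivative y' x) (at x within S)" "(y' has_real_derivative q x * y x) (at x within S)"
  using assms by (auto simp: lin_sol_def)

lemma lin_sol_subset: "lin_sol S q y y' \<Longrightarrow> R \<subseteq> S \<Longrightarrow> lin_sol R q y y'"
  unfolding lin_sol_def by (meson DERIV_subset subsetD)

lemma lin_sol_cont: "lin_sol S q y y' \<Longrightarrow> continuous_on S y" "lin_sol S q y y' \<Longrightarrow> continuous_on S y'"
  by (rule DERIV_continuous_on, erule (1) lin_solD)+

lemma lin_sol_comb:
  assumes "lin_sol S q y y'" "lin_sol S q z z'"
  shows "lin_sol S q (\<lambda>x. \<alpha> * y x + \<beta> * z x) (\<lambda>x. \<alpha> * y' x + \<beta> * z' x)"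
  unfolding lin_sol_def
proof (intro ballI conjI)
  fix x assume x: "x \<in> S"
  show "((\<lambda>x. \<alpha> * y x + \<beta> * z x) has_real_derivative \<alpha> * y' x + \<beta> * z' x) (at x within S)"
    by (intro DERIV_add DERIV_cmult lin_solD(1)[OF assms(1) x] lin_solD(1)[OF assms(2) x])
  show "((\<lambda>x. \<alpha> * y' x + \<beta> * z' x) has_real_derivative q x * (\<alpha> * y x + \<beta> * z x)) (at x within S)"
    by (rule DERIV_cong[OF DERIV_add[OF DERIV_cmult[OF lin_solD(2)[OF assms(1) x]] DERIV_cmult[OF lin_solD(2)[OF assms(2) x]]]])
      (simp add: algebra_simps)
qed

text \<open>Sturm's identity. The comparisons below use it with q = V - \<mu> and p = V or p = V -
  \<nu>, where q - p is a constant of known sign; for q = p it gives a conserved quantity.\<close>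

lemma Wronskian_deriv:
  assumes "lin_sol S q y y'" "lin_sol S p z z'" "x \<in> S"
  shows "((\<lambda>x. y' x * z x - y x * z' x) has_real_derivative (q x - p x) * (y x * z x)) (at x within S)"
  by (rule DERIV_cong[OF DERIV_diff[OF DERIV_mult[OF lin_solD(2)[OF assms(1,3)] lin_solD(1)[OF assms(2,3)]]
        DERIV_mult[OF lin_solD(1)[OF assms(1,3)] lin_solD(2)[OF assms(2,3)]]]]) (simp add: algebra_simps)

lemma Wronskian_const:
  assumes "lin_sol S q y y'" "lin_sol S q z z'" "convex S" "x \<in> S" "a \<in> S"
  shows "y' x * z x - y x * z' x = y' a * z a - y a * z' a"
proof -
  obtain c where "\<forall>x\<in>S. y' x * z x - y x * z' x = c"
    using has_field_derivative_zero_constant[OF assms(3), of "\<lambda>x. y' x * z x - y x * z' x"]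
      Wronskian_deriv[OF assms(1,2)] by auto
  then show ?thesis using assms(4,5) by simp
qed

section \<open>Existence, uniqueness and dependence on the spectral parameter\<close>

lemma continuous_interval_bounded:
  fixes f :: "real \<Rightarrow> real"
  assumes "continuous_on {a..b} f"
  obtains B where "\<And>x. x \<in> {a..b} \<Longrightarrow> \<bar>f x\<bar> \<le> B"
proof -
  have "bounded (f ` {a..b})" by (rule compact_imp_bounded[OF compact_continuous_image[OF assms compact_Icc]])
  then obtain B where "\<forall>y\<in>f ` {a..b}. norm y \<le> B" unfolding bounded_iff ..
  then show ?thesis using that[of B] by simp
qed

text \<open>In the weight exp (k (t - a)) integration gains a factor 1 / k, so the Picard iteration
  contracts on the whole interval at once, without subdivision.\<close>

lemma exp_integral_bound:
  fixes f :: "real \<Rightarrow> real"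
  assumes k: "0 < k" and x: "a \<le> x" and f: "continuous_on {a..x} f"
    and b: "\<And>t. t \<in> {a..x} \<Longrightarrow> \<bar>f t\<bar> \<le> k * (C * exp (k * (t - a)))" and C: "0 \<le> C"
  shows "\<bar>integral {a..x} f\<bar> \<le> C * exp (k * (x - a))"
proof -
  have I: "((\<lambda>t. k * (C * exp (k * (t - a)))) has_integral C * exp (k * (x - a)) - C * exp (k * (a - a))) {a..x}"
    by (rule fundamental_theorem_of_calculus[OF x])
      (auto simp: has_real_derivative_iff_has_vector_derivative[symmetric] intro!: derivative_eq_intros)
  have "norm (integral {a..x} f) \<le> integral {a..x} (\<lambda>t. k * (C * exp (k * (t - a))))"
    by (rule integral_norm_bound_integral[OF integrable_continuous_real[OF f] has_integral_integrable[OF I]]) (simp add: b)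
  also have "\<dots> = C * exp (k * (x - a)) - C" using integral_unique[OF I] by simp
  finally show ?thesis using C by simp
qed

text \<open>The solution is the sum of the Picard increments (p n, r n): p 0 is the affine function
  with the initial data, r (n + 1) integrates q p n, and p (n + 1) integrates r (n + 1). The
  weighted bounds decrease like 2^(-n), so the series of derivatives converge uniformly.\<close>

lemma linear_ode_left:
  fixes q :: "real \<Rightarrow> real"
  assumes ab: "a < b" and q: "continuous_on {a..b} q"
  obtains y y' where "lin_sol {a..b} q y y'" "y a = A" "y' a = B"
proof -
  define S where "S = {a..b}"
  obtain Q0 where Q0: "\<And>x. x \<in> S \<Longrightarrow> \<bar>q x\<bar> \<le> Q0"
    using continuous_interval_bounded[OF q] unfolding S_def by blast
  \<comment> \<open>The exponent is chosen so that |q| <= k / 2, which produces the factor 1/2 per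
    step, and k >= 1, which lets p (n + 1) inherit the bound of r (n + 1).\<close>
  define k where "k = 2 * \<bar>Q0\<bar> + 2"
  have k: "k > 0" "2 \<le> k" by (auto simp: k_def)
  have qk: "\<bar>q x\<bar> \<le> k / 2" if "x \<in> S" for x using Q0[OF that] by (simp add: k_def)
  define pr where "pr = rec_nat (\<lambda>x. A + B * (x - a), \<lambda>x. B)
     (\<lambda>_ (p, r). (\<lambda>x. integral {a..x} (\<lambda>t. integral {a..t} (\<lambda>u. q u * p u)), \<lambda>x. integral {a..x} (\<lambda>u. q u * p u)))"
  define p where "p n = fst (pr n)" for n
  define r where "r n = snd (pr n)" for n
  have p0: "p 0 = (\<lambda>x. A + B * (x - a))" and r0: "r 0 = (\<lambda>x. B)" by (auto simp: p_def r_def pr_def)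
  have rS: "r (Suc n) = (\<lambda>x. integral {a..x} (\<lambda>u. q u * p n u))" for n
    by (auto simp: p_def r_def pr_def case_prod_beta)
  have pS: "p (Suc n) = (\<lambda>x. integral {a..x} (r (Suc n)))" for n
    unfolding rS by (auto simp: p_def r_def pr_def case_prod_beta)
  have dint: "((\<lambda>x. integral {a..x} f) has_real_derivative f x) (at x within S)" if "continuous_on S f" "x \<in> S" for f x
    using integral_has_vector_derivative[of a b f x] that by (auto simp: S_def has_real_derivative_iff_has_vector_derivative)
  have cont: "continuous_on S (p n) \<and> continuous_on S (r n)" for n
  proof (induction n)
    case 0
    show ?case unfolding p0 r0 by (intro conjI continuous_intros)
  next
    case (Suc n)
    have c: "continuous_on S (\<lambda>u. q u * p n u)" using Suc q by (auto simp: S_def intro: continuous_intros)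
    have "continuous_on S (r (Suc n))" unfolding rS using dint[OF c] by (rule DERIV_continuous_on)
    moreover from this have "continuous_on S (p (Suc n))" unfolding pS using dint by (intro DERIV_continuous_on)
    ultimately show ?case by simp
  qed
  have cqp: "continuous_on S (\<lambda>u. q u * p n u)" for n using cont q by (auto simp: S_def intro: continuous_intros)
  have dr: "(r (Suc n) has_real_derivative q x * p n x) (at x within S)" if "x \<in> S" for n x
    unfolding rS by (rule dint[OF cqp that])
  have dp: "(p n has_real_derivative r n x) (at x within S)" if "x \<in> S" for n x
  proof (cases n)
    case 0
    show ?thesis unfolding 0 p0 r0 by (auto intro!: derivative_eq_intros)
  next
    case (Suc m)
    show ?thesis unfolding Suc pS using cont[of "Suc m"] that by (intro dint) auto
  qed
  define C where "C = \<bar>A\<bar> + \<bar>B\<bar> * (b - a) + \<bar>B\<bar>"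
  have C: "0 \<le> C" using ab by (simp add: C_def)
  define E where "E x = exp (k * (x - a))" for x
  have E1: "1 \<le> E x" if "x \<in> S" for x using that k by (auto simp: E_def S_def)
  have bound: "x \<in> S \<Longrightarrow> \<bar>p n x\<bar> \<le> C * (1/2) ^ n * E x \<and> \<bar>r n x\<bar> \<le> C * (1/2) ^ n * E x" for n x
  proof (induction n arbitrary: x)
    case 0
    have "\<bar>A + B * (x - a)\<bar> \<le> \<bar>A\<bar> + \<bar>B\<bar> * (x - a)" using 0 by (auto simp: S_def abs_mult intro: order_trans[OF abs_triangle_ineq])
    also have "\<dots> \<le> C" unfolding C_def using 0 by (simp add: S_def mult_left_mono add_increasing2)
    finally have 1: "\<bar>A + B * (x - a)\<bar> \<le> C" .
    have 2: "\<bar>B\<bar> \<le> C" using ab by (simp add: C_def)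
    have "C \<le> C * E x" using mult_left_mono[OF E1[OF 0] C] by simp
    then show ?case unfolding p0 r0 using 1 2 by simp
  next
    case (Suc n)
    have sub: "{a..x} \<subseteq> S" using Suc.prems by (auto simp: S_def)
    have ax: "a \<le> x" using Suc.prems by (simp add: S_def)
    have R: "\<bar>r (Suc n) t\<bar> \<le> C * (1/2) ^ Suc n * E t" if "t \<in> S" for t
      unfolding rS E_def
    proof (rule exp_integral_bound[OF k(1)])
      show "a \<le> t" using that by (simp add: S_def)
      show "continuous_on {a..t} (\<lambda>u. q u * p n u)" by (rule continuous_on_subset[OF cqp]) (use that in \<open>auto simp: S_def\<close>)
      show "0 \<le> C * (1 / 2) ^ Suc n" using C by simp
      fix u assume "u \<in> {a..t}"
      then have u: "u \<in> S" using that by (auto simp: S_def)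
      have "\<bar>q u * p n u\<bar> \<le> (k / 2) * (C * (1/2) ^ n * E u)"
        unfolding abs_mult using qk[OF u] Suc.IH[OF u] k by (intro mult_mono) auto
      then show "\<bar>q u * p n u\<bar> \<le> k * (C * (1 / 2) ^ Suc n * exp (k * (u - a)))" by (simp add: E_def)
    qed
    have "\<bar>p (Suc n) x\<bar> \<le> C * (1/2) ^ Suc n * E x"
      unfolding pS E_def
    proof (rule exp_integral_bound[OF k(1) ax])
      show "continuous_on {a..x} (r (Suc n))" using cont sub continuous_on_subset by blast
      show "0 \<le> C * (1 / 2) ^ Suc n" using C by simp
      fix u assume "u \<in> {a..x}"
      then have u: "u \<in> S" using sub by auto
      have "\<bar>r (Suc n) u\<bar> \<le> 1 * (C * (1/2) ^ Suc n * E u)" using R[OF u] by simp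
      also have "\<dots> \<le> k * (C * (1/2) ^ Suc n * E u)" using k C E1[OF u] by (intro mult_right_mono) auto
      finally show "\<bar>r (Suc n) u\<bar> \<le> k * (C * (1 / 2) ^ Suc n * exp (k * (u - a)))" by (simp add: E_def)
    qed
    then show ?case using R[OF Suc.prems] by simp
  qed
  define D where "D = C * E b"
  have EbS: "E x \<le> E b" if "x \<in> S" for x using that k by (auto simp: E_def S_def)
  have bp: "norm (p n x) \<le> D * (1/2) ^ n" and br: "norm (r n x) \<le> D * (1/2) ^ n" if "x \<in> S" for n x
  proof -
    have "C * (1/2) ^ n * E x \<le> C * (1/2) ^ n * E b" by (rule mult_left_mono[OF EbS[OF that]]) (use C in simp)
    also have "\<dots> = D * (1/2) ^ n" by (simp add: D_def)
    finally have le: "C * (1/2) ^ n * E x \<le> D * (1/2) ^ n" .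
    show "norm (p n x) \<le> D * (1/2) ^ n" "norm (r n x) \<le> D * (1/2) ^ n"
      using order_trans[OF conjunct1[OF bound[OF that]] le] order_trans[OF conjunct2[OF bound[OF that]] le] by (simp_all only: real_norm_def)
  qed
  have sm: "summable (\<lambda>n. D * (1/2) ^ n)" by (intro summable_mult summable_geometric) simp
  \<comment> \<open>r 0 is constant; its derivative is the zero term in front that shifts the series
    for y'' by one index.\<close>
  define f' where "f' n x = (case n of 0 \<Rightarrow> 0 | Suc m \<Rightarrow> q x * p m x)" for n x
  have bf': "norm (f' n x) \<le> k * (D * (1/2) ^ n)" if "x \<in> S" for n x
  proof (cases n)
    case 0
    have "0 \<le> D" using C unfolding D_def E_def by simp
    then show ?thesis using k by (simp add: f'_def 0)
  next
    case (Suc m)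
    have "\<bar>q x * p m x\<bar> \<le> (k / 2) * (D * (1/2) ^ m)"
      unfolding abs_mult using qk[OF that] bp[OF that, of m] k by (intro mult_mono) auto
    then show ?thesis by (simp add: f'_def Suc)
  qed
  have aS: "a \<in> S" using ab by (simp add: S_def)
  have sp: "summable (\<lambda>n. p n x)" and sr: "summable (\<lambda>n. r n x)" if "x \<in> S" for x
    by (rule summable_comparison_test'[OF sm bp[OF that]], rule summable_comparison_test'[OF sm br[OF that]])
  have cS: "convex S" by (simp add: S_def)
  have u1: "uniform_limit S (\<lambda>n x. \<Sum>i<n. r i x) (\<lambda>x. \<Sum>i. r i x) sequentially"
    by (rule Weierstrass_m_test[OF br sm])
  have u2: "uniform_limit S (\<lambda>n x. \<Sum>i<n. f' i x) (\<lambda>x. \<Sum>i. f' i x) sequentially"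
    by (rule Weierstrass_m_test[OF bf' summable_mult[OF sm]])
  have df': "(r n has_real_derivative f' n x) (at x within S)" if "x \<in> S" for n x
    using dr[OF that] by (cases n) (auto simp: f'_def r0)
  obtain y where y: "\<And>x. x \<in> S \<Longrightarrow> (\<lambda>n. p n x) sums y x" "\<And>x. x \<in> S \<Longrightarrow> (y has_real_derivative (\<Sum>i. r i x)) (at x within S)"
    using has_field_derivative_series[OF cS dp u1 aS sp[OF aS]] by blast
  obtain y' where y': "\<And>x. x \<in> S \<Longrightarrow> (\<lambda>n. r n x) sums y' x" "\<And>x. x \<in> S \<Longrightarrow> (y' has_real_derivative (\<Sum>i. f' i x)) (at x within S)"
    using has_field_derivative_series[OF cS df' u2 aS sr[OF aS]] by blast
  have e1: "(\<Sum>i. r i x) = y' x" if "x \<in> S" for x using y'(1)[OF that] sums_unique by metis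
  have e2: "(\<Sum>i. f' i x) = q x * y x" if "x \<in> S" for x
  proof -
    have "(\<lambda>n. f' (Suc n) x) sums (q x * y x)" unfolding f'_def using sums_mult[OF y(1)[OF that], of "q x"] by simp
    then have "(\<lambda>n. f' n x) sums (q x * y x + f' 0 x)" by (rule sums_Suc)
    then have "(\<lambda>n. f' n x) sums (q x * y x)" by (simp add: f'_def)
    then show ?thesis by (rule sums_unique[symmetric])
  qed
  have "lin_sol S q y y'" unfolding lin_sol_def using y(2) y'(2) e1 e2 by simp
  moreover have "y a = A"
  proof -
    have "p n a = (if n = 0 then A else 0)" for n by (cases n) (auto simp: p0 pS)
    then have "(\<lambda>n. p n a) sums A" using sums_If_finite_set[of "{0::nat}" "\<lambda>_. A"] by simp
    then show ?thesis using y(1)[OF aS] sums_unique2 by blast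
  qed
  moreover have "y' a = B"
  proof -
    have "r n a = (if n = 0 then B else 0)" for n by (cases n) (auto simp: r0 rS)
    then have "(\<lambda>n. r n a) sums B" using sums_If_finite_set[of "{0::nat}" "\<lambda>_. B"] by simp
    then show ?thesis using y'(1)[OF aS] sums_unique2 by blast
  qed
  ultimately show ?thesis using that by (auto simp: S_def)
qed

text \<open>Cramer's rule with the fundamental system at a, whose Wronskian is - 1
  everywhere.\<close>

lemma linear_ode:
  fixes q :: "real \<Rightarrow> real"
  assumes ab: "a < b" and q: "continuous_on {a..b} q" and c: "c \<in> {a..b}"
  obtains y y' where "lin_sol {a..b} q y y'" "y c = A" "y' c = B"
proof -
  obtain u u' where u: "lin_sol {a..b} q u u'" "u a = 1" "u' a = 0" using linear_ode_left[OF ab q] by metis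
  obtain v v' where v: "lin_sol {a..b} q v v'" "v a = 0" "v' a = 1" using linear_ode_left[OF ab q] by metis
  have W: "u' c * v c - u c * v' c = - 1"
    using Wronskian_const[OF u(1) v(1) _ c, of a] ab u v by simp
  define \<alpha> \<beta> where "\<alpha> = A * v' c - B * v c" and "\<beta> = B * u c - A * u' c"
  show ?thesis
  proof (rule that[OF lin_sol_comb[OF u(1) v(1), of \<alpha> \<beta>]])
    have "\<alpha> * u c + \<beta> * v c = - A * (u' c * v c - u c * v' c)" "\<alpha> * u' c + \<beta> * v' c = - B * (u' c * v c - u c * v' c)"
      by (simp_all add: \<alpha>_def \<beta>_def algebra_simps)
    then show "\<alpha> * u c + \<beta> * v c = A" "\<alpha> * u' c + \<beta> * v' c = B" unfolding W by auto
  qed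
qed

text \<open>The Wronskian of y with any solution is constant and vanishes at c; solutions with data
  (0, 1) and (1, 0) at x then read off y x and y' x.\<close>

lemma lin_sol_unique:
  assumes ab: "a < b" and q: "continuous_on {a..b} q" and y: "lin_sol {a..b} q y y'"
    and c: "c \<in> {a..b}" "y c = 0" "y' c = 0" and x: "x \<in> {a..b}"
  shows "y x = 0" "y' x = 0"
proof -
  obtain u u' where u: "lin_sol {a..b} q u u'" "u x = 1" "u' x = 0" using linear_ode[OF ab q x] by metis
  obtain v v' where v: "lin_sol {a..b} q v v'" "v x = 0" "v' x = 1" using linear_ode[OF ab q x] by metis
  show "y x = 0" using Wronskian_const[OF y v(1) _ x c(1)] v c by simp
  show "y' x = 0" using Wronskian_const[OF y u(1) _ x c(1)] u c by simp
qed

text \<open>Gronwall's argument for d^2 + d'^2, where d is the difference of the two solutions and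
  obeys the linear equation with forcing (\<nu> - \<mu>) z.\<close>

lemma lin_sol_param_bound:
  fixes V :: "real \<Rightarrow> real"
  assumes L: "0 \<le> L" and y: "lin_sol {0..L} (\<lambda>x. V x - \<mu>) y y'" and z: "lin_sol {0..L} (\<lambda>x. V x - \<nu>) z z'"
    and ic: "y 0 = z 0" "y' 0 = z' 0" and V: "\<And>x. x \<in> {0..L} \<Longrightarrow> \<bar>V x\<bar> \<le> B" and Y: "\<And>x. x \<in> {0..L} \<Longrightarrow> \<bar>z x\<bar> \<le> Y"
    and \<mu>: "\<bar>\<mu> - \<nu>\<bar> \<le> 1"
  shows "(y L - z L)\<^sup>2 + (y' L - z' L)\<^sup>2 \<le> exp ((B + \<bar>\<nu>\<bar> + 3) * L) * ((\<mu> - \<nu>)\<^sup>2 * Y\<^sup>2 * L)"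
proof -
  \<comment> \<open>C - 1 bounds |1 + V - \<mu>| because \<mu> is within 1 of \<nu>; the last unit
    absorbs the d'^2 that arises from splitting the forcing term.\<close>
  define C where "C = B + \<bar>\<nu>\<bar> + 3"
  have B0: "0 \<le> B" using V[of 0] L abs_ge_zero[of "V 0"] by simp
  have C0: "0 \<le> C" using B0 by (simp add: C_def)
  define d where "d x = y x - z x" for x
  define d' where "d' x = y' x - z' x" for x
  define e where "e x = (d x)\<^sup>2 + (d' x)\<^sup>2" for x
  define e' where "e' x = 2 * d x * d' x * (1 + V x - \<mu>) + 2 * d' x * ((\<nu> - \<mu>) * z x)" for x
  have dd: "(d has_real_derivative d' x) (at x within {0..L})" if "x \<in> {0..L}" for x
    unfolding d_def d'_def by (intro DERIV_diff lin_solD(1)[OF y that] lin_solD(1)[OF z that])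
  have dd': "(d' has_real_derivative (V x - \<mu>) * d x + (\<nu> - \<mu>) * z x) (at x within {0..L})" if "x \<in> {0..L}" for x
    unfolding d_def d'_def
    by (rule DERIV_cong[OF DERIV_diff[OF lin_solD(2)[OF y that] lin_solD(2)[OF z that]]]) (simp add: algebra_simps)
  have de: "(e has_real_derivative e' x) (at x within {0..L})" if "x \<in> {0..L}" for x
    unfolding e_def e'_def
    by (rule derivative_eq_intros dd[OF that] dd'[OF that] refl)+ (simp add: algebra_simps)
  have e'le: "e' x \<le> C * e x + (\<mu> - \<nu>)\<^sup>2 * Y\<^sup>2" if x: "x \<in> {0..L}" for x
  proof -
    have 1: "2 * d x * d' x * (1 + V x - \<mu>) \<le> (C - 1) * e x"
    proof -
      have "\<bar>1 + V x - \<mu>\<bar> \<le> C - 1" using V[OF x] \<mu> by (simp add: C_def)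
      moreover have "\<bar>2 * d x * d' x\<bar> \<le> e x" unfolding e_def
        using sum_squares_bound[of "d x" "d' x"] sum_squares_bound[of "d x" "- d' x"] by (simp add: abs_le_iff)
      ultimately have "\<bar>2 * d x * d' x\<bar> * \<bar>1 + V x - \<mu>\<bar> \<le> e x * (C - 1)"
        by (intro mult_mono) (auto simp: e_def)
      then show ?thesis unfolding abs_mult[symmetric] by (simp add: abs_le_iff mult.commute)
    qed
    have "2 * d' x * ((\<nu> - \<mu>) * z x) \<le> (d' x)\<^sup>2 + ((\<nu> - \<mu>) * z x)\<^sup>2" by (rule sum_squares_bound)
    also have "\<dots> \<le> e x + (\<mu> - \<nu>)\<^sup>2 * Y\<^sup>2"
    proof (intro add_mono)
      have "(z x)\<^sup>2 \<le> Y\<^sup>2" using Y[OF x] by (metis abs_ge_zero power2_abs power_mono)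
      then show "((\<nu> - \<mu>) * z x)\<^sup>2 \<le> (\<mu> - \<nu>)\<^sup>2 * Y\<^sup>2"
        unfolding power_mult_distrib by (simp add: power2_commute mult_left_mono)
    qed (simp add: e_def)
    finally show ?thesis unfolding e'_def using 1 by (simp add: algebra_simps)
  qed
  define K where "K = (\<mu> - \<nu>)\<^sup>2 * Y\<^sup>2"
  have K: "0 \<le> K" by (simp add: K_def)
  have "K * 0 - e 0 * exp (- C * 0) \<le> K * L - e L * exp (- C * L)"
  proof (rule within_nondecreasing[OF L])
    fix x assume x: "x \<in> {0..L}"
    show "((\<lambda>x. K * x - e x * exp (- C * x)) has_real_derivative K - (e' x - C * e x) * exp (- C * x)) (at x within {0..L})"
      by (rule derivative_eq_intros de[OF x] refl)+ (simp add: algebra_simps)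
  next
    fix x assume "x \<in> {0<..<L}"
    then have x: "x \<in> {0..L}" "0 \<le> x" by auto
    have "(e' x - C * e x) * exp (- C * x) \<le> K * exp (- C * x)"
      using e'le[OF x(1)] by (intro mult_right_mono) (auto simp: K_def)
    also have "\<dots> \<le> K * 1" using C0 x K by (intro mult_left_mono) auto
    finally show "0 \<le> K - (e' x - C * e x) * exp (- C * x)" by simp
  qed
  then have "e L * exp (- C * L) \<le> K * L" using ic by (simp add: e_def d_def d'_def)
  then have "exp (C * L) * (e L * exp (- C * L)) \<le> exp (C * L) * (K * L)" by (intro mult_left_mono) auto
  moreover have "exp (C * L) * (e L * exp (- C * L)) = e L"
  proof -
    have "exp (C * L) * exp (- C * L) = 1" by (simp add: exp_add[symmetric])
    then show ?thesis by (metis mult.left_commute mult.right_neutral)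
  qed
  ultimately have "e L \<le> exp (C * L) * (K * L)" by (simp only:)
  then show ?thesis unfolding e_def d_def d'_def C_def K_def .
qed

lemma lin_sol_param_continuous:
  fixes V :: "real \<Rightarrow> real"
  assumes L: "0 \<le> L" and V: "continuous_on {0..L} V"
    and y: "\<And>\<mu>. lin_sol {0..L} (\<lambda>x. V x - \<mu>) (y \<mu>) (y' \<mu>)" and ic: "\<And>\<mu>. y \<mu> 0 = A" "\<And>\<mu>. y' \<mu> 0 = B"
  shows "continuous_on UNIV (\<lambda>\<mu>. y \<mu> L)" "continuous_on UNIV (\<lambda>\<mu>. y' \<mu> L)"
proof -
  obtain B1 where B1: "\<And>x. x \<in> {0..L} \<Longrightarrow> \<bar>V x\<bar> \<le> B1"
    using continuous_interval_bounded[OF V] by blast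
  have "isCont (\<lambda>\<mu>. y \<mu> L) \<nu> \<and> isCont (\<lambda>\<mu>. y' \<mu> L) \<nu>" for \<nu>
  proof -
    obtain Y where Y: "\<And>x. x \<in> {0..L} \<Longrightarrow> \<bar>y \<nu> x\<bar> \<le> Y"
      using continuous_interval_bounded[OF lin_sol_cont(1)[OF y[of \<nu>]]] by blast
    define M where "M = exp ((B1 + \<bar>\<nu>\<bar> + 3) * L) * (Y\<^sup>2 * L)"
    have M0: "0 \<le> M" using L by (simp add: M_def)
    have b: "(y \<mu> L - y \<nu> L)\<^sup>2 + (y' \<mu> L - y' \<nu> L)\<^sup>2 \<le> M * (\<mu> - \<nu>)\<^sup>2" if "\<bar>\<mu> - \<nu>\<bar> \<le> 1" for \<mu>
    proof -
      have "y \<mu> 0 = y \<nu> 0" "y' \<mu> 0 = y' \<nu> 0" by (simp_all only: ic)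
      from lin_sol_param_bound[OF L y[of \<mu>] y[of \<nu>] this B1 Y that]
      show ?thesis unfolding M_def by (simp only: mult_ac)
    qed
    have b1: "\<bar>y \<mu> L - y \<nu> L\<bar> \<le> sqrt M * \<bar>\<mu> - \<nu>\<bar>" and b2: "\<bar>y' \<mu> L - y' \<nu> L\<bar> \<le> sqrt M * \<bar>\<mu> - \<nu>\<bar>" if "\<bar>\<mu> - \<nu>\<bar> \<le> 1" for \<mu>
    proof -
      have "(y \<mu> L - y \<nu> L)\<^sup>2 \<le> (sqrt M * \<bar>\<mu> - \<nu>\<bar>)\<^sup>2" "(y' \<mu> L - y' \<nu> L)\<^sup>2 \<le> (sqrt M * \<bar>\<mu> - \<nu>\<bar>)\<^sup>2"
        using b[OF that] zero_le_power2[of "y \<mu> L - y \<nu> L"] zero_le_power2[of "y' \<mu> L - y' \<nu> L"] M0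
        unfolding power_mult_distrib real_sqrt_pow2[OF M0] power2_abs by linarith+
      then have "\<bar>y \<mu> L - y \<nu> L\<bar> \<le> \<bar>sqrt M * \<bar>\<mu> - \<nu>\<bar>\<bar>" "\<bar>y' \<mu> L - y' \<nu> L\<bar> \<le> \<bar>sqrt M * \<bar>\<mu> - \<nu>\<bar>\<bar>"
        by (simp_all only: abs_le_square_iff)
      moreover have "\<bar>sqrt M * \<bar>\<mu> - \<nu>\<bar>\<bar> = sqrt M * \<bar>\<mu> - \<nu>\<bar>" using M0 by (simp add: abs_mult)
      ultimately show "\<bar>y \<mu> L - y \<nu> L\<bar> \<le> sqrt M * \<bar>\<mu> - \<nu>\<bar>" "\<bar>y' \<mu> L - y' \<nu> L\<bar> \<le> sqrt M * \<bar>\<mu> - \<nu>\<bar>"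
        by simp_all
    qed
    have ev: "\<forall>\<^sub>F \<mu> in at \<nu>. \<bar>\<mu> - \<nu>\<bar> \<le> 1"
      unfolding eventually_at by (rule exI[of _ 1]) (auto simp: dist_real_def)
    have lim: "((\<lambda>\<mu>. sqrt M * \<bar>\<mu> - \<nu>\<bar>) \<longlongrightarrow> 0) (at \<nu>)" by (auto intro!: tendsto_eq_intros)
    have 1: "((\<lambda>\<mu>. y \<mu> L - y \<nu> L) \<longlongrightarrow> 0) (at \<nu>)"
      by (rule Lim_null_comparison[OF eventually_mono[OF ev] lim]) (simp add: b1)
    have 2: "((\<lambda>\<mu>. y' \<mu> L - y' \<nu> L) \<longlongrightarrow> 0) (at \<nu>)"
      by (rule Lim_null_comparison[OF eventually_mono[OF ev] lim]) (simp add: b2)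
    show ?thesis unfolding isCont_def by (rule conjI[OF LIM_zero_cancel[OF 1] LIM_zero_cancel[OF 2]])
  qed
  then show "continuous_on UNIV (\<lambda>\<mu>. y \<mu> L)" "continuous_on UNIV (\<lambda>\<mu>. y' \<mu> L)"
    by (auto simp: continuous_on_eq_continuous_at)
qed

text \<open>Positivity is assumed only just to the right of a, since y may vanish at a itself; the
  least zero is therefore sought beyond a point c where y is already positive.\<close>

lemma first_zero:
  fixes y :: "real \<Rightarrow> real"
  assumes y: "continuous_on {a..b} y" and \<delta>: "0 < \<delta>" "\<And>t. a < t \<Longrightarrow> t < a + \<delta> \<Longrightarrow> t \<le> b \<Longrightarrow> 0 < y t"
    and x: "a < x" "x \<le> b" "y x \<le> 0"
  obtains z where "a < z" "z \<le> x" "y z = 0" "\<And>t. a < t \<Longrightarrow> t < z \<Longrightarrow> 0 < y t"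
proof -
  define c where "c = min (a + \<delta> / 2) x"
  have c: "a < c" "c \<le> x" "c < a + \<delta>" using \<delta>(1) x by (auto simp: c_def)
  have yc: "0 < y c" using \<delta>(2) c x by simp
  define Z where "Z = {t \<in> {c..x}. y t \<le> 0}"
  have cy: "continuous_on {c..x} y" by (rule continuous_on_subset[OF y]) (use c x in auto)
  have "Z = {c..x} \<inter> y -` {..0}" by (auto simp: Z_def)
  then have "closed Z" using continuous_closed_preimage[OF cy closed_atLeastAtMost closed_atMost[of 0]] by simp
  moreover have "Z = {c..x} \<inter> Z" by (auto simp: Z_def)
  ultimately have cZ: "compact Z" using compact_Int_closed[OF compact_Icc, of Z c x] by (simp only:)
  have nZ: "Z \<noteq> {}" using x c by (auto simp: Z_def)
  obtain z where z: "z \<in> Z" "\<And>t. t \<in> Z \<Longrightarrow> z \<le> t" using compact_attains_inf[OF cZ nZ] by blast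
  have zc: "c \<le> z" "z \<le> x" "y z \<le> 0" using z(1) by (auto simp: Z_def)
  have before: "0 < y t" if "a < t" "t < z" for t
  proof (cases "t < c")
    case True
    then show ?thesis using \<delta>(2)[of t] that c x by simp
  next
    case False
    then have "t \<notin> Z" "t \<in> {c..x}" using z(2)[of t] that zc by auto
    then show ?thesis by (simp add: Z_def)
  qed
  have "y z = 0"
  proof (rule ccontr)
    assume "y z \<noteq> 0"
    then have "y z < 0" using zc by simp
    have "\<exists>t\<ge>c. t \<le> z \<and> y t = y z / 2"
    proof (rule IVT2')
      show "continuous_on {c..z} y" by (rule continuous_on_subset[OF cy]) (use zc in auto)
    qed (use \<open>y z < 0\<close> yc zc in auto)
    then obtain t where t: "c \<le> t" "t \<le> z" "y t = y z / 2" by blast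
    then have "t \<in> Z" using \<open>y z < 0\<close> zc by (simp add: Z_def)
    then have "t = z" using z(2) t by fastforce
    then show False using t \<open>y z < 0\<close> by simp
  qed
  then show ?thesis using that[of z] zc c before by simp
qed

lemma deriv_nonpos_at_zero:
  assumes d: "(y has_real_derivative D) (at z within {a..b})" and z: "a < z" "z \<le> b" "y z = 0"
    and pos: "\<And>t. a < t \<Longrightarrow> t < z \<Longrightarrow> 0 < y t"
  shows "D \<le> 0"
proof (rule ccontr)
  assume "\<not> D \<le> 0"
  then obtain e where e: "e > 0" "\<And>h. 0 < h \<Longrightarrow> z - h \<in> {a..b} \<Longrightarrow> h < e \<Longrightarrow> y (z - h) < y z"
    using has_real_derivative_pos_inc_left[OF d] by auto
  define h where "h = min (e / 2) ((z - a) / 2)"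
  have h: "0 < h" "h < e" "a < z - h" "z - h < z" using e(1) z by (auto simp: h_def min_def field_simps)
  then show False using e(2)[of h] pos[of "z - h"] z by auto
qed

lemma deriv_pos_right:
  assumes d: "(y has_real_derivative D) (at a within {l..b})" and a: "y a = 0" "0 < D" "l \<le> a"
  obtains \<delta> where "0 < \<delta>" "\<And>t. a < t \<Longrightarrow> t < a + \<delta> \<Longrightarrow> t \<le> b \<Longrightarrow> 0 < y t"
proof -
  obtain e where e: "e > 0" "\<And>h. 0 < h \<Longrightarrow> a + h \<in> {l..b} \<Longrightarrow> h < e \<Longrightarrow> y a < y (a + h)"
    using has_real_derivative_pos_inc_right[OF d a(2)] by auto
  show ?thesis
  proof (rule that[OF e(1)])
    fix t assume "a < t" "t < a + e" "t \<le> b"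
    then show "0 < y t" using e(2)[of "t - a"] a by auto
  qed
qed

section \<open>Sturm comparison on a loop\<close>

text \<open>The zero-energy solution v vanishes at 0 and is positive afterwards; later it is minus
  the slope of the profile. It serves as comparison function for every \<mu> \<le> 0, while s \<mu>
  is the solution that is even about the midpoint of the loop.\<close>

locale loop_problem =
  fixes L :: real and V v v' :: "real \<Rightarrow> real" and s s' :: "real \<Rightarrow> real \<Rightarrow> real"
  assumes L: "0 < L" and V: "continuous_on {0..L} V"
    and v: "lin_sol {0..L} V v v'" "v 0 = 0" "\<And>x. 0 < x \<Longrightarrow> x \<le> L \<Longrightarrow> 0 < v x"
    and s: "\<And>\<mu>. lin_sol {0..L} (\<lambda>x. V x - \<mu>) (s \<mu>) (s' \<mu>)" "\<And>\<mu>. s \<mu> 0 = 1" "\<And>\<mu>. s' \<mu> 0 = 0"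
begin

text \<open>If y returned to zero at z, the Wronskian with v would be nondecreasing on [x1, z] and
  nonnegative at x1, yet equal to y'(z) v(z) <= 0 at z; so y'(z) = 0 and y would be trivial. The
  case x1 = 0, where v vanishes too, is included and serves the odd solution.\<close>

lemma positive_after_zero:
  assumes \<mu>: "\<mu> \<le> 0" and y: "lin_sol {0..L} (\<lambda>x. V x - \<mu>) y y'"
    and x1: "0 \<le> x1" "y x1 = 0" "0 < y' x1" and x: "x1 < x" "x \<le> L"
  shows "0 < y x"
proof (rule ccontr)
  assume "\<not> 0 < y x"
  then have yx: "y x \<le> 0" by simp
  have x1L: "x1 \<in> {0..L}" using x x1 by simp
  obtain \<delta> where \<delta>: "0 < \<delta>" "\<And>t. x1 < t \<Longrightarrow> t < x1 + \<delta> \<Longrightarrow> t \<le> L \<Longrightarrow> 0 < y t"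
    using deriv_pos_right[OF lin_solD(1)[OF y x1L] x1(2,3,1)] by blast
  have cy: "continuous_on {x1..L} y" by (rule continuous_on_subset[OF lin_sol_cont(1)[OF y]]) (use x1 in auto)
  obtain z where z: "x1 < z" "z \<le> x" "y z = 0" "\<And>t. x1 < t \<Longrightarrow> t < z \<Longrightarrow> 0 < y t"
    using first_zero[OF cy \<delta> x yx] by blast
  have zL: "z \<in> {0..L}" using z x x1 by simp
  have sub: "{x1..z} \<subseteq> {0..L}" using x1 zL by auto
  note y1 = lin_sol_subset[OF y sub] and v1 = lin_sol_subset[OF v(1) sub]
  have "y' z \<le> 0"
    by (rule deriv_nonpos_at_zero[OF lin_solD(1)[OF y1]]) (use z in auto)
  have "y' x1 * v x1 - y x1 * v' x1 \<le> y' z * v z - y z * v' z"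
  proof (rule within_nondecreasing[OF less_imp_le[OF z(1)] Wronskian_deriv[OF y1 v1]], assumption)
    fix t assume t: "t \<in> {x1<..<z}"
    have "0 < y t" "0 < v t" using z(4)[of t] v(3)[of t] t x1(1) zL by auto
    then show "0 \<le> (V t - \<mu> - V t) * (y t * v t)" using \<mu> by (intro mult_nonneg_nonneg) auto
  qed
  moreover have "0 \<le> v x1" using v(2) v(3)[of x1] x1L x1(1) by (cases "x1 = 0") auto
  ultimately have "0 \<le> y' z * v z" using x1(2,3) z(3) by (simp add: order_trans[rotated])
  moreover have "0 < v z" using v(3) z x1 zL by auto
  ultimately have "y' z = 0" using \<open>y' z \<le> 0\<close> by (simp add: zero_le_mult_iff)
  have "y' x1 = 0"
    by (rule lin_sol_unique(2)[OF L _ y zL z(3) \<open>y' z = 0\<close> x1L]) (intro continuous_intros V)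
  then show False using x1 by simp
qed

text \<open>\<open>positive_after_zero\<close> applied to - s \<mu> leaves room for only one zero;
  uniqueness of solutions makes the crossing transversal.\<close>

lemma even_first_zero:
  assumes \<mu>: "\<mu> \<le> 0" and x: "0 < x" "x \<le> L" "s \<mu> x \<le> 0"
  obtains z where "0 < z" "z \<le> x" "s \<mu> z = 0" "\<And>t. 0 \<le> t \<Longrightarrow> t < z \<Longrightarrow> 0 < s \<mu> t" "s' \<mu> z < 0"
    "\<And>t. z < t \<Longrightarrow> t \<le> L \<Longrightarrow> s \<mu> t < 0"
proof -
  have cs: "continuous_on {0..L} (s \<mu>)" by (rule lin_sol_cont(1)[OF s(1)])
  have "\<exists>\<delta>>0. \<forall>t\<in>{0..L}. dist t 0 < \<delta> \<longrightarrow> dist (s \<mu> t) (s \<mu> 0) < 1"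
    using cs[unfolded continuous_on_iff, rule_format, of 0 1] L by auto
  then obtain \<delta> where \<delta>: "0 < \<delta>" "\<And>t. t \<in> {0..L} \<Longrightarrow> dist t 0 < \<delta> \<Longrightarrow> dist (s \<mu> t) (s \<mu> 0) < 1" by blast
  have \<delta>': "0 < s \<mu> t" if "0 < t" "t < 0 + \<delta>" "t \<le> L" for t
    using \<delta>(2)[of t] that s(2)[of \<mu>] by (auto simp: dist_real_def abs_less_iff)
  obtain z where z: "0 < z" "z \<le> x" "s \<mu> z = 0" "\<And>t. 0 < t \<Longrightarrow> t < z \<Longrightarrow> 0 < s \<mu> t"
    using first_zero[OF cs \<delta>(1) \<delta>' x] by blast
  have zL: "z \<in> {0..L}" using z x by simp
  have "s' \<mu> z \<le> 0" by (rule deriv_nonpos_at_zero[OF lin_solD(1)[OF s(1) zL]]) (use z zL in auto)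
  moreover have "s' \<mu> z \<noteq> 0"
  proof
    assume "s' \<mu> z = 0"
    then have "s \<mu> 0 = 0"
      by (intro lin_sol_unique(1)[OF L _ s(1) zL z(3)]) (use L in \<open>auto intro!: continuous_intros V\<close>)
    then show False using s(2) by simp
  qed
  ultimately have s'z: "s' \<mu> z < 0" by simp
  have neg: "lin_sol {0..L} (\<lambda>x. V x - \<mu>) (\<lambda>x. (- 1) * s \<mu> x + 0 * s \<mu> x) (\<lambda>x. (- 1) * s' \<mu> x + 0 * s' \<mu> x)"
    by (rule lin_sol_comb[OF s(1) s(1)])
  show ?thesis
  proof (rule that[of z])
    show "0 < s \<mu> t" if "0 \<le> t" "t < z" for t using z(4)[of t] that s(2)[of \<mu>] by (cases "t = 0") auto
    show "s \<mu> t < 0" if "z < t" "t \<le> L" for t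
      using positive_after_zero[OF \<mu> neg, of z t] z s'z that by simp
  qed (use z s'z in auto)
qed

lemma even_positive_before:
  assumes \<mu>: "\<mu> \<le> 0" and x: "x \<le> L" "0 \<le> s \<mu> x" and t: "0 \<le> t" "t < x"
  shows "0 < s \<mu> t"
proof (rule ccontr)
  assume "\<not> 0 < s \<mu> t"
  then have st: "s \<mu> t \<le> 0" by simp
  have "t \<noteq> 0"
  proof
    assume "t = 0"
    then show False using st s(2)[of \<mu>] by simp
  qed
  then have t0: "0 < t" using t by simp
  have tL: "t \<le> L" using t x by simp
  obtain z where z: "0 < z" "z \<le> t" "s \<mu> z = 0" "\<And>t. 0 \<le> t \<Longrightarrow> t < z \<Longrightarrow> 0 < s \<mu> t" "s' \<mu> z < 0" "\<And>t. z < t \<Longrightarrow> t \<le> L \<Longrightarrow> s \<mu> t < 0"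
    using even_first_zero[OF \<mu> t0 tL st] by blast
  have "s \<mu> x < 0" by (rule z(6)) (use z(2) x t in auto)
  then show False using x by simp
qed

text \<open>Zeros of the even solution move to the right as the energy decreases: with s \<nu>
  positive up to the first zero of s \<mu>, the Wronskian would increase from 0, contradicting its
  sign at that zero.\<close>

lemma even_comparison:
  assumes \<mu>\<nu>: "\<mu> < \<nu>" "\<nu> \<le> 0" and x: "0 < x" "x \<le> L" "0 \<le> s \<nu> x" and t: "0 \<le> t" "t \<le> x"
  shows "0 < s \<mu> t"
proof (rule ccontr)
  assume n: "\<not> 0 < s \<mu> t"
  have t0: "0 < t" using n t s(2)[of \<mu>] by (cases "t = 0") auto
  have \<mu>0: "\<mu> \<le> 0" using \<mu>\<nu> by simp
  obtain z where z: "0 < z" "z \<le> t" "s \<mu> z = 0" "\<And>t. 0 \<le> t \<Longrightarrow> t < z \<Longrightarrow> 0 < s \<mu> t" "s' \<mu> z < 0" "\<And>t. z < t \<Longrightarrow> t \<le> L \<Longrightarrow> s \<mu> t < 0"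
    using even_first_zero[OF \<mu>0 t0 order_trans[OF t(2) x(2)] leI[OF n]] by blast
  have pos: "0 < s \<nu> r" if "0 \<le> r" "r < z" for r
    by (rule even_positive_before[OF \<mu>\<nu>(2) x(2,3) that(1)]) (use that z t in auto)
  have sub: "{0..z} \<subseteq> {0..L}" using z t x by auto
  have "s' \<mu> 0 * s \<nu> 0 - s \<mu> 0 * s' \<nu> 0 < s' \<mu> z * s \<nu> z - s \<mu> z * s' \<nu> z"
  proof (rule within_increasing[OF z(1) Wronskian_deriv[OF lin_sol_subset[OF s(1) sub] lin_sol_subset[OF s(1) sub]]], assumption)
    fix r assume "r \<in> {0<..<z}"
    then have "0 < s \<mu> r" "0 < s \<nu> r" using z(4)[of r] pos[of r] by auto
    then show "0 < (V r - \<mu> - (V r - \<nu>)) * (s \<mu> r * s \<nu> r)" using \<mu>\<nu> by (intro mult_pos_pos) auto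
  qed
  then have "0 < s' \<mu> z * s \<nu> z" using s z by simp
  moreover have "0 \<le> s \<nu> z"
  proof (cases "z = x")
    case False
    then show ?thesis using even_positive_before[OF \<mu>\<nu>(2) x(2,3), of z] z t by simp
  qed (use x in simp)
  ultimately show False using z(5) by (simp add: zero_less_mult_iff)
qed

text \<open>This expresses that the logarithmic derivative at L decreases with the energy. If s
  \<nu> is nonnegative at L, neither solution has a zero before L and the Wronskian grows from 0; if
  s \<mu> has changed sign, the comparison starts at its zero, where the Wronskian is already
  positive and beyond which both solutions are negative.\<close>

lemma Wronskian_end_pos:
  assumes \<mu>\<nu>: "\<mu> < \<nu>" "\<nu> \<le> 0" and "0 \<le> s \<nu> L \<or> s \<mu> L < 0"
  shows "0 < s' \<mu> L * s \<nu> L - s \<mu> L * s' \<nu> L"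
proof (cases "0 \<le> s \<nu> L")
  case True
  have "s' \<mu> 0 * s \<nu> 0 - s \<mu> 0 * s' \<nu> 0 < s' \<mu> L * s \<nu> L - s \<mu> L * s' \<nu> L"
  proof (rule within_increasing[OF L Wronskian_deriv[OF s(1) s(1)]], assumption)
    fix r assume "r \<in> {0<..<L}"
    then have "0 < s \<mu> r" "0 < s \<nu> r"
      using even_positive_before[OF \<mu>\<nu>(2) order_refl True, of r] even_comparison[OF \<mu>\<nu> L order_refl True, of r] by auto
    then show "0 < (V r - \<mu> - (V r - \<nu>)) * (s \<mu> r * s \<nu> r)" using \<mu>\<nu> by (intro mult_pos_pos) auto
  qed
  then show ?thesis using s by simp
next
  case False
  then have neg: "s \<mu> L < 0" using assms by simp
  have \<mu>0: "\<mu> \<le> 0" using \<mu>\<nu> by simp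
  obtain z where z: "0 < z" "z \<le> L" "s \<mu> z = 0" "\<And>t. 0 \<le> t \<Longrightarrow> t < z \<Longrightarrow> 0 < s \<mu> t" "s' \<mu> z < 0" "\<And>t. z < t \<Longrightarrow> t \<le> L \<Longrightarrow> s \<mu> t < 0"
    using even_first_zero[OF \<mu>0 L order_refl less_imp_le[OF neg]] by blast
  have zL: "z < L" using z neg by (cases "z = L") auto
  have \<nu>z: "s \<nu> z < 0"
  proof (rule ccontr)
    assume "\<not> s \<nu> z < 0"
    then have "0 < s \<mu> z" using even_comparison[OF \<mu>\<nu> z(1,2), of z] z by simp
    then show False using z by simp
  qed
  obtain w where w: "0 < w" "w \<le> z" "s \<nu> w = 0" "\<And>t. 0 \<le> t \<Longrightarrow> t < w \<Longrightarrow> 0 < s \<nu> t" "s' \<nu> w < 0" "\<And>t. w < t \<Longrightarrow> t \<le> L \<Longrightarrow> s \<nu> t < 0"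
    using even_first_zero[OF \<mu>\<nu>(2) z(1,2) less_imp_le[OF \<nu>z]] by blast
  have sub: "{z..L} \<subseteq> {0..L}" using z by auto
  have "s' \<mu> z * s \<nu> z - s \<mu> z * s' \<nu> z < s' \<mu> L * s \<nu> L - s \<mu> L * s' \<nu> L"
  proof (rule within_increasing[OF zL Wronskian_deriv[OF lin_sol_subset[OF s(1) sub] lin_sol_subset[OF s(1) sub]]], assumption)
    fix r assume "r \<in> {z<..<L}"
    then have "s \<mu> r < 0" "s \<nu> r < 0" using z(6)[of r] w(6)[of r] w(2) by auto
    then show "0 < (V r - \<mu> - (V r - \<nu>)) * (s \<mu> r * s \<nu> r)" using \<mu>\<nu> by (intro mult_pos_pos mult_neg_neg) auto
  qed
  moreover have "0 < s' \<mu> z * s \<nu> z" using z \<nu>z by (simp add: mult_neg_neg)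
  ultimately show ?thesis using z by simp
qed

text \<open>As long as s is positive, s'' = (V - \<mu>) s >= 0, so s' stays nonnegative and s cannot
  come down to zero.\<close>

lemma even_convex:
  assumes \<mu>: "\<mu> \<le> 0" and q: "\<And>x. x \<in> {0..L} \<Longrightarrow> \<mu> \<le> V x"
  shows "1 \<le> s \<mu> L" "0 \<le> s' \<mu> L"
proof -
  have *: "1 \<le> s \<mu> x \<and> 0 \<le> s' \<mu> x" if x: "0 \<le> x" "x \<le> L" and pos: "\<And>t. 0 < t \<Longrightarrow> t < x \<Longrightarrow> 0 < s \<mu> t" for x
  proof -
    have s'n: "0 \<le> s' \<mu> r" if r: "0 \<le> r" "r \<le> x" for r
    proof -
      have sub: "{0..r} \<subseteq> {0..L}" using r x by auto
      have "s' \<mu> 0 \<le> s' \<mu> r"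
      proof (rule within_nondecreasing[OF r(1) lin_solD(2)[OF lin_sol_subset[OF s(1) sub]]], assumption)
        fix t assume t: "t \<in> {0<..<r}"
        have "\<mu> \<le> V t" "0 < s \<mu> t" using q[of t] pos[of t] t r x by auto
        then show "0 \<le> (V t - \<mu>) * s \<mu> t" by (intro mult_nonneg_nonneg) auto
      qed
      then show ?thesis using s by simp
    qed
    have sub: "{0..x} \<subseteq> {0..L}" using x by auto
    have "s \<mu> 0 \<le> s \<mu> x"
      by (rule within_nondecreasing[OF x(1) lin_solD(1)[OF lin_sol_subset[OF s(1) sub]]]) (use s'n in auto)
    then show ?thesis using s s'n[of x] x by simp
  qed
  have "0 < s \<mu> t" if t: "0 < t" "t < L" for t
  proof (rule ccontr)
    assume "\<not> 0 < s \<mu> t"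
    then have n: "s \<mu> t \<le> 0" by simp
    obtain z where z: "0 < z" "z \<le> t" "s \<mu> z = 0" "\<And>t. 0 \<le> t \<Longrightarrow> t < z \<Longrightarrow> 0 < s \<mu> t" "s' \<mu> z < 0" "\<And>t. z < t \<Longrightarrow> t \<le> L \<Longrightarrow> s \<mu> t < 0"
      using even_first_zero[OF \<mu> t(1) less_imp_le[OF t(2)] n] by blast
    then show False using *[of z] t by auto
  qed
  then show "1 \<le> s \<mu> L" "0 \<le> s' \<mu> L" using *[of L] L by auto
qed

lemma even_nondegenerate:
  assumes "s \<mu> L = 0"
  shows "s' \<mu> L \<noteq> 0"
proof
  assume "s' \<mu> L = 0"
  then have "s \<mu> 0 = 0"
    by (intro lin_sol_unique(1)[OF L _ s(1) _ assms]) (use L in \<open>auto intro!: continuous_intros V\<close>)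
  then show False using s(2) by simp
qed

lemma end_continuous: "continuous_on UNIV (\<lambda>\<mu>. s \<mu> L)" "continuous_on UNIV (\<lambda>\<mu>. s' \<mu> L)"
  by (rule lin_sol_param_continuous[OF less_imp_le[OF L] V s])+

lemma bounded_below_potential: "\<exists>m0\<le>0. \<forall>\<mu>\<le>m0. 1 \<le> s \<mu> L \<and> 0 \<le> s' \<mu> L"
proof -
  obtain B where B: "\<And>x. x \<in> {0..L} \<Longrightarrow> \<bar>V x\<bar> \<le> B" using continuous_interval_bounded[OF V] by blast
  have "\<forall>\<mu>\<le>- \<bar>B\<bar>. 1 \<le> s \<mu> L \<and> 0 \<le> s' \<mu> L"
  proof (intro allI impI conjI)
    fix \<mu> assume m: "\<mu> \<le> - \<bar>B\<bar>"
    have "\<mu> \<le> 0" using m by simp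
    moreover have "\<mu> \<le> V x" if "x \<in> {0..L}" for x using B[OF that] m by linarith
    ultimately show "1 \<le> s \<mu> L" "0 \<le> s' \<mu> L" using even_convex by auto
  qed
  then show ?thesis by (intro exI[of _ "- \<bar>B\<bar>"]) simp
qed

text \<open>By \<open>even_comparison\<close>, a zero at L for the higher energy keeps the solution
  at the lower energy positive up to L.\<close>

lemma Dirichlet_unique:
  assumes "\<mu> \<le> 0" "s \<mu> L = 0" "\<nu> \<le> 0" "s \<nu> L = 0"
  shows "\<mu> = \<nu>"
proof (rule ccontr)
  have *: False if "\<mu> < \<nu>" "\<nu> \<le> 0" "s \<mu> L = 0" "s \<nu> L = 0" for \<mu> \<nu>
    using even_comparison[OF that(1,2) L order_refl _ _ order_refl] that(3,4) L by auto
  assume "\<mu> \<noteq> \<nu>"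
  then show False using *[of \<mu> \<nu>] *[of \<nu> \<mu>] assms by linarith
qed

lemma Dirichlet_none:
  assumes "0 \<le> s 0 L" "\<mu> < 0"
  shows "0 < s \<mu> L"
  using even_comparison[OF assms(2) order_refl L order_refl assms(1) _ order_refl] L by simp

lemma Dirichlet_exists:
  assumes "s 0 L < 0"
  obtains \<mu> where "\<mu> < 0" "s \<mu> L = 0"
proof -
  obtain m0 where m0: "m0 \<le> 0" "\<And>\<mu>. \<mu> \<le> m0 \<Longrightarrow> 1 \<le> s \<mu> L" using bounded_below_potential by blast
  have "\<exists>\<mu>\<ge>m0. \<mu> \<le> 0 \<and> s \<mu> L = 0"
    by (rule IVT2'[of "\<lambda>\<mu>. s \<mu> L"]) (use m0(2)[of m0] m0(1) assms continuous_on_subset[OF end_continuous(1)] in auto)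
  then obtain \<mu> where "\<mu> \<le> 0" "s \<mu> L = 0" by blast
  then show ?thesis using that[of \<mu>] assms by (cases "\<mu> = 0") auto
qed

text \<open>The zeros of \<open>M * s' \<mu> L - s \<mu> L * g \<mu>\<close> are the eigenvalues of the sector in which all loops carry
  the same even function; \<open>g\<close> is the logarithmic derivative at the vertex of the decaying solution.\<close>

lemma matching_unique:
  fixes M :: real and g :: "real \<Rightarrow> real"
  assumes M: "0 < M" and gc: "continuous_on {..0} g" and gm: "\<And>\<mu> \<nu>. \<mu> < \<nu> \<Longrightarrow> \<nu> \<le> 0 \<Longrightarrow> g \<mu> < g \<nu>"
    and gn: "\<And>\<mu>. \<mu> \<le> m1 \<Longrightarrow> g \<mu> < 0" and D0: "M * s' 0 L - s 0 L * g 0 < 0"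
  obtains \<mu>D where "\<mu>D < 0" "0 < s \<mu>D L" "M * s' \<mu>D L - s \<mu>D L * g \<mu>D = 0"
    "\<And>\<mu>. \<mu> \<le> 0 \<Longrightarrow> M * s' \<mu> L - s \<mu> L * g \<mu> = 0 \<Longrightarrow> \<mu> = \<mu>D"
proof -
  define D where "D \<mu> = M * s' \<mu> L - s \<mu> L * g \<mu>" for \<mu>
  obtain m0 where m0: "m0 \<le> 0" "\<And>\<mu>. \<mu> \<le> m0 \<Longrightarrow> 1 \<le> s \<mu> L \<and> 0 \<le> s' \<mu> L" using bounded_below_potential by blast
  define m where "m = min m0 m1"
  have "0 \<le> M * s' m L" "s m L * g m < 0" using m0(2)[of m] gn[of m] M by (auto simp: m_def mult_pos_neg)
  then have Dm: "0 < D m" by (simp add: D_def)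
  have cD: "continuous_on {m..0} D" unfolding D_def
    by (intro continuous_intros continuous_on_subset[OF end_continuous(1)] continuous_on_subset[OF end_continuous(2)] continuous_on_subset[OF gc]) auto
  have "\<exists>\<mu>\<ge>m. \<mu> \<le> 0 \<and> D \<mu> = 0"
    by (rule IVT2'[of D]) (use Dm D0 cD m0(1) in \<open>auto simp: D_def m_def\<close>)
  then obtain \<mu>D where \<mu>D: "\<mu>D \<le> 0" "D \<mu>D = 0" by blast
  have log: "s' \<mu> L / s \<mu> L = g \<mu> / M" if "D \<mu> = 0" "s \<mu> L \<noteq> 0" for \<mu>
    using that M by (simp add: D_def field_simps)
  have Wlog: "s' \<nu> L / s \<nu> L < s' \<mu> L / s \<mu> L" if "\<mu> < \<nu>" "\<nu> \<le> 0" "0 < s \<mu> L * s \<nu> L" for \<mu> \<nu>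
  proof -
    have "0 \<le> s \<nu> L \<or> s \<mu> L < 0" using that(3) by (auto simp: zero_less_mult_iff)
    from Wronskian_end_pos[OF that(1,2) this]
    have "0 < (s' \<mu> L * s \<nu> L - s \<mu> L * s' \<nu> L) / (s \<mu> L * s \<nu> L)" using that(3) by simp
    also have "\<dots> = s' \<mu> L / s \<mu> L - s' \<nu> L / s \<nu> L"
    proof -
      have "s \<mu> L \<noteq> 0" "s \<nu> L \<noteq> 0" using that(3) by auto
      then show ?thesis by (simp add: field_simps)
    qed
    finally show ?thesis by simp
  qed
  \<comment> \<open>At a zero \<nu> of D with \<open>s \<nu> L < 0\<close> the logarithmic
    derivatives would form the cycle g 0 / M < s' 0 L / s 0 L < s' \<nu> L / s \<nu> L = g \<nu> / M
    < g 0 / M.\<close>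
  have zpos: "0 < s \<nu> L" if z: "\<nu> \<le> 0" "D \<nu> = 0" for \<nu>
  proof (rule ccontr)
    assume "\<not> 0 < s \<nu> L"
    moreover have "s \<nu> L \<noteq> 0" using z even_nondegenerate[of \<nu>] M by (auto simp: D_def)
    ultimately have neg: "s \<nu> L < 0" by simp
    have "\<nu> \<noteq> 0" using z D0 by (auto simp: D_def)
    then have n0: "\<nu> < 0" using z by simp
    have neg0: "s 0 L < 0"
    proof (rule ccontr)
      assume "\<not> s 0 L < 0"
      then show False using Dirichlet_none[OF _ n0] neg by simp
    qed
    have "M * s' 0 L / s 0 L > g 0" using D0 neg0 by (simp add: field_simps)
    then have 1: "g 0 / M < s' 0 L / s 0 L" using M by (simp add: field_simps)
    have 2: "s' 0 L / s 0 L < s' \<nu> L / s \<nu> L" by (rule Wlog[OF n0]) (use neg neg0 in \<open>auto simp: mult_neg_neg\<close>)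
    have 3: "s' \<nu> L / s \<nu> L = g \<nu> / M" using log z neg by simp
    have 4: "g \<nu> / M < g 0 / M" using gm[OF n0] M by (simp add: divide_strict_right_mono)
    show False using 1 2 3 4 by linarith
  qed
  \<comment> \<open>Among energies where s is positive at L, the logarithmic derivative of s
    strictly decreases while g strictly increases, so they meet at most once.\<close>
  have nolt: False if z: "\<mu> < \<nu>" "\<nu> \<le> 0" "D \<mu> = 0" "D \<nu> = 0" for \<mu> \<nu>
  proof -
    have p: "0 < s \<mu> L" "0 < s \<nu> L" using zpos z by auto
    have "s' \<nu> L / s \<nu> L < s' \<mu> L / s \<mu> L" by (rule Wlog[OF z(1,2)]) (use p in simp)
    then have "g \<nu> / M < g \<mu> / M" using log z p by simp
    then show False using gm[OF z(1,2)] M by (simp add: divide_less_cancel)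
  qed
  show ?thesis
  proof (rule that[of \<mu>D])
    show "\<mu>D < 0" using \<mu>D D0 by (cases "\<mu>D = 0") (auto simp: D_def)
    show "0 < s \<mu>D L" by (rule zpos[OF \<mu>D])
    show "M * s' \<mu>D L - s \<mu>D L * g \<mu>D = 0" using \<mu>D by (simp add: D_def)
    show "\<mu> = \<mu>D" if "\<mu> \<le> 0" "M * s' \<mu> L - s \<mu> L * g \<mu> = 0" for \<mu>
      using nolt[of \<mu> \<mu>D] nolt[of \<mu>D \<mu>] that \<mu>D unfolding D_def by (cases \<mu> \<mu>D rule: linorder_cases) auto
  qed
qed

end

section \<open>The profile on a loop\<close>

text \<open>Only the amplitudes are scaled: u = \<phi> / \<epsilon> and p = \<phi>' / \<epsilon>^2,
  while x still runs over the half-loop [0, pi]. The assumption on p at pi is Kirchhoff's condition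
  for N equal even loops joined to a soliton tail, with c = 1 / (2 N).\<close>

locale loop_profile = period_curve c for c :: real +
  fixes \<epsilon> z :: real and u p :: "real \<Rightarrow> real"
  assumes \<epsilon>: "0 < \<epsilon>"
    and u': "\<And>x. x \<in> {0..pi} \<Longrightarrow> (u has_real_derivative \<epsilon> * p x) (at x within {0..pi})"
    and p': "\<And>x. x \<in> {0..pi} \<Longrightarrow> (p has_real_derivative \<epsilon> * (u x - 2 * u x ^ 3)) (at x within {0..pi})"
    and u_pos: "\<And>x. x \<in> {0..pi} \<Longrightarrow> 0 < u x"
    and p0: "p 0 = 0" and p_nonpos: "\<And>x. x \<in> {0..pi} \<Longrightarrow> p x \<le> 0"
    and z: "z = (u pi)\<^sup>2" "z < 1" and p_pi: "p pi = - (c * u pi * sqrt (1 - z))"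
begin

lemma z_pos: "0 < z" using z u_pos[of pi] by simp

lemma energy:
  assumes "x \<in> {0..pi}"
  shows "(p x)\<^sup>2 = (u x)\<^sup>2 - u x ^ 4 + (u 0 ^ 4 - (u 0)\<^sup>2)"
proof -
  have "((\<lambda>x. (p x)\<^sup>2 - (u x)\<^sup>2 + u x ^ 4) has_real_derivative 0) (at x within {0..pi})" if "x \<in> {0..pi}" for x
    by (rule derivative_eq_intros u'[OF that] p'[OF that] refl)+ (simp add: algebra_simps power2_eq_square power3_eq_cube)
  then obtain k where "\<forall>x\<in>{0..pi}. (p x)\<^sup>2 - (u x)\<^sup>2 + u x ^ 4 = k"
    using has_field_derivative_zero_constant[of "{0..pi}" "\<lambda>x. (p x)\<^sup>2 - (u x)\<^sup>2 + u x ^ 4"] by auto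
  then have "(p x)\<^sup>2 - (u x)\<^sup>2 + u x ^ 4 = (p 0)\<^sup>2 - (u 0)\<^sup>2 + u 0 ^ 4" using assms by simp
  then show ?thesis using p0 by simp
qed

lemma P0_prod: "(u 0)\<^sup>2 * (1 - (u 0)\<^sup>2) = k2 * (z * (1 - z))"
proof -
  have "c\<^sup>2 * z * (1 - z) = (p pi)\<^sup>2" using z by (simp add: p_pi power_mult_distrib)
  also have "\<dots> = z - z\<^sup>2 + (u 0 ^ 4 - (u 0)\<^sup>2)" using energy[of pi] by (simp add: z(1) power_mult[symmetric])
  finally show ?thesis unfolding k2_def by (simp add: algebra_simps power2_eq_square power4_eq_xxxx)
qed

lemma P0_ne: "(u 0)\<^sup>2 * (1 - (u 0)\<^sup>2) < 1 / 4"
  using mult_strict_right_mono[OF k2_bounds(2), of "z * (1 - z)"] zz[OF z_pos z(2)] unfolding P0_prod by linarith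

text \<open>p starts at 0 and never becomes positive, so its derivative at 0 is nonpositive, and
  equality is excluded by \<open>P0_ne\<close>. This selects the larger root of the quadratic
  equation for u(0)^2.\<close>

lemma P0_gt: "1 / 2 < (u 0)\<^sup>2"
proof -
  have "\<not> 0 < \<epsilon> * (u 0 - 2 * u 0 ^ 3)"
  proof
    assume pos: "0 < \<epsilon> * (u 0 - 2 * u 0 ^ 3)"
    have d: "(p has_real_derivative \<epsilon> * (u 0 - 2 * u 0 ^ 3)) (at 0 within {0..pi})" using p'[of 0] by simp
    obtain \<delta> where \<delta>: "0 < \<delta>" "\<And>t. 0 < t \<Longrightarrow> t < 0 + \<delta> \<Longrightarrow> t \<le> pi \<Longrightarrow> 0 < p t"
      using deriv_pos_right[OF d p0 pos order_refl] by blast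
    define t where "t = min (\<delta> / 2) pi"
    have t: "0 < t" "t < 0 + \<delta>" "t \<le> pi" using \<delta>(1) pi_gt_zero by (auto simp: t_def min_def)
    then show False using \<delta>(2)[OF t] p_nonpos[of t] by simp
  qed
  then have "u 0 * (1 - 2 * (u 0)\<^sup>2) \<le> 0" using \<epsilon> by (simp add: zero_less_mult_iff algebra_simps power2_eq_square power3_eq_cube)
  then have "1 / 2 \<le> (u 0)\<^sup>2" using u_pos[of 0] by (simp add: mult_le_0_iff)
  moreover have "(u 0)\<^sup>2 \<noteq> 1 / 2"
  proof
    assume e: "(u 0)\<^sup>2 = 1 / 2"
    show False using P0_ne unfolding e by simp
  qed
  ultimately show ?thesis by simp
qed

lemma P0_eq: "P z = (u 0)\<^sup>2"
proof -
  have "(2 * (u 0)\<^sup>2 - 1)\<^sup>2 = 1 - 4 * ((u 0)\<^sup>2 * (1 - (u 0)\<^sup>2))" by (simp add: power2_eq_square algebra_simps)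
  also have "\<dots> = (M z)\<^sup>2" unfolding P0_prod M_sq[OF z_pos z(2)] by simp
  finally have "2 * (u 0)\<^sup>2 - 1 = M z" using P0_gt M_pos[OF z_pos z(2)] by (simp add: power2_eq_iff)
  then show ?thesis by (simp add: P_def)
qed

lemma energy':
  assumes "x \<in> {0..pi}"
  shows "(p x)\<^sup>2 = (P z - (u x)\<^sup>2) * ((u x)\<^sup>2 + P z - 1)"
  unfolding energy[OF assms] P0_eq by (simp add: algebra_simps power2_eq_square power4_eq_xxxx)

lemma u_decreasing:
  assumes "0 \<le> x" "x \<le> y" "y \<le> pi"
  shows "u y \<le> u x"
proof -
  have sub: "{x..y} \<subseteq> {0..pi}" using assms by auto
  have "- u x \<le> - u y"
  proof (rule within_nondecreasing[OF assms(2)])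
    fix t assume "t \<in> {x..y}"
    then show "((\<lambda>x. - u x) has_real_derivative - (\<epsilon> * p t)) (at t within {x..y})"
      using sub by (intro DERIV_minus DERIV_subset[OF u' sub]) auto
  next
    fix t assume "t \<in> {x<..<y}"
    then have "p t \<le> 0" using p_nonpos[of t] assms by auto
    then show "0 \<le> - (\<epsilon> * p t)" using \<epsilon> by (simp add: mult_nonneg_nonpos)
  qed
  then show ?thesis by simp
qed

lemma u_sq_bounds:
  assumes "x \<in> {0..pi}"
  shows "z \<le> (u x)\<^sup>2" "(u x)\<^sup>2 \<le> P z" "0 < (u x)\<^sup>2 + P z - 1"
proof -
  show 1: "z \<le> (u x)\<^sup>2" unfolding z(1) using u_decreasing[of x pi] u_pos[of pi] assms by (intro power_mono) auto
  show "(u x)\<^sup>2 \<le> P z" unfolding P0_eq using u_decreasing[of 0 x] u_pos[of x] assms by (intro power_mono) auto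
  show "0 < (u x)\<^sup>2 + P z - 1" using 1 P_gt[OF z_pos z(2)] by simp
qed

text \<open>An interior zero of p would be a local maximum, hence u^2 = 1/2 there; but at that
  height the energy relation leaves p^2 = 1/4 - P (1 - P) > 0.\<close>

lemma p_neg:
  assumes "0 < x" "x \<le> pi"
  shows "p x < 0"
proof (rule ccontr)
  assume "\<not> p x < 0"
  then have px: "p x = 0" using p_nonpos[of x] assms by simp
  have "x \<noteq> pi"
  proof
    assume "x = pi"
    then have "c * u pi * sqrt (1 - z) = 0" using px p_pi by simp
    then show False using c0 u_pos[of pi] z(2) by simp
  qed
  then have x: "0 < x" "x < pi" using assms by auto
  have d: "(p has_real_derivative \<epsilon> * (u x - 2 * u x ^ 3)) (at x)"
    using p'[of x] x by (simp add: at_within_Icc_at)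
  have "\<epsilon> * (u x - 2 * u x ^ 3) = 0"
  proof (rule DERIV_local_max[OF d])
    show "0 < min x (pi - x)" using x by simp
    show "\<forall>y. \<bar>x - y\<bar> < min x (pi - x) \<longrightarrow> p y \<le> p x"
      using px p_nonpos by (auto simp: abs_less_iff)
  qed
  then have "u x * (1 - 2 * (u x)\<^sup>2) = 0" using \<epsilon> by (simp add: algebra_simps power2_eq_square power3_eq_cube)
  then have ux: "(u x)\<^sup>2 = 1 / 2" using u_pos[of x] x by simp
  have "(p x)\<^sup>2 = 1/4 - (u 0)\<^sup>2 * (1 - (u 0)\<^sup>2)"
  proof -
    have "u x ^ 4 = (u x)\<^sup>2 * (u x)\<^sup>2" by (simp add: power4_eq_xxxx power2_eq_square)
    then have "u x ^ 4 = 1 / 4" unfolding ux by simp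
    then show ?thesis using energy[of x] x ux by (simp add: algebra_simps power2_eq_square power4_eq_xxxx)
  qed
  then show False using P0_ne px by simp
qed

lemma cont_u: "continuous_on {0..pi} u"
  by (rule DERIV_continuous_on, erule u')

text \<open>The substitution \<open>t = sqrt (P z - (u x)\<^sup>2)\<close> turns the loop into the integrals of the period curve.\<close>

lemma trajectory_integral:
  assumes k: "continuous_on {0..1} k" and m: "continuous_on {0..pi} m"
    and km: "\<And>x. 0 < x \<Longrightarrow> x < pi \<Longrightarrow> k (sqrt (P z - (u x)\<^sup>2) / \<rho> z) = m x * (\<rho> z * hf (P z) (sqrt (P z - (u x)\<^sup>2)))"
  shows "integral {0..1} k = integral {0..pi} (\<lambda>x. \<epsilon> * m x)"
proof -
  define t where "t x = sqrt (P z - (u x)\<^sup>2)" for x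
  define r where "r x = t x / \<rho> z" for x
  note zp = z_pos z(2)
  have r01: "r x \<in> {0..1}" if "x \<in> {0..pi}" for x
    using u_sq_bounds[OF that] \<rho>_pos[OF zp] by (auto simp: r_def t_def \<rho>_def intro!: divide_le_eq_1_pos[THEN iffD2])
  have cr: "continuous_on {0..pi} r" unfolding r_def t_def
    by (intro continuous_intros cont_u) (use \<rho>_pos[OF zp] in auto)
  define F where "F a = integral {0..a} k" for a
  have dF: "(F has_real_derivative k a) (at a within {0..1})" if "a \<in> {0..1}" for a
    unfolding F_def using integral_has_vector_derivative[OF k that] by (simp add: has_real_derivative_iff_has_vector_derivative)
  have cF: "continuous_on {0..1} F" using dF by (rule DERIV_continuous_on)
  define G where "G x = integral {0..x} (\<lambda>x. \<epsilon> * m x)" for x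
  have cm: "continuous_on {0..pi} (\<lambda>x. \<epsilon> * m x)" by (intro continuous_intros m)
  have dG: "(G has_real_derivative \<epsilon> * m x) (at x within {0..pi})" if "x \<in> {0..pi}" for x
    unfolding G_def using integral_has_vector_derivative[OF cm that] by (simp add: has_real_derivative_iff_has_vector_derivative)
  have cG: "continuous_on {0..pi} G" using dG by (rule DERIV_continuous_on)
  \<comment> \<open>The substitution is checked by comparing primitives: r is continuous on the
    closed half-loop, and the derivatives have to agree only in the open one, which sidesteps the
    square root at the turning point r = 0.\<close>
  have "F (r pi) - G pi = F (r 0) - G 0"
  proof (rule DERIV_isconst_end[OF pi_gt_zero])
    show "continuous_on {0..pi} (\<lambda>x. F (r x) - G x)"
      by (intro continuous_on_diff cG continuous_on_compose2[OF cF cr]) (use r01 in auto)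
    fix x assume x: "0 < x" "x < pi"
    then have xI: "x \<in> {0..pi}" by simp
    have px: "p x < 0" using p_neg x by simp
    define U where "U = (u x)\<^sup>2"
    have "0 < (p x)\<^sup>2" using px by simp
    then have U: "0 < P z - U" using energy'[OF xI] u_sq_bounds[OF xI] unfolding U_def by (simp add: zero_less_mult_iff)
    have Ux: "z \<le> U" "0 < U + P z - 1" using u_sq_bounds[OF xI] by (auto simp: U_def)
    have dux: "(u has_real_derivative \<epsilon> * p x) (at x)" using u'[OF xI] x by (simp add: at_within_Icc_at)
    have dm: "((\<lambda>x. P z - (u x)\<^sup>2) has_real_derivative - (2 * u x * (\<epsilon> * p x))) (at x)"
      by (rule derivative_eq_intros dux refl)+ simp
    have tx: "t x > 0" "(t x)\<^sup>2 = P z - U" using U by (auto simp: t_def U_def)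
    have "(t has_real_derivative inverse (t x) / 2 * (- (2 * u x * (\<epsilon> * p x)))) (at x)"
      unfolding t_def by (rule DERIV_chain2[OF DERIV_real_sqrt dm]) (use U in \<open>simp add: U_def\<close>)
    then have dr: "(r has_real_derivative inverse (t x) / 2 * (- (2 * u x * (\<epsilon> * p x))) / \<rho> z) (at x)"
      unfolding r_def by (rule DERIV_cdivide)
    have "t x < \<rho> z \<or> t x = \<rho> z" using r01[OF xI] \<rho>_pos[OF zp] by (auto simp: r_def divide_le_eq)
    moreover have "t x \<noteq> \<rho> z"
    proof
      assume "t x = \<rho> z"
      then have "U = z" using tx \<rho>_sq[OF zp] by simp
      then have ueq: "u x = u pi" using z(1) u_pos[OF xI] u_pos[of pi] by (simp add: U_def power2_eq_iff)
      have "- u x < - u pi"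
      proof (rule within_increasing[OF x(2)])
        have sub: "{x..pi} \<subseteq> {0..pi}" using x by auto
        fix t assume "t \<in> {x..pi}"
        then show "((\<lambda>x. - u x) has_real_derivative - (\<epsilon> * p t)) (at t within {x..pi})"
          using sub by (intro DERIV_minus DERIV_subset[OF u' sub]) auto
      next
        fix t assume "t \<in> {x<..<pi}"
        then have "p t < 0" using p_neg x by auto
        then show "0 < - (\<epsilon> * p t)" using \<epsilon> by (simp add: mult_pos_neg)
      qed
      then show False using ueq by simp
    qed
    ultimately have rx: "0 < r x" "r x < 1" using tx \<rho>_pos[OF zp] by (auto simp: r_def)
    have "(F has_real_derivative k (r x)) (at (r x))"
      using dF[of "r x"] rx by (simp add: at_within_Icc_at)
    from DERIV_chain2[OF this dr]
    have dFr: "((\<lambda>x. F (r x)) has_real_derivative k (r x) * (inverse (t x) / 2 * (- (2 * u x * (\<epsilon> * p x))) / \<rho> z)) (at x)" .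
    have dGx: "(G has_real_derivative \<epsilon> * m x) (at x)" using dG[OF xI] x by (simp add: at_within_Icc_at)
    have "k (r x) * (inverse (t x) / 2 * (- (2 * u x * (\<epsilon> * p x))) / \<rho> z) = \<epsilon> * m x"
    proof -
      have kr: "k (r x) = m x * (\<rho> z * hf (P z) (t x))" using km[OF x] by (simp add: r_def t_def)
      have Q: "Qf (P z) (t x) = U * (U + P z - 1)" unfolding Qf_def tx(2) by (simp add: algebra_simps)
      define W where "W = sqrt (U + P z - 1)"
      have W: "0 < W" "W\<^sup>2 = U + P z - 1" using Ux by (auto simp: W_def)
      have h: "hf (P z) (t x) = 1 / (u x * W)"
        unfolding hf_def Q W_def U_def using u_pos[OF xI] by (simp add: real_sqrt_mult)
      have "(p x)\<^sup>2 = (t x * W)\<^sup>2" using energy'[OF xI] tx W by (simp add: power_mult_distrib U_def)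
      then have "p x = t x * W \<or> p x = - (t x * W)" by (simp add: power2_eq_iff)
      moreover have "0 < t x * W" using tx(1) W(1) by simp
      ultimately have "p x = - (t x * W)" using px by linarith
      then show ?thesis unfolding kr h using u_pos[OF xI] tx W \<rho>_pos[OF zp] by (simp add: field_simps)
    qed
    then show "((\<lambda>x. F (r x) - G x) has_real_derivative 0) (at x)" using DERIV_diff[OF dFr dGx] by simp
  qed
  moreover have "r 0 = 0" by (simp add: r_def t_def P0_eq)
  moreover have "r pi = 1" using \<rho>_pos[OF zp] by (simp add: r_def t_def \<rho>_def z(1)[symmetric])
  ultimately show ?thesis by (simp add: F_def G_def)
qed

lemma T_value: "T z = \<epsilon> * pi"
proof -
  have "T z = integral {0..pi} (\<lambda>x. \<epsilon> * 1)"
    unfolding T_def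
    by (rule trajectory_integral[OF kernel_cont(1)[OF z_pos z(2)]]) (use \<rho>_pos[OF z_pos z(2)] in auto)
  then show ?thesis by simp
qed

text \<open>The part of J accumulated up to x; it supplies the nonelementary part of the second
  solution \<open>w\<close>.\<close>

definition I :: "real \<Rightarrow> real" where "I x = integral {0..x} (\<lambda>x. \<epsilon> * ((u x)\<^sup>2 - 2 * (P z * (1 - P z))))"

lemma J_value: "J z = I pi"
  unfolding J_def I_def
proof (rule trajectory_integral[OF kernel_cont(2)[OF z_pos z(2)]])
  show "continuous_on {0..pi} (\<lambda>x. (u x)\<^sup>2 - 2 * (P z * (1 - P z)))" by (intro continuous_intros cont_u)
  fix x :: real assume "0 < x" "x < pi"
  then have "0 \<le> P z - (u x)\<^sup>2" using u_sq_bounds[of x] by simp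
  then show "\<rho> z * jf (P z) (\<rho> z * (sqrt (P z - (u x)\<^sup>2) / \<rho> z))
     = ((u x)\<^sup>2 - 2 * (P z * (1 - P z))) * (\<rho> z * hf (P z) (sqrt (P z - (u x)\<^sup>2)))"
    using \<rho>_pos[OF z_pos z(2)] by (simp add: jf_def algebra_simps power2_eq_square[of "P z"])
qed

lemma I_deriv: "x \<in> {0..pi} \<Longrightarrow> (I has_real_derivative \<epsilon> * ((u x)\<^sup>2 - 2 * (P z * (1 - P z)))) (at x within {0..pi})"
proof -
  assume x: "x \<in> {0..pi}"
  have cm: "continuous_on {0..pi} (\<lambda>x. \<epsilon> * ((u x)\<^sup>2 - 2 * (P z * (1 - P z))))" by (intro continuous_intros cont_u)
  show ?thesis unfolding I_def using integral_has_vector_derivative[OF cm x] by (simp add: has_real_derivative_iff_has_vector_derivative)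
qed

text \<open>Equal to - \<omega> - 6 \<Phi>^2 on a loop when \<Phi> = \<epsilon> u and - \<omega> =
  \<epsilon>^2.\<close>

definition V :: "real \<Rightarrow> real" where "V x = \<epsilon>\<^sup>2 * (1 - 6 * (u x)\<^sup>2)"

text \<open>Differentiating the profile equation shows that the slope solves the linearized
  equation; the minus sign makes it positive on (0, pi].\<close>

lemma translation_sol: "lin_sol {0..pi} V (\<lambda>x. - p x) (\<lambda>x. - (\<epsilon> * (u x - 2 * u x ^ 3)))"
  unfolding lin_sol_def
proof (intro ballI conjI)
  fix x assume x: "x \<in> {0..pi}"
  show "((\<lambda>x. - p x) has_real_derivative - (\<epsilon> * (u x - 2 * u x ^ 3))) (at x within {0..pi})" by (rule DERIV_minus[OF p'[OF x]])
  show "((\<lambda>x. - (\<epsilon> * (u x - 2 * u x ^ 3))) has_real_derivative V x * - p x) (at x within {0..pi})"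
    unfolding V_def by (rule derivative_eq_intros u'[OF x] refl)+ (simp add: algebra_simps power2_eq_square)
qed

text \<open>A second solution of the linearized equation at energy zero; up to scaling it is the derivative of
  the profile with respect to its height at the midpoint of the loop.\<close>

definition w :: "real \<Rightarrow> real" where "w x = p x * I x + u x * (1 - (u x)\<^sup>2 - 2 * (P z * (1 - P z)))"
definition w' :: "real \<Rightarrow> real" where "w' x = \<epsilon> * ((u x - 2 * u x ^ 3) * I x + p x * (1 - 2 * (u x)\<^sup>2 - 4 * (P z * (1 - P z))))"

lemma w_sol: "lin_sol {0..pi} V w w'"
  unfolding lin_sol_def
proof (intro ballI conjI)
  fix x assume x: "x \<in> {0..pi}"
  define e where "e = P z * (1 - P z)"
  have dI: "(I has_real_derivative \<epsilon> * ((u x)\<^sup>2 - 2 * e)) (at x within {0..pi})" using I_deriv[OF x] by (simp add: e_def)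
  show "(w has_real_derivative w' x) (at x within {0..pi})"
    unfolding w_def w'_def e_def[symmetric]
    by (rule derivative_eq_intros u'[OF x] p'[OF x] dI refl)+ (simp add: algebra_simps power2_eq_square power3_eq_cube)
  \<comment> \<open>The square of p that arises from differentiating \<open>w'\<close> has to be
    eliminated by the energy relation before both sides agree as polynomials.\<close>
  have en: "(p x)\<^sup>2 = (u x)\<^sup>2 - u x ^ 4 - e" using energy'[OF x] by (simp add: e_def algebra_simps power2_eq_square power4_eq_xxxx)
  have "(w' has_real_derivative
      \<epsilon> * (\<epsilon> * p x * (1 - 6 * (u x)\<^sup>2) * I x + (u x - 2 * u x ^ 3) * (\<epsilon> * ((u x)\<^sup>2 - 2 * e))
        + \<epsilon> * (u x - 2 * u x ^ 3) * (1 - 2 * (u x)\<^sup>2 - 4 * e) + (p x * p x) * (- 4 * u x * \<epsilon>))) (at x within {0..pi})"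
    unfolding w'_def e_def[symmetric]
    by (rule derivative_eq_intros u'[OF x] p'[OF x] dI refl)+ (simp add: algebra_simps power2_eq_square power3_eq_cube)
  moreover have "\<epsilon> * (\<epsilon> * p x * (1 - 6 * (u x)\<^sup>2) * I x + (u x - 2 * u x ^ 3) * (\<epsilon> * ((u x)\<^sup>2 - 2 * e))
        + \<epsilon> * (u x - 2 * u x ^ 3) * (1 - 2 * (u x)\<^sup>2 - 4 * e) + (p x * p x) * (- 4 * u x * \<epsilon>)) = V x * w x"
    unfolding power2_eq_square[symmetric, of "p x"] en V_def w_def e_def[symmetric]
    by (simp add: algebra_simps power2_eq_square power3_eq_cube power4_eq_xxxx)
  ultimately show "(w' has_real_derivative V x * w x) (at x within {0..pi})" by (simp only:)
qed

lemma I0: "I 0 = 0" by (simp add: I_def)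

text \<open>These initial data make w a multiple of the even solution, with a negative factor
  because 1/2 < P < 1. The factor reverses signs between H and the even solution.\<close>

lemma w_start: "w 0 < 0" "w' 0 = 0"
proof -
  have "w 0 = u 0 * ((1 - P z) * (1 - 2 * P z))" unfolding w_def P0_eq[symmetric] using p0 by (simp add: algebra_simps)
  moreover have "(1 - P z) * (1 - 2 * P z) < 0" using P_bounds[OF z_pos z(2)] by (intro mult_pos_neg) auto
  ultimately show "w 0 < 0" using u_pos[of 0] by (simp add: mult_pos_neg)
  show "w' 0 = 0" by (simp add: w'_def p0 I0)
qed

lemma w_end: "w pi = u pi * sqrt (1 - z) * H z"
proof -
  have s: "1 - z = sqrt (1 - z) * sqrt (1 - z)" using z(2) by simp
  have "w pi = u pi * (- (c * sqrt (1 - z)) * J z + (1 - z) * (1 - 2 * k2 * z))"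
    unfolding w_def p_pi J_value P_eq[OF z_pos z(2)] z(1)[symmetric] by (simp add: algebra_simps)
  also have "\<dots> = u pi * sqrt (1 - z) * H z" unfolding H_def by (subst s) (simp add: algebra_simps)
  finally show ?thesis .
qed

text \<open>With 1 / c = 2 N and \<epsilon> (2 z - 1) / sqrt (1 - z) the logarithmic derivative of
  the decaying solution on the half-line, the left side is the Kirchhoff mismatch of w at energy 0.
  The J terms combine through 1 / c - c = k2 / c.\<close>

lemma w'_end: "w' pi / c - w pi * (\<epsilon> * (2 * z - 1) / sqrt (1 - z)) = \<epsilon> * u pi * k2 / c * K z"
proof -
  define s where "s = sqrt (1 - z)"
  have s: "s > 0" "s * s = 1 - z" using z(2) by (auto simp: s_def)
  have u3: "u pi - 2 * u pi ^ 3 = u pi * (1 - 2 * z)" by (simp add: z(1) algebra_simps power2_eq_square power3_eq_cube)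
  have "w' pi = \<epsilon> * u pi * ((1 - 2 * z) * J z - c * s * (1 - 2 * z - 4 * (k2 * (z * (1 - z)))))"
    unfolding w'_def u3 p_pi J_value P_eq[OF z_pos z(2)] z(1)[symmetric] s_def[symmetric] by (simp add: algebra_simps)
  then have 1: "w' pi / c = \<epsilon> * u pi * ((1 - 2 * z) * J z / c - s * (1 - 2 * z - 4 * (k2 * (z * (1 - z)))))"
    using c0 by (simp add: field_simps)
  have 2: "w pi * (\<epsilon> * (2 * z - 1) / s) = \<epsilon> * u pi * ((2 * z - 1) * (s * (1 - 2 * k2 * z) - c * J z))"
    unfolding w_end s_def[symmetric] H_def using s by (simp add: field_simps)
  have 3: "(1 - 2 * z) * J z / c - c * ((1 - 2 * z) * J z) = k2 / c * ((1 - 2 * z) * J z)"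
    using c0 by (simp add: k2_def field_simps power2_eq_square)
  have 4: "k2 / c * (2 * c * z * s) = 2 * k2 * z * s" using c0 by simp
  have 5: "a - s * (1 - 2 * z - 4 * (k2 * (z * (1 - z)))) - (2 * z - 1) * (s * (1 - 2 * k2 * z) - c * J z)
      = (a - c * ((1 - 2 * z) * J z)) + 2 * k2 * z * s" for a
    by (simp add: algebra_simps)
  show ?thesis unfolding s_def[symmetric] 1 2 right_diff_distrib[of "\<epsilon> * u pi", symmetric] 5 3 K_def 4[symmetric]
    by (simp only: distrib_left[symmetric] add_divide_distrib[symmetric] mult.assoc times_divide_eq_left times_divide_eq_right add.commute)
qed

end

section \<open>The half-line\<close>

text \<open>The half-line has infinite measure. This turns conserved quantities into zeros: the
  energy of the tail, and the Wronskian of a square integrable solution with the Jost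
  solution.\<close>

lemma const_integrable_halfline:
  fixes k :: real
  assumes "set_integrable lebesgue {0::real..} (\<lambda>x. k)"
  shows "k = 0"
proof (rule ccontr)
  assume k: "k \<noteq> 0"
  have "set_integrable lebesgue {0::real..} (\<lambda>x. (1 / k) *\<^sub>R k)" using set_integrable_scaleR_right[where a="1 / k" and f="\<lambda>_. k", OF assms] k by simp
  then have "integrable lebesgue (indicator {0..} :: real \<Rightarrow> real)" using k unfolding set_integrable_def by simp
  then have fin: "emeasure lebesgue {0::real..} < \<infinity>" by (simp add: integrable_indicator_iff)
  have le: "of_nat n \<le> emeasure lebesgue {0::real..}" for n :: nat
  proof -
    have "emeasure lebesgue {0..real n} \<le> emeasure lebesgue {0::real..}" by (rule emeasure_mono) auto
    then show ?thesis by (simp add: ennreal_of_nat_eq_real_of_nat)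
  qed
  obtain n :: nat where "emeasure lebesgue {0::real..} < of_nat n"
    using fin ennreal_Ex_less_of_nat[of "emeasure lebesgue {0::real..}"] by auto
  then show False using le[of n] by simp
qed

lemma L2_norm_square_integrable: "u \<in> L2_on I \<Longrightarrow> set_integrable lebesgue I (\<lambda>x. (norm (u x))\<^sup>2)"
  by (simp add: L2_on_def)

lemma exp_bound_L2:
  fixes u :: "real \<Rightarrow> 'a::euclidean_space"
  assumes c: "continuous_on {0..} u" and a: "0 < a" and b: "\<And>x. 0 \<le> x \<Longrightarrow> norm (u x) \<le> C * exp (- a * x)"
  shows "u \<in> L2_on {0..}"
  unfolding L2_on_def
proof safe
  show "set_borel_measurable lebesgue {0..} u" by (rule cont_set_borel_measurable[OF c]) simp
  have "(\<lambda>x. exp (- (2 * a) * x)) integrable_on {0..}" by (rule integrable_on_exp_minus_to_infinity) (use a in simp)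
  then have "(\<lambda>x. exp (- (2 * a) * x)) absolutely_integrable_on {0..}"
    by (rule nonnegative_absolutely_integrable_1) simp
  then have i: "set_integrable lebesgue {0..} (\<lambda>x. C\<^sup>2 *\<^sub>R exp (- (2 * a) * x))" by (intro set_integrable_scaleR_right)
  have m: "set_borel_measurable lebesgue {0..} (\<lambda>x. (norm (u x))\<^sup>2)"
    by (rule cont_set_borel_measurable) (auto intro!: continuous_intros c)
  show "set_integrable lebesgue {0..} (\<lambda>x. (norm (u x))\<^sup>2)"
    unfolding set_integrable_def
  proof (rule Bochner_Integration.integrable_bound[OF i[unfolded set_integrable_def]])
    show "(\<lambda>x. indicator {0..} x *\<^sub>R (norm (u x))\<^sup>2) \<in> borel_measurable lebesgue" using m unfolding set_borel_measurable_def .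
    show "AE x in lebesgue. norm (indicator {0..} x *\<^sub>R (norm (u x))\<^sup>2) \<le> norm (indicator {0..} x *\<^sub>R C\<^sup>2 *\<^sub>R exp (- (2 * a) * x))"
    proof (intro AE_I2)
      fix x :: real
      have "(norm (u x))\<^sup>2 \<le> C\<^sup>2 * exp (- (2 * a) * x)" if "0 \<le> x"
      proof -
        have "(norm (u x))\<^sup>2 \<le> (C * exp (- a * x))\<^sup>2" using b[OF that] by (intro power_mono) auto
        also have "\<dots> = C\<^sup>2 * exp (- (2 * a) * x)" by (simp add: power_mult_distrib power2_eq_square[of "exp _"] exp_add[symmetric])
        finally show ?thesis .
      qed
      then show "norm (indicator {0..} x *\<^sub>R (norm (u x))\<^sup>2) \<le> norm (indicator {0..} x *\<^sub>R C\<^sup>2 *\<^sub>R exp (- (2 * a) * x))"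
        by (auto simp: indicator_def)
    qed
  qed
qed

text \<open>\<tau> stands for tanh (\<epsilon> (x + a)), characterized by its Riccati equation; the
  truncation point a of the soliton enters only through the value of \<tau> at 0.\<close>

locale halfline_profile =
  fixes \<epsilon> :: real and \<tau> :: "real \<Rightarrow> real"
  assumes \<epsilon>: "0 < \<epsilon>"
    and \<tau>': "\<And>x. 0 \<le> x \<Longrightarrow> (\<tau> has_real_derivative \<epsilon> * (1 - (\<tau> x)\<^sup>2)) (at x within {0..})"
    and \<tau>_bounds: "\<And>x. 0 \<le> x \<Longrightarrow> 0 < \<tau> x" "\<And>x. 0 \<le> x \<Longrightarrow> \<tau> x \<le> 1"
begin

definition X :: "real \<Rightarrow> real \<Rightarrow> real" where "X \<kappa> x = 3 * (\<tau> x)\<^sup>2 + 3 * \<kappa> * \<tau> x + \<kappa>\<^sup>2 - 1"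
definition Y :: "real \<Rightarrow> real \<Rightarrow> real" where "Y \<kappa> x = - \<kappa> * X \<kappa> x + 3 * (\<kappa> + 2 * \<tau> x) * (1 - (\<tau> x)\<^sup>2)"
definition f :: "real \<Rightarrow> real \<Rightarrow> real" where "f \<kappa> x = exp (- (\<kappa> * \<epsilon>) * x) * X \<kappa> x"
definition f' :: "real \<Rightarrow> real \<Rightarrow> real" where "f' \<kappa> x = exp (- (\<kappa> * \<epsilon>) * x) * (\<epsilon> * Y \<kappa> x)"

text \<open>The Jost solution of the Poeschl--Teller potential, written with \<open>\<tau>\<close> in place of the hyperbolic tangent.\<close>

lemma f_deriv:
  assumes "0 \<le> x"
  shows "(f \<kappa> has_real_derivative f' \<kappa> x) (at x within {0..})"
    "(f' \<kappa> has_real_derivative \<epsilon>\<^sup>2 * (\<kappa>\<^sup>2 - 6 * (1 - (\<tau> x)\<^sup>2)) * f \<kappa> x) (at x within {0..})"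
proof -
  define E where "E x = exp (- (\<kappa> * \<epsilon>) * x)" for x
  have dE: "(E has_real_derivative - (\<kappa> * \<epsilon>) * E x) (at x within {0..})"
    unfolding E_def by (rule derivative_eq_intros refl)+ simp
  have fe: "f \<kappa> = (\<lambda>x. E x * X \<kappa> x)" "f' \<kappa> = (\<lambda>x. E x * (\<epsilon> * Y \<kappa> x))" by (auto simp: f_def f'_def E_def)
  show "(f \<kappa> has_real_derivative f' \<kappa> x) (at x within {0..})"
    unfolding fe X_def Y_def
    by (rule derivative_eq_intros dE \<tau>'[OF assms] refl)+ (simp add: algebra_simps power2_eq_square)
  show "(f' \<kappa> has_real_derivative \<epsilon>\<^sup>2 * (\<kappa>\<^sup>2 - 6 * (1 - (\<tau> x)\<^sup>2)) * f \<kappa> x) (at x within {0..})"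
    unfolding fe X_def Y_def
    by (rule derivative_eq_intros dE \<tau>'[OF assms] refl)+ (simp add: algebra_simps power2_eq_square)
qed

lemma X_pos:
  assumes "0 \<le> x" "1 \<le> \<kappa>"
  shows "0 < X \<kappa> x"
proof -
  have "0 < 3 * (\<tau> x)\<^sup>2" "0 \<le> 3 * \<kappa> * \<tau> x" "1 \<le> \<kappa>\<^sup>2" using \<tau>_bounds[OF assms(1)] assms(2) by (auto simp: one_le_power)
  then show ?thesis unfolding X_def by linarith
qed

lemma f_pos: "0 \<le> x \<Longrightarrow> 1 \<le> \<kappa> \<Longrightarrow> 0 < f \<kappa> x"
  unfolding f_def using X_pos by simp

lemma \<tau>_cont: "continuous_on {0..} \<tau>"
  by (rule DERIV_continuous_on, rule \<tau>', simp)

lemma f_bounds: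
  assumes "0 \<le> x" "1 \<le> \<kappa>"
  shows "\<bar>f \<kappa> x\<bar> \<le> (3 + 3 * \<kappa> + \<kappa>\<^sup>2) * exp (- \<epsilon> * x)"
    "\<bar>f' \<kappa> x\<bar> \<le> (\<epsilon> * (\<kappa> * (3 + 3 * \<kappa> + \<kappa>\<^sup>2) + 3 * (\<kappa> + 2))) * exp (- \<epsilon> * x)"
proof -
  note t = \<tau>_bounds[OF assms(1)]
  have t2: "(\<tau> x)\<^sup>2 \<le> 1" "0 \<le> (\<tau> x)\<^sup>2" using t by (auto simp: abs_square_le_1)
  have e: "exp (- (\<kappa> * \<epsilon>) * x) \<le> exp (- \<epsilon> * x)"
    using mult_right_mono[OF assms(2), of "\<epsilon> * x"] assms(1) \<epsilon> by (simp add: mult.assoc)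
  have kt: "\<kappa> * \<tau> x \<le> \<kappa> * 1" using t assms by (intro mult_left_mono) auto
  have X: "\<bar>X \<kappa> x\<bar> \<le> 3 + 3 * \<kappa> + \<kappa>\<^sup>2"
    using X_pos[OF assms] t2 kt unfolding X_def by auto
  have "\<bar>3 * (\<kappa> + 2 * \<tau> x) * (1 - (\<tau> x)\<^sup>2)\<bar> = 3 * (\<kappa> + 2 * \<tau> x) * (1 - (\<tau> x)\<^sup>2)" using t t2 assms by simp
  also have "\<dots> \<le> 3 * (\<kappa> + 2) * 1" using t t2 assms by (intro mult_mono) auto
  finally have b: "\<bar>3 * (\<kappa> + 2 * \<tau> x) * (1 - (\<tau> x)\<^sup>2)\<bar> \<le> 3 * (\<kappa> + 2)" by simp
  have a: "\<bar>- \<kappa> * X \<kappa> x\<bar> \<le> \<kappa> * (3 + 3 * \<kappa> + \<kappa>\<^sup>2)" using X assms(2) by (simp add: abs_mult mult_left_mono)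
  have Y: "\<bar>Y \<kappa> x\<bar> \<le> \<kappa> * (3 + 3 * \<kappa> + \<kappa>\<^sup>2) + 3 * (\<kappa> + 2)"
    unfolding Y_def by (rule order_trans[OF abs_triangle_ineq add_mono[OF a b]])
  have "exp (- (\<kappa> * \<epsilon>) * x) * \<bar>X \<kappa> x\<bar> \<le> exp (- \<epsilon> * x) * (3 + 3 * \<kappa> + \<kappa>\<^sup>2)"
    by (rule mult_mono[OF e X]) auto
  then show "\<bar>f \<kappa> x\<bar> \<le> (3 + 3 * \<kappa> + \<kappa>\<^sup>2) * exp (- \<epsilon> * x)" by (simp add: f_def abs_mult mult.commute)
  have "exp (- (\<kappa> * \<epsilon>) * x) * (\<epsilon> * \<bar>Y \<kappa> x\<bar>) \<le> exp (- \<epsilon> * x) * (\<epsilon> * (\<kappa> * (3 + 3 * \<kappa> + \<kappa>\<^sup>2) + 3 * (\<kappa> + 2)))"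
    by (rule mult_mono[OF e mult_left_mono[OF Y]]) (use \<epsilon> in auto)
  then show "\<bar>f' \<kappa> x\<bar> \<le> (\<epsilon> * (\<kappa> * (3 + 3 * \<kappa> + \<kappa>\<^sup>2) + 3 * (\<kappa> + 2))) * exp (- \<epsilon> * x)"
    using \<epsilon> by (simp add: f'_def abs_mult mult.commute)
qed

text \<open>The Wronskian with the Jost solution is constant. As f and f' are bounded, its square is
  dominated by a multiple of |\<psi>|^2 + |\<psi>'|^2, which is integrable on the half-line; so it
  vanishes, and \<psi> / f is constant since f has no zeros.\<close>

lemma decaying_unique:
  fixes \<psi> \<psi>' :: "real \<Rightarrow> complex"
  assumes \<kappa>: "1 \<le> \<kappa>"
    and d: "\<And>x. 0 \<le> x \<Longrightarrow> (\<psi> has_vector_derivative \<psi>' x) (at x within {0..})"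
    and d': "\<And>x. 0 \<le> x \<Longrightarrow> (\<psi>' has_vector_derivative (\<epsilon>\<^sup>2 * (\<kappa>\<^sup>2 - 6 * (1 - (\<tau> x)\<^sup>2))) *\<^sub>R \<psi> x) (at x within {0..})"
    and L2: "\<psi> \<in> L2_on {0..}" "\<psi>' \<in> L2_on {0..}"
  obtains k where "\<And>x. 0 \<le> x \<Longrightarrow> \<psi> x = f \<kappa> x *\<^sub>R k" "\<And>x. 0 \<le> x \<Longrightarrow> \<psi>' x = f' \<kappa> x *\<^sub>R k"
proof -
  define W where "W x = f \<kappa> x *\<^sub>R \<psi>' x - f' \<kappa> x *\<^sub>R \<psi> x" for x
  have cv: "convex {0::real..}" by simp
  have "(W has_vector_derivative 0) (at x within {0..})" if "x \<in> {0..}" for x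
  proof -
    have x: "0 \<le> x" using that by simp
    have "(W has_vector_derivative
       (f \<kappa> x *\<^sub>R ((\<epsilon>\<^sup>2 * (\<kappa>\<^sup>2 - 6 * (1 - (\<tau> x)\<^sup>2))) *\<^sub>R \<psi> x) + f' \<kappa> x *\<^sub>R \<psi>' x) -
       (f' \<kappa> x *\<^sub>R \<psi>' x + (\<epsilon>\<^sup>2 * (\<kappa>\<^sup>2 - 6 * (1 - (\<tau> x)\<^sup>2)) * f \<kappa> x) *\<^sub>R \<psi> x)) (at x within {0..})"
      unfolding W_def
      by (intro has_vector_derivative_diff has_vector_derivative_scaleR f_deriv[OF x] d[OF x] d'[OF x])
    then show ?thesis by (simp add: mult.commute)
  qed
  then obtain C where C: "\<And>x. x \<in> {0..} \<Longrightarrow> W x = C"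
    using has_vector_derivative_zero_constant[OF cv, of W] by metis
  define A1 where "A1 = 3 + 3 * \<kappa> + \<kappa>\<^sup>2"
  define A2 where "A2 = \<epsilon> * (\<kappa> * (3 + 3 * \<kappa> + \<kappa>\<^sup>2) + 3 * (\<kappa> + 2))"
  define B where "B = A1 + A2"
  have B: "\<bar>f \<kappa> x\<bar> \<le> B" "\<bar>f' \<kappa> x\<bar> \<le> B" if x: "0 \<le> x" for x
  proof -
    have e: "exp (- \<epsilon> * x) \<le> 1" using \<epsilon> x by simp
    have p1: "0 \<le> A1" and p2: "0 \<le> A2" using \<kappa> \<epsilon> by (auto simp: A1_def A2_def)
    have "\<bar>f \<kappa> x\<bar> \<le> A1 * exp (- \<epsilon> * x)" "\<bar>f' \<kappa> x\<bar> \<le> A2 * exp (- \<epsilon> * x)"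
      using f_bounds[OF x \<kappa>] by (auto simp: A1_def A2_def)
    moreover have "A1 * exp (- \<epsilon> * x) \<le> A1" "A2 * exp (- \<epsilon> * x) \<le> A2"
      using mult_left_mono[OF e p1] mult_left_mono[OF e p2] by simp_all
    ultimately show "\<bar>f \<kappa> x\<bar> \<le> B" "\<bar>f' \<kappa> x\<bar> \<le> B" using p1 p2 unfolding B_def by linarith+
  qed
  have Cb: "(norm C)\<^sup>2 \<le> 2 * B\<^sup>2 * ((norm (\<psi> x))\<^sup>2 + (norm (\<psi>' x))\<^sup>2)" if x: "0 \<le> x" for x
  proof -
    have "norm C \<le> norm (f \<kappa> x *\<^sub>R \<psi>' x) + norm (f' \<kappa> x *\<^sub>R \<psi> x)"
      using C[of x] x norm_triangle_ineq4[of "f \<kappa> x *\<^sub>R \<psi>' x" "f' \<kappa> x *\<^sub>R \<psi> x"] by (simp add: W_def)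
    also have "\<dots> \<le> B * norm (\<psi>' x) + B * norm (\<psi> x)" using B[OF x] by (intro add_mono) (auto intro: mult_right_mono)
    finally have "norm C \<le> B * (norm (\<psi>' x) + norm (\<psi> x))" by (simp add: algebra_simps)
    then have "(norm C)\<^sup>2 \<le> (B * (norm (\<psi>' x) + norm (\<psi> x)))\<^sup>2" by (intro power_mono) auto
    also have "\<dots> = B\<^sup>2 * (norm (\<psi>' x) + norm (\<psi> x))\<^sup>2" by (simp add: power_mult_distrib)
    also have "\<dots> \<le> B\<^sup>2 * (2 * ((norm (\<psi> x))\<^sup>2 + (norm (\<psi>' x))\<^sup>2))"
      using sum_squares_bound[of "norm (\<psi>' x)" "norm (\<psi> x)"] by (intro mult_left_mono) (auto simp: power2_sum)
    finally show ?thesis by (simp add: algebra_simps)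
  qed
  define h where "h x = (2 * B\<^sup>2) *\<^sub>R ((norm (\<psi> x))\<^sup>2 + (norm (\<psi>' x))\<^sup>2)" for x
  have h: "set_integrable lebesgue {0..} h"
    using set_integrable_scaleR_right[where a="2 * B\<^sup>2" and f="\<lambda>x. (norm (\<psi> x))\<^sup>2 + (norm (\<psi>' x))\<^sup>2",
        OF set_integral_add(1)[OF L2_norm_square_integrable[OF L2(1)] L2_norm_square_integrable[OF L2(2)]]]
    unfolding h_def .
  have "set_integrable lebesgue {0::real..} (\<lambda>x. (norm C)\<^sup>2)"
    unfolding set_integrable_def
  proof (rule Bochner_Integration.integrable_bound[OF h[unfolded set_integrable_def]])
    show "(\<lambda>x::real. indicator {0..} x *\<^sub>R (norm C)\<^sup>2) \<in> borel_measurable lebesgue"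
      by (intro borel_measurable_scaleR borel_measurable_indicator borel_measurable_const) simp
    show "AE x::real in lebesgue. norm (indicator {0..} x *\<^sub>R (norm C)\<^sup>2) \<le> norm (indicator {0..} x *\<^sub>R h x)"
      using Cb by (intro AE_I2) (auto simp: indicator_def h_def)
  qed
  then have C0: "C = 0" using const_integrable_halfline[of "(norm C)\<^sup>2"] by simp
  have W0: "f \<kappa> x *\<^sub>R \<psi>' x = f' \<kappa> x *\<^sub>R \<psi> x" if "0 \<le> x" for x using C[of x] that C0 by (simp add: W_def)
  have "((\<lambda>x. (1 / f \<kappa> x) *\<^sub>R \<psi> x) has_vector_derivative 0) (at x within {0..})" if "x \<in> {0..}" for x
  proof -
    have x: "0 \<le> x" using that by simp
    have fp: "f \<kappa> x \<noteq> 0" using f_pos[OF x \<kappa>] by simp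
    have "((\<lambda>x. 1 / f \<kappa> x) has_field_derivative - f' \<kappa> x / (f \<kappa> x * f \<kappa> x)) (at x within {0..})"
      by (rule derivative_eq_intros f_deriv[OF x] refl fp)+ simp
    from has_vector_derivative_scaleR[OF this d[OF x]]
    have "((\<lambda>x. (1 / f \<kappa> x) *\<^sub>R \<psi> x) has_vector_derivative (1 / f \<kappa> x) *\<^sub>R \<psi>' x + (- f' \<kappa> x / (f \<kappa> x * f \<kappa> x)) *\<^sub>R \<psi> x) (at x within {0..})" .
    moreover have "(1 / f \<kappa> x) *\<^sub>R \<psi>' x + (- f' \<kappa> x / (f \<kappa> x * f \<kappa> x)) *\<^sub>R \<psi> x = (1 / (f \<kappa> x * f \<kappa> x)) *\<^sub>R (f \<kappa> x *\<^sub>R \<psi>' x - f' \<kappa> x *\<^sub>R \<psi> x)"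
      using fp by (simp add: scaleR_diff_right)
    ultimately show ?thesis using W0[OF x] by simp
  qed
  then obtain k where k: "\<And>x. x \<in> {0..} \<Longrightarrow> (1 / f \<kappa> x) *\<^sub>R \<psi> x = k"
    using has_vector_derivative_zero_constant[OF cv, of "\<lambda>x. (1 / f \<kappa> x) *\<^sub>R \<psi> x"] by metis
  have \<psi>: "\<psi> x = f \<kappa> x *\<^sub>R k" if "0 \<le> x" for x
    using k[of x] that f_pos[OF that \<kappa>] by auto
  show ?thesis
  proof (rule that[OF \<psi>])
    fix x :: real assume x: "0 \<le> x"
    have "f \<kappa> x *\<^sub>R \<psi>' x = f \<kappa> x *\<^sub>R (f' \<kappa> x *\<^sub>R k)" unfolding W0[OF x] \<psi>[OF x] by (simp add: mult.commute)
    then show "\<psi>' x = f' \<kappa> x *\<^sub>R k"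
      by (rule scaleR_left_imp_eq[rotated]) (use f_pos[OF x \<kappa>] in simp)
  qed
qed

text \<open>The decay rate in units of \<epsilon>: where \<tau> is close to 1 the equation is
  approximately \<psi>'' = (\<epsilon>^2 - \<mu>) \<psi> = (\<epsilon> \<kappa>)^2 \<psi>.\<close>

definition \<kappa> :: "real \<Rightarrow> real" where "\<kappa> \<mu> = sqrt (1 - \<mu> / \<epsilon>\<^sup>2)"
definition g :: "real \<Rightarrow> real" where "g \<mu> = f' (\<kappa> \<mu>) 0 / f (\<kappa> \<mu>) 0"

lemma \<kappa>_props:
  assumes "\<mu> \<le> 0"
  shows "1 \<le> \<kappa> \<mu>" "\<epsilon>\<^sup>2 * ((\<kappa> \<mu>)\<^sup>2 - 6 * y) = \<epsilon>\<^sup>2 * (1 - 6 * y) - \<mu>"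
proof -
  have 0: "\<mu> / \<epsilon>\<^sup>2 \<le> 0" using assms by (simp add: divide_nonpos_nonneg)
  then show "1 \<le> \<kappa> \<mu>" unfolding \<kappa>_def by simp
  have "(\<kappa> \<mu>)\<^sup>2 = 1 - \<mu> / \<epsilon>\<^sup>2" unfolding \<kappa>_def using 0 by simp
  then show "\<epsilon>\<^sup>2 * ((\<kappa> \<mu>)\<^sup>2 - 6 * y) = \<epsilon>\<^sup>2 * (1 - 6 * y) - \<mu>" using \<epsilon> by (simp add: field_simps)
qed

lemma g_eq: "1 \<le> \<kappa> \<mu> \<Longrightarrow> g \<mu> = \<epsilon> * (- \<kappa> \<mu> + 3 * (1 - (\<tau> 0)\<^sup>2) * ((\<kappa> \<mu> + 2 * \<tau> 0) / X (\<kappa> \<mu>) 0))"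
  unfolding g_def f_def f'_def Y_def using X_pos[of 0 "\<kappa> \<mu>"] by (simp add: field_simps)

text \<open>Written as (\<kappa> + 2 \<tau>) (\<kappa> + \<tau>) - (1 - \<tau>^2), X grows with
  \<kappa> faster than \<kappa> + 2 \<tau>, so neither term of \<open>g_eq\<close> increases with
  \<kappa>, and the term - \<kappa> strictly decreases. Finally \<kappa> decreases as \<mu>
  grows.\<close>

lemma g_mono:
  assumes "\<mu> < \<nu>" "\<nu> \<le> 0"
  shows "g \<mu> < g \<nu>"
proof -
  define a b where "a = \<kappa> \<nu>" and "b = \<kappa> \<mu>"
  have a1: "1 \<le> a" using \<kappa>_props(1)[OF assms(2)] by (simp add: a_def)
  have ab: "a < b" unfolding a_def b_def \<kappa>_def using assms \<epsilon> by (simp add: divide_strict_right_mono)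
  define t where "t = \<tau> 0"
  have t: "0 < t" "t \<le> 1" using \<tau>_bounds[of 0] by (auto simp: t_def)
  have t2: "0 \<le> 1 - t\<^sup>2" using t by (simp add: abs_square_le_1)
  have Xp: "0 < X a 0" "0 < X b 0" using X_pos a1 ab by auto
  have XX: "X k 0 = (k + 2 * t) * (k + t) - (1 - t\<^sup>2)" for k by (simp add: X_def t_def algebra_simps power2_eq_square)
  have "(b + 2 * t) * X a 0 \<le> (a + 2 * t) * X b 0"
  proof -
    have "(b + 2 * t) * X a 0 - (a + 2 * t) * X b 0 = (a + 2 * t) * (b + 2 * t) * (a - b) - (1 - t\<^sup>2) * (b - a)"
      unfolding XX by (simp add: algebra_simps power2_eq_square)
    also have "\<dots> \<le> 0 - 0"
      using ab a1 t t2 by (intro diff_mono mult_nonneg_nonpos mult_nonneg_nonneg) auto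
    finally show ?thesis by simp
  qed
  then have "(b + 2 * t) / X b 0 \<le> (a + 2 * t) / X a 0" using Xp by (simp add: divide_le_eq pos_le_divide_eq mult.commute field_simps)
  then have "3 * (1 - t\<^sup>2) * ((b + 2 * t) / X b 0) \<le> 3 * (1 - t\<^sup>2) * ((a + 2 * t) / X a 0)" using t2 by (intro mult_left_mono) auto
  then have "- b + 3 * (1 - t\<^sup>2) * ((b + 2 * t) / X b 0) < - a + 3 * (1 - t\<^sup>2) * ((a + 2 * t) / X a 0)" using ab by linarith
  then show ?thesis using g_eq[of \<mu>] g_eq[of \<nu>] a1 ab \<epsilon> unfolding a_def b_def t_def by simp
qed

text \<open>The threshold - 8 \<epsilon>^2 means \<kappa> >= 3, and the second term of
  \<open>g_eq\<close> contributes less than 3 because \<kappa> + 2 \<tau> <= X.\<close>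

lemma g_neg:
  assumes "\<mu> \<le> - 8 * \<epsilon>\<^sup>2"
  shows "g \<mu> < 0"
proof -
  have "\<mu> / \<epsilon>\<^sup>2 \<le> - 8" using assms \<epsilon> by (simp add: divide_le_eq)
  then have k: "3 \<le> \<kappa> \<mu>" unfolding \<kappa>_def by (intro real_le_rsqrt) simp
  define b where "b = \<kappa> \<mu>"
  define t where "t = \<tau> 0"
  have t: "0 < t" "t \<le> 1" using \<tau>_bounds[of 0] by (auto simp: t_def)
  have t2: "0 \<le> 1 - t\<^sup>2" "1 - t\<^sup>2 \<le> 1" using t by (auto simp: abs_square_le_1)
  have b: "3 \<le> b" using k by (simp add: b_def)
  have Xp: "0 < X b 0" using X_pos b by auto
  have "X b 0 - (b + 2 * t) = 3 * t\<^sup>2 + t * (3 * b - 2) + (b * (b - 1) - 1)" by (simp add: X_def t_def algebra_simps power2_eq_square)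
  moreover have "0 \<le> t * (3 * b - 2)" using t b by simp
  moreover have "3 * (3 - 1) \<le> b * (b - 1)" using b by (intro mult_mono) auto
  ultimately have "b + 2 * t \<le> X b 0" by (smt (verit) zero_le_power2)
  then have q: "(b + 2 * t) / X b 0 \<le> 1" "0 \<le> (b + 2 * t) / X b 0" using Xp b t by auto
  have "3 * (1 - t\<^sup>2) * ((b + 2 * t) / X b 0) < 3"
  proof -
    have "3 * (1 - t\<^sup>2) * ((b + 2 * t) / X b 0) \<le> 3 * (1 - t\<^sup>2) * 1" using q t2 by (intro mult_left_mono) auto
    also have "\<dots> < 3" using t by simp
    finally show ?thesis .
  qed
  then have "- b + 3 * (1 - t\<^sup>2) * ((b + 2 * t) / X b 0) < 0" using b by linarith
  then show ?thesis using g_eq[of \<mu>] k \<epsilon> unfolding b_def t_def by (simp add: mult_pos_neg)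
qed

lemma g_cont: "continuous_on {..0} g"
proof -
  have ck: "continuous_on {..0} \<kappa>" unfolding \<kappa>_def by (intro continuous_intros) (use \<epsilon> in auto)
  have "continuous_on {..0} (\<lambda>\<mu>. \<epsilon> * (- \<kappa> \<mu> + 3 * (1 - (\<tau> 0)\<^sup>2) * ((\<kappa> \<mu> + 2 * \<tau> 0) / X (\<kappa> \<mu>) 0)))"
    unfolding X_def
  proof (intro continuous_intros ck ballI)
    fix \<mu> :: real assume "\<mu> \<in> {..0}"
    then show "3 * (\<tau> 0)\<^sup>2 + 3 * \<kappa> \<mu> * \<tau> 0 + (\<kappa> \<mu>)\<^sup>2 - 1 \<noteq> 0"
      using X_pos[of 0 "\<kappa> \<mu>"] \<kappa>_props(1)[of \<mu>] unfolding X_def by simp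
  qed
  then show ?thesis
    by (rule continuous_on_eq) (use g_eq \<kappa>_props(1) in simp)
qed

text \<open>For \<kappa> = 1 the factor 1 + \<tau> cancels; the result is the ratio \<psi>'' /
  \<psi>' of the soliton tail \<psi>, whose derivative is the decaying solution at energy 0.\<close>

lemma g_zero: "g 0 = \<epsilon> * (1 - 2 * (\<tau> 0)\<^sup>2) / \<tau> 0"
proof -
  have k: "\<kappa> 0 = 1" by (simp add: \<kappa>_def)
  have t: "0 < \<tau> 0" using \<tau>_bounds[of 0] by simp
  have X1: "X 1 0 = 3 * (\<tau> 0 * (\<tau> 0 + 1))" by (simp add: X_def algebra_simps power2_eq_square)
  have "- 1 + 3 * (1 - t\<^sup>2) * ((1 + 2 * t) / (3 * (t * (t + 1)))) = (1 - 2 * t\<^sup>2) / t" if "0 < t" for t :: real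
  proof -
    have "3 * (1 - t\<^sup>2) * ((1 + 2 * t) / (3 * (t * (t + 1)))) = (1 - t) * (1 + 2 * t) / t"
      using that by (simp add: divide_simps) (simp add: algebra_simps power2_eq_square)
    then show ?thesis using that by (simp add: field_simps power2_eq_square)
  qed
  from this[OF t] show ?thesis using g_eq[of 0] unfolding k X1 by simp
qed

end

section \<open>From the state to its profiles\<close>

lemma AE_edge: "(AE x in lebesgue_on (edge j). Q x) \<longleftrightarrow> (AE x in lebesgue. x \<in> edge j \<longrightarrow> Q x)"
  by (subst AE_restrict_space_iff) (auto simp: edge_def)

lemma edge_cases: "edge j = {(if j = 0 then 0 else - pi)..} \<or> ((if j = 0 then 0 else - pi) < pi \<and> edge j = {(if j = 0 then 0 else - pi)..pi})"
  by (simp add: edge_def)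

lemma vector_derivative_edge:
  fixes f :: "real \<Rightarrow> 'a::real_normed_vector"
  assumes d: "(f has_vector_derivative D) (at x within edge j)" and x: "if j = 0 then x = 0 else x \<in> {- pi..pi}"
  shows "vector_derivative f (at x within edge j) = D"
proof (rule vector_derivative_within[OF _ d])
  show "at x within edge j \<noteq> bot"
  proof (cases "j = 0")
    case True
    then show ?thesis using x by (simp add: edge_def at_within_Ici_at_right)
  next
    case False
    then show ?thesis using x by (simp add: edge_def trivial_limit_within islimpt_Icc)
  qed
qed

lemma antimono_deriv_nonpos:
  assumes d: "(h has_real_derivative D) (at x within S)" and m: "antimono_on S h" and e: "0 < e" "{x..x + e} \<subseteq> S"
  shows "D \<le> 0"
proof (rule ccontr)
  assume "\<not> D \<le> 0"
  then obtain \<delta> where \<delta>: "0 < \<delta>" "\<And>k. 0 < k \<Longrightarrow> x + k \<in> S \<Longrightarrow> k < \<delta> \<Longrightarrow> h x < h (x + k)"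
    using has_real_derivative_pos_inc_right[OF d] by auto
  define k where "k = min (\<delta> / 2) e"
  have k: "0 < k" "k < \<delta>" "x \<in> S" "x + k \<in> S" using \<delta>(1) e by (auto simp: k_def min_def subset_iff)
  have "h (x + k) \<le> h x" using monotone_onD[OF m k(3,4)] k(1) by simp
  then show False using \<delta>(2)[OF k(1,4,2)] by simp
qed

lemma even_derivative_odd:
  fixes h h' :: "real \<Rightarrow> 'a::euclidean_space"
  assumes d: "\<And>x. x \<in> {- pi..pi} \<Longrightarrow> (h has_vector_derivative h' x) (at x within {- pi..pi})"
    and x: "x \<in> {- pi..pi}"
  shows "((\<lambda>x. h (- x)) has_vector_derivative - h' (- x)) (at x within {- pi..pi})"
proof -
  have "(uminus has_vector_derivative - 1) (at x within {- pi..pi})"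
    by (auto intro!: derivative_eq_intros simp: has_real_derivative_iff_has_vector_derivative[symmetric])
  moreover have "(h has_vector_derivative h' (- x)) (at (- x) within uminus ` {- pi..pi})"
    using d[of "- x"] x by simp
  ultimately have "((h \<circ> uminus) has_vector_derivative (- 1) *\<^sub>R h' (- x)) (at x within {- pi..pi})"
    by (rule vector_diff_chain_within)
  then show ?thesis by (simp add: o_def)
qed

text \<open>Regularity turns the state into classical profiles. By symmetry one loop suffices; on
  the half-line the vanishing energy reduces the equation to a Riccati equation for the logarithmic
  derivative. The parameter z is the squared height at the vertex divided by \<epsilon>^2.\<close>

lemma state_profiles:
  fixes \<Phi> :: "nat \<Rightarrow> real \<Rightarrow> real"
  assumes N: "2 \<le> N" and \<omega>: "\<omega> < 0" and st: "positive_single_lobe_symmetric_state N \<omega> \<Phi>"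
  obtains u p \<tau> z where "loop_profile (1 / (2 * real N)) (sqrt (- \<omega>)) z u p" "halfline_profile (sqrt (- \<omega>)) \<tau>"
    "\<tau> 0 = sqrt (1 - z)" "\<And>j x. j \<in> {1..N} \<Longrightarrow> x \<in> {- pi..pi} \<Longrightarrow> \<Phi> j x = sqrt (- \<omega>) * u \<bar>x\<bar>"
    "\<And>x. 0 \<le> x \<Longrightarrow> (\<Phi> 0 x)\<^sup>2 = - \<omega> * (1 - (\<tau> x)\<^sup>2)"
proof -
  define \<epsilon> where "\<epsilon> = sqrt (- \<omega>)"
  have \<epsilon>: "0 < \<epsilon>" "\<epsilon>\<^sup>2 = - \<omega>" using \<omega> by (auto simp: \<epsilon>_def)
  define c where "c = 1 / (2 * real N)"
  have c: "0 < c" "c \<le> 1 / 4" using N by (auto simp: c_def field_simps)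
  have NK: "\<Phi> \<in> flower_H2_NK N" and pos: "\<And>j x. j \<le> N \<Longrightarrow> x \<in> edge j \<Longrightarrow> 0 < \<Phi> j x"
    and ae: "flower_ae_eq N (\<lambda>j x. \<omega> * \<Phi> j x) (\<lambda>j x. - laplacian \<Phi> j x - 2 * (\<Phi> j x) ^ 3)"
    and sym: "\<And>i j x. i \<in> {1..N} \<Longrightarrow> j \<in> {1..N} \<Longrightarrow> x \<in> {- pi..pi} \<Longrightarrow> \<Phi> i x = \<Phi> j x"
    and even: "\<And>j x. j \<in> {1..N} \<Longrightarrow> x \<in> {- pi..pi} \<Longrightarrow> \<Phi> j (- x) = \<Phi> j x"
    and am: "\<And>j. j \<in> {1..N} \<Longrightarrow> antimono_on {0..pi} (\<Phi> j)" and am0: "antimono_on {0..} (\<Phi> 0)"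
    using st unfolding positive_single_lobe_symmetric_state_def by blast+
  have H2: "\<And>j. j \<le> N \<Longrightarrow> \<Phi> j \<in> H2_on (edge j)" "\<And>j. j \<le> N \<Longrightarrow> continuous_on (edge j) (\<Phi> j)"
    and out: "\<And>j x. j > N \<or> x \<notin> edge j \<Longrightarrow> \<Phi> j x = 0"
    and vert: "\<And>j. j \<in> {1..N} \<Longrightarrow> \<Phi> j pi = \<Phi> 0 0 \<and> \<Phi> j (- pi) = \<Phi> 0 0"
    and kirch: "(\<Sum>j=1..N. edge_deriv \<Phi> j pi - edge_deriv \<Phi> j (- pi)) = edge_deriv \<Phi> 0 0"
    using NK unfolding flower_H2_NK_def flower_H2_def by blast+
  have reg: "\<exists>u'. (\<forall>x\<in>edge j. (\<Phi> j has_real_derivative u' x) (at x within edge j)) \<and>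
     (\<forall>x\<in>edge j. (u' has_real_derivative \<epsilon>\<^sup>2 * \<Phi> j x - 2 * \<Phi> j x ^ 3) (at x within edge j)) \<and> u' \<in> L2_on (edge j)" if j: "j \<le> N" for j
  proof -
    have cc: "continuous_on (edge j) (\<lambda>x. \<epsilon>\<^sup>2 * \<Phi> j x - 2 * \<Phi> j x ^ 3)" by (intro continuous_intros H2(2) j)
    have "AE x in lebesgue_on (edge j). \<omega> * \<Phi> j x = - laplacian \<Phi> j x - 2 * \<Phi> j x ^ 3"
      using ae j by (auto simp: flower_ae_eq_def)
    then have ae: "AE x in lebesgue. x \<in> edge j \<longrightarrow> weak_deriv (edge j) (weak_deriv (edge j) (\<Phi> j)) x = \<epsilon>\<^sup>2 * \<Phi> j x - 2 * \<Phi> j x ^ 3"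
      unfolding AE_edge laplacian_def by eventually_elim (simp add: \<epsilon>(2))
    obtain u' where "\<And>x. x \<in> edge j \<Longrightarrow> (\<Phi> j has_vector_derivative u' x) (at x within edge j)"
      "\<And>x. x \<in> edge j \<Longrightarrow> (u' has_vector_derivative \<epsilon>\<^sup>2 * \<Phi> j x - 2 * \<Phi> j x ^ 3) (at x within edge j)" "u' \<in> L2_on (edge j)"
      using H2_regularity[OF edge_cases H2(1)[OF j] H2(2)[OF j] cc ae] by blast
    then show ?thesis unfolding has_real_derivative_iff_has_vector_derivative by blast
  qed
  have e1: "edge (Suc 0) = {- pi..pi}" and e0: "edge 0 = {0..}" by (auto simp: edge_def)
  define \<phi> where "\<phi> = \<Phi> 1"
  define \<psi> where "\<psi> = \<Phi> 0"
  obtain \<phi>' where "\<forall>x\<in>{- pi..pi}. (\<phi> has_real_derivative \<phi>' x) (at x within {- pi..pi})"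
    "\<forall>x\<in>{- pi..pi}. (\<phi>' has_real_derivative \<epsilon>\<^sup>2 * \<phi> x - 2 * \<phi> x ^ 3) (at x within {- pi..pi})"
    using reg[of 1] N unfolding \<phi>_def One_nat_def e1 by auto
  note \<phi>' = this[rule_format]
  obtain \<psi>' where "\<forall>x\<in>{0..}. (\<psi> has_real_derivative \<psi>' x) (at x within {0..})"
    "\<forall>x\<in>{0..}. (\<psi>' has_real_derivative \<epsilon>\<^sup>2 * \<psi> x - 2 * \<psi> x ^ 3) (at x within {0..})" "\<psi>' \<in> L2_on {0..}"
    using reg[of 0] unfolding \<psi>_def e0 by auto
  note \<psi>' = this(1,2)[rule_format, OF atLeast_iff[THEN iffD2]] this(3)
  have \<psi>L2: "\<psi> \<in> L2_on {0..}" using H2(1)[of 0] by (simp add: \<psi>_def H2_on_def H1_on_def e0)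
  have \<phi>pos: "0 < \<phi> x" if "x \<in> {- pi..pi}" for x using pos[of 1 x] N that by (simp add: \<phi>_def e1)
  have \<psi>pos: "0 < \<psi> x" if "0 \<le> x" for x using pos[of 0 x] that by (simp add: \<psi>_def e0)
  have one: "(1::nat) \<in> {1..N}" using N by simp
  have \<phi>even: "\<phi> (- x) = \<phi> x" if "x \<in> {- pi..pi}" for x using even[OF one that] by (simp add: \<phi>_def)
  have \<phi>odd: "\<phi>' (- x) = - \<phi>' x" if x: "x \<in> {- pi..pi}" for x
  proof -
    have v: "(\<phi> has_vector_derivative \<phi>' x) (at x within {- pi..pi})" if "x \<in> {- pi..pi}" for x
      using \<phi>'(1)[OF that] by (simp add: has_real_derivative_iff_has_vector_derivative)
    have "((\<lambda>x. \<phi> (- x)) has_vector_derivative - \<phi>' (- x)) (at x within {- pi..pi})"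
      by (rule even_derivative_odd[OF v x])
    then have "(\<phi> has_vector_derivative - \<phi>' (- x)) (at x within {- pi..pi})"
      by (rule has_vector_derivative_transform[rotated -1]) (use x \<phi>even in auto)
    from vector_derivative_edge[of \<phi> _ x 1, unfolded One_nat_def e1, OF this]
      vector_derivative_edge[of \<phi> _ x 1, unfolded One_nat_def e1, OF v[OF x]] x
    show ?thesis by simp
  qed
  have \<phi>'0: "\<phi>' 0 = 0" using \<phi>odd[of 0] by simp
  \<comment> \<open>All loops carry the same even function, so each contributes 2 \<phi>'(pi) to the
    Kirchhoff sum.\<close>
  have NK1: "2 * real N * \<phi>' pi = \<psi>' 0"
  proof -
    have \<Phi>1: "\<Phi> j = \<phi>" if j: "j \<in> {1..N}" for j
    proof
      fix x show "\<Phi> j x = \<phi> x"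
        using sym[OF j one, of x] out[of j x] out[of 1 x] j by (cases "x \<in> {- pi..pi}") (auto simp: \<phi>_def edge_def)
    qed
    have ed: "edge_deriv \<Phi> j x = \<phi>' x" if j: "j \<in> {1..N}" and x: "x \<in> {- pi..pi}" for j x
      unfolding \<Phi>1[OF j]
      by (rule vector_derivative_edge) (use \<phi>'(1)[OF x] j x in \<open>auto simp: edge_def has_real_derivative_iff_has_vector_derivative\<close>)
    have "edge_deriv \<Phi> 0 0 = \<psi>' 0"
      by (rule vector_derivative_edge) (use \<psi>'(1)[of 0] in \<open>auto simp: edge_def has_real_derivative_iff_has_vector_derivative \<psi>_def\<close>)
    then have "\<psi>' 0 = (\<Sum>j=1..N. edge_deriv \<Phi> j pi - edge_deriv \<Phi> j (- pi))" using kirch by simp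
    also have "\<dots> = (\<Sum>j=1..N. \<phi>' pi - \<phi>' (- pi))" by (intro sum.cong) (auto simp: ed)
    also have "\<dots> = 2 * real N * \<phi>' pi" using \<phi>odd[of pi] by simp
    finally show ?thesis by simp
  qed
  have vertex: "\<phi> pi = \<psi> 0" using vert[OF one] by (simp add: \<phi>_def \<psi>_def)

  \<comment> \<open>the energy on the half-line is a constant in \<open>L\<^sup>1\<close>, hence zero\<close>
  have \<psi>'n: "\<psi>' x \<le> 0" if "0 \<le> x" for x
    by (rule antimono_deriv_nonpos[OF \<psi>'(1)[OF that], of 1]) (use am0 that in \<open>auto simp: \<psi>_def\<close>)
  have \<psi>le: "\<psi> x \<le> \<psi> 0" if "0 \<le> x" for x using monotone_onD[OF am0, of 0 x] that by (simp add: \<psi>_def)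
  have energy0: "(\<psi>' x)\<^sup>2 = \<epsilon>\<^sup>2 * (\<psi> x)\<^sup>2 - \<psi> x ^ 4" if x: "0 \<le> x" for x
  proof -
    define e where "e x = (\<psi>' x)\<^sup>2 - \<epsilon>\<^sup>2 * (\<psi> x)\<^sup>2 + \<psi> x ^ 4" for x
    have "(e has_real_derivative 0) (at x within {0..})" if "x \<in> {0..}" for x
      unfolding e_def using that
      by (auto intro!: derivative_eq_intros \<psi>'(1,2) simp: algebra_simps power2_eq_square power3_eq_cube)
    then obtain k where k: "\<And>x. x \<in> {0..} \<Longrightarrow> e x = k"
      using has_field_derivative_zero_constant[of "{0::real..}" e] by auto
    define b where "b x = (norm (\<psi>' x))\<^sup>2 + (\<epsilon>\<^sup>2 + (\<psi> 0)\<^sup>2) *\<^sub>R (norm (\<psi> x))\<^sup>2" for x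
    have ib: "set_integrable lebesgue {0..} b"
      unfolding b_def
      by (rule set_integral_add(1)[OF L2_norm_square_integrable[OF \<psi>'(3)] set_integrable_scaleR_right[OF L2_norm_square_integrable[OF \<psi>L2]]])
    have kb: "\<bar>k\<bar> \<le> b x" if x: "0 \<le> x" for x
    proof -
      have "\<psi> x ^ 4 = (\<psi> x)\<^sup>2 * (\<psi> x)\<^sup>2" by (simp add: power4_eq_xxxx power2_eq_square)
      also have "\<dots> \<le> (\<psi> 0)\<^sup>2 * (\<psi> x)\<^sup>2"
        using \<psi>le[OF x] \<psi>pos[OF x] by (intro mult_right_mono power_mono) auto
      finally have q: "\<psi> x ^ 4 \<le> (\<psi> 0)\<^sup>2 * (\<psi> x)\<^sup>2" .
      have "0 \<le> \<psi> x ^ 4" "0 \<le> (\<psi>' x)\<^sup>2" "0 \<le> \<epsilon>\<^sup>2 * (\<psi> x)\<^sup>2" by auto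
      moreover have "k = (\<psi>' x)\<^sup>2 - \<epsilon>\<^sup>2 * (\<psi> x)\<^sup>2 + \<psi> x ^ 4" using k[of x] x by (simp add: e_def)
      moreover have "b x = (\<psi>' x)\<^sup>2 + \<epsilon>\<^sup>2 * (\<psi> x)\<^sup>2 + (\<psi> 0)\<^sup>2 * (\<psi> x)\<^sup>2" by (simp add: b_def algebra_simps)
      ultimately show ?thesis using q by linarith
    qed
    have "set_integrable lebesgue {0::real..} (\<lambda>x. k)"
      unfolding set_integrable_def
    proof (rule Bochner_Integration.integrable_bound[OF ib[unfolded set_integrable_def]])
      show "(\<lambda>x::real. indicator {0..} x *\<^sub>R k) \<in> borel_measurable lebesgue"
        by (intro borel_measurable_scaleR borel_measurable_indicator borel_measurable_const) simp
      show "AE x::real in lebesgue. norm (indicator {0..} x *\<^sub>R k) \<le> norm (indicator {0..} x *\<^sub>R b x)"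
        using kb by (intro AE_I2) (fastforce simp: indicator_def)
    qed
    then have "k = 0" by (rule const_integrable_halfline)
    then show ?thesis using k[of x] x by (simp add: e_def)
  qed
  \<comment> \<open>The negative logarithmic derivative of the tail in units of \<epsilon>;
    vanishing energy becomes \<psi>^2 = \<epsilon>^2 (1 - \<tau>^2).\<close>
  define \<tau> where "\<tau> x = - \<psi>' x / (\<epsilon> * \<psi> x)" for x
  have \<tau>sq: "(\<psi> x)\<^sup>2 = \<epsilon>\<^sup>2 * (1 - (\<tau> x)\<^sup>2)" if x: "0 \<le> x" for x
  proof -
    have "(\<tau> x)\<^sup>2 = (\<epsilon>\<^sup>2 * (\<psi> x)\<^sup>2 - \<psi> x ^ 4) / (\<epsilon>\<^sup>2 * (\<psi> x)\<^sup>2)"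
      unfolding \<tau>_def power_divide power2_minus energy0[OF x] power_mult_distrib ..
    also have "\<dots> = 1 - (\<psi> x)\<^sup>2 / \<epsilon>\<^sup>2" using \<epsilon>(1) \<psi>pos[OF x] by (simp add: diff_divide_distrib power4_eq_xxxx power2_eq_square)
    finally show ?thesis using \<epsilon>(1) by (simp add: field_simps)
  qed
  have \<tau>nn: "0 \<le> \<tau> x" if "0 \<le> x" for x unfolding \<tau>_def using \<psi>'n[OF that] \<psi>pos[OF that] \<epsilon>(1) by (simp add: divide_nonpos_pos)
  have \<tau>d: "(\<tau> has_real_derivative \<epsilon> * (1 - (\<tau> x)\<^sup>2)) (at x within {0..})" if x: "0 \<le> x" for x
  proof -
    have ne: "\<epsilon> * \<psi> x \<noteq> 0" using \<psi>pos[OF x] \<epsilon>(1) by simp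
    have "(\<tau> has_real_derivative (- (\<epsilon>\<^sup>2 * \<psi> x - 2 * \<psi> x ^ 3) * (\<epsilon> * \<psi> x) - (- \<psi>' x) * (\<epsilon> * \<psi>' x)) / ((\<epsilon> * \<psi> x) * (\<epsilon> * \<psi> x))) (at x within {0..})"
      unfolding \<tau>_def by (rule DERIV_divide[OF DERIV_minus[OF \<psi>'(2)[OF x]] DERIV_cmult[OF \<psi>'(1)[OF x]] ne])
    moreover have "- (\<epsilon>\<^sup>2 * \<psi> x - 2 * \<psi> x ^ 3) * (\<epsilon> * \<psi> x) - (- \<psi>' x) * (\<epsilon> * \<psi>' x) = \<epsilon> * (\<psi> x)\<^sup>2 * (\<psi> x)\<^sup>2"
    proof -
      have "- (\<epsilon>\<^sup>2 * \<psi> x - 2 * \<psi> x ^ 3) * (\<epsilon> * \<psi> x) - (- \<psi>' x) * (\<epsilon> * \<psi>' x) = - \<epsilon> * (\<epsilon>\<^sup>2 * (\<psi> x)\<^sup>2 - 2 * \<psi> x ^ 4) + \<epsilon> * (\<psi>' x)\<^sup>2"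
        by (simp add: algebra_simps power2_eq_square power3_eq_cube power4_eq_xxxx)
      then show ?thesis unfolding energy0[OF x] by (simp add: algebra_simps power2_eq_square power4_eq_xxxx)
    qed
    moreover have "\<epsilon> * (\<psi> x)\<^sup>2 * (\<psi> x)\<^sup>2 / ((\<epsilon> * \<psi> x) * (\<epsilon> * \<psi> x)) = \<epsilon> * (1 - (\<tau> x)\<^sup>2)"
    proof -
      have "\<epsilon> * (\<psi> x)\<^sup>2 * (\<psi> x)\<^sup>2 / ((\<epsilon> * \<psi> x) * (\<epsilon> * \<psi> x)) = \<epsilon> * ((\<psi> x)\<^sup>2 / \<epsilon>\<^sup>2)"
        using ne by (simp add: field_simps power2_eq_square)
      then show ?thesis unfolding \<tau>sq[OF x] using \<epsilon>(1) by simp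
    qed
    ultimately show ?thesis by (simp only:)
  qed
  define z where "z = (\<psi> 0)\<^sup>2 / \<epsilon>\<^sup>2"
  have \<tau>0sq: "(\<tau> 0)\<^sup>2 = 1 - z" using \<tau>sq[of 0] \<epsilon>(1) by (simp add: z_def)
  have \<phi>sub: "(\<phi> has_real_derivative \<phi>' x) (at x within {0..pi})"
    "(\<phi>' has_real_derivative \<epsilon>\<^sup>2 * \<phi> x - 2 * \<phi> x ^ 3) (at x within {0..pi})" if "x \<in> {0..pi}" for x
    using \<phi>'[of x] that by (auto intro: DERIV_subset)
  have energy1: "(\<phi>' x)\<^sup>2 - \<epsilon>\<^sup>2 * (\<phi> x)\<^sup>2 + \<phi> x ^ 4 = (\<phi>' pi)\<^sup>2 - \<epsilon>\<^sup>2 * (\<phi> pi)\<^sup>2 + \<phi> pi ^ 4" if x: "x \<in> {0..pi}" for x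
  proof -
    define e where "e x = (\<phi>' x)\<^sup>2 - \<epsilon>\<^sup>2 * (\<phi> x)\<^sup>2 + \<phi> x ^ 4" for x
    have "(e has_real_derivative 0) (at x within {0..pi})" if "x \<in> {0..pi}" for x
      unfolding e_def
      by (rule derivative_eq_intros \<phi>sub[OF that] refl)+ (simp add: algebra_simps power2_eq_square power3_eq_cube)
    then obtain k where k: "\<And>x. x \<in> {0..pi} \<Longrightarrow> e x = k"
      using has_field_derivative_zero_constant[of "{0..pi}" e] by auto
    show ?thesis using k[OF x] k[of pi] by (simp add: e_def)
  qed
  have \<phi>mono: "\<phi> y \<le> \<phi> x" if "0 \<le> x" "x \<le> y" "y \<le> pi" for x y
    using monotone_onD[OF am[OF one], of x y] that by (simp add: \<phi>_def)
  \<comment> \<open>If z = 1, the slope vanishes at both ends of the half-loop, and energy and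
    monotonicity force \<phi> to be the constant \<epsilon>, which does not solve the profile
    equation.\<close>
  have z1: "z < 1"
  proof (rule ccontr)
    assume "\<not> z < 1"
    moreover have "z \<le> 1" using \<tau>0sq zero_le_power2[of "\<tau> 0"] by linarith
    ultimately have "z = 1" by simp
    then have q: "(\<psi> 0)\<^sup>2 = \<epsilon>\<^sup>2" using \<epsilon>(1) by (simp add: z_def field_simps)
    then have "\<tau> 0 = 0" using \<tau>0sq \<open>z = 1\<close> by simp
    then have "\<psi>' 0 = 0" using \<epsilon>(1) \<psi>pos[of 0] by (simp add: \<tau>_def)
    then have p0: "\<phi>' pi = 0" using NK1 N by simp
    have qp: "\<phi> pi = \<epsilon>" using q \<epsilon>(1) \<psi>pos[of 0] by (simp add: vertex power2_eq_iff)
    have "\<phi> 0 ^ 4 = \<epsilon>\<^sup>2 * (\<phi> 0)\<^sup>2" using energy1[of 0] by (simp add: p0 qp \<phi>'0 power4_eq_xxxx power2_eq_square)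
    then have "(\<phi> 0)\<^sup>2 = \<epsilon>\<^sup>2" using \<phi>pos[of 0] by (simp add: power4_eq_xxxx power2_eq_square)
    then have q0: "\<phi> 0 = \<epsilon>" using \<epsilon>(1) \<phi>pos[of 0] by (simp add: power2_eq_iff)
    have const: "\<phi> x = \<epsilon>" if "x \<in> {0..pi}" for x using \<phi>mono[of 0 x] \<phi>mono[of x pi] that q0 qp by simp
    have "- \<phi>' 0 < - \<phi>' pi"
    proof (rule within_increasing[OF pi_gt_zero])
      show "((\<lambda>x. - \<phi>' x) has_real_derivative - (\<epsilon>\<^sup>2 * \<phi> x - 2 * \<phi> x ^ 3)) (at x within {0..pi})" if "x \<in> {0..pi}" for x
        by (rule DERIV_minus[OF \<phi>sub(2)[OF that]])
      show "0 < - (\<epsilon>\<^sup>2 * \<phi> x - 2 * \<phi> x ^ 3)" if "x \<in> {0<..<pi}" for x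
        using const[of x] that \<epsilon>(1) by (simp add: power2_eq_square power3_eq_cube)
    qed
    then show False using p0 \<phi>'0 by simp
  qed
  have \<tau>0: "\<tau> 0 = sqrt (1 - z)" using \<tau>0sq \<tau>nn[of 0] by (metis order_refl real_sqrt_unique)
  have \<tau>pos: "0 < \<tau> x" if x: "0 \<le> x" for x
  proof -
    have "\<tau> 0 \<le> \<tau> x"
    proof (rule within_nondecreasing[OF x])
      show "(\<tau> has_real_derivative \<epsilon> * (1 - (\<tau> y)\<^sup>2)) (at y within {0..x})" if "y \<in> {0..x}" for y
        using \<tau>d[of y] that by (auto intro: DERIV_subset)
      show "0 \<le> \<epsilon> * (1 - (\<tau> y)\<^sup>2)" if "y \<in> {0<..<x}" for y
      proof -
        have "0 \<le> \<epsilon>\<^sup>2 * (1 - (\<tau> y)\<^sup>2)" using \<tau>sq[of y] that zero_le_power2[of "\<psi> y"] by simp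
        then show ?thesis using \<epsilon>(1) by (simp add: zero_le_mult_iff)
      qed
    qed
    moreover have "0 < \<tau> 0" unfolding \<tau>0 using z1 by simp
    ultimately show ?thesis by simp
  qed
  have half: "halfline_profile \<epsilon> \<tau>"
  proof
    show "\<tau> x \<le> 1" if "0 \<le> x" for x
    proof -
      have "0 < (\<psi> x)\<^sup>2" using \<psi>pos[OF that] by simp
      then have "0 < \<epsilon>\<^sup>2 * (1 - (\<tau> x)\<^sup>2)" unfolding \<tau>sq[OF that] .
      then have "(\<tau> x)\<^sup>2 < 1" using \<epsilon>(1) by (simp add: zero_less_mult_iff)
      then show ?thesis by (simp add: abs_square_less_1)
    qed
  qed (use \<epsilon> \<tau>d \<tau>pos in auto)
  define u where "u x = \<phi> x / \<epsilon>" for x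
  define p where "p x = \<phi>' x / \<epsilon>\<^sup>2" for x
  have up: "u pi = \<psi> 0 / \<epsilon>" by (simp add: u_def vertex)
  have ppi: "p pi = - (c * u pi * sqrt (1 - z))"
  proof -
    have "\<psi>' 0 = - (\<epsilon> * \<psi> 0 * sqrt (1 - z))" using \<tau>0 \<epsilon>(1) \<psi>pos[of 0] by (simp add: \<tau>_def field_simps)
    then have "\<phi>' pi = - (c * (\<epsilon> * \<psi> 0 * sqrt (1 - z)))" using NK1 N by (simp add: c_def field_simps)
    then show ?thesis unfolding p_def up using \<epsilon>(1) by (simp add: field_simps power2_eq_square)
  qed
  have loop: "loop_profile c \<epsilon> z u p"
  proof
    show "0 < c" "c \<le> 1 / 4" "0 < \<epsilon>" by (fact c \<epsilon>)+
    fix x assume x: "x \<in> {0..pi}"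
    show "(u has_real_derivative \<epsilon> * p x) (at x within {0..pi})"
      unfolding u_def p_def by (rule DERIV_cong[OF DERIV_cdivide[OF \<phi>sub(1)[OF x]]]) (use \<epsilon>(1) in \<open>simp add: power2_eq_square\<close>)
    show "(p has_real_derivative \<epsilon> * (u x - 2 * u x ^ 3)) (at x within {0..pi})"
      unfolding u_def p_def by (rule DERIV_cong[OF DERIV_cdivide[OF \<phi>sub(2)[OF x]]])
        (use \<epsilon>(1) in \<open>simp add: field_simps power2_eq_square power3_eq_cube\<close>)
    show "0 < u x" using \<phi>pos[of x] x \<epsilon>(1) by (simp add: u_def)
    \<comment> \<open>At pi there is no room for a right difference quotient inside the half-loop;
      there the Kirchhoff value gives the sign.\<close>
    show "p x \<le> 0"
    proof (cases "x = pi")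
      case True
      have "0 < u pi" using up \<psi>pos[of 0] \<epsilon>(1) by simp
      then show ?thesis unfolding True ppi using c z1 by simp
    next
      case False
      have "\<phi>' x \<le> 0"
        by (rule antimono_deriv_nonpos[OF \<phi>sub(1)[OF x], of "pi - x"]) (use am[OF one] x False in \<open>auto simp: \<phi>_def\<close>)
      then show ?thesis by (simp add: p_def divide_nonpos_nonneg)
    qed
  next
    show "p 0 = 0" by (simp add: p_def \<phi>'0)
    show "z = (u pi)\<^sup>2" by (simp add: up z_def power_divide)
  qed (use z1 ppi in auto)
  show ?thesis
  proof (rule that[of z u p \<tau>])
    show "loop_profile (1 / (2 * real N)) (sqrt (- \<omega>)) z u p" using loop by (simp add: c_def \<epsilon>_def)
    show "halfline_profile (sqrt (- \<omega>)) \<tau>" using half by (simp add: \<epsilon>_def)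
    show "\<tau> 0 = sqrt (1 - z)" by (fact \<tau>0)
    show "\<Phi> j x = sqrt (- \<omega>) * u \<bar>x\<bar>" if "j \<in> {1..N}" "x \<in> {- pi..pi}" for j x
      using sym[OF that(1) one that(2)] \<phi>even[OF that(2)] \<epsilon>(1) by (simp add: u_def \<phi>_def \<epsilon>_def[symmetric] abs_real_def)
    show "(\<Phi> 0 x)\<^sup>2 = - \<omega> * (1 - (\<tau> x)\<^sup>2)" if "0 \<le> x" for x
      using \<tau>sq[OF that] \<epsilon>(2) by (simp add: \<psi>_def)
  qed
qed

section \<open>Eigenspaces\<close>

lemma lin_sol_cong:
  assumes "lin_sol S q y y'" "\<And>x. x \<in> S \<Longrightarrow> q x = r x"
  shows "lin_sol S r y y'"
  using assms by (simp add: lin_sol_def)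

lemma lin_sol_reflect:
  assumes y: "lin_sol {- pi..pi} q y y'" and q: "\<And>x. x \<in> {- pi..pi} \<Longrightarrow> q (- x) = q x"
  shows "lin_sol {- pi..pi} q (\<lambda>x. y (- x)) (\<lambda>x. - y' (- x))"
  unfolding lin_sol_def
proof (intro ballI conjI)
  fix x assume x: "x \<in> {- pi..pi}"
  show "((\<lambda>x. y (- x)) has_real_derivative - y' (- x)) (at x within {- pi..pi})"
    unfolding has_real_derivative_iff_has_vector_derivative
    by (rule even_derivative_odd[OF _ x]) (use lin_solD(1)[OF y] in \<open>simp add: has_real_derivative_iff_has_vector_derivative\<close>)
  have "((\<lambda>x. y' (- x)) has_real_derivative - (q (- x) * y (- x))) (at x within {- pi..pi})"
    unfolding has_real_derivative_iff_has_vector_derivative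
    by (rule even_derivative_odd[OF _ x, where h' = "\<lambda>x. q x * y x"]) (use lin_solD(2)[OF y] in \<open>simp add: has_real_derivative_iff_has_vector_derivative\<close>)
  from DERIV_minus[OF this] show "((\<lambda>x. - y' (- x)) has_real_derivative q x * y (- x)) (at x within {- pi..pi})"
    using q[OF x] by simp
qed

lemma lin_sol_eq:
  assumes ab: "a < b" and q: "continuous_on {a..b} q" and y: "lin_sol {a..b} q y y'" and w: "lin_sol {a..b} q w w'"
    and c: "c \<in> {a..b}" "y c = w c" "y' c = w' c" and x: "x \<in> {a..b}"
  shows "y x = w x" "y' x = w' x"
  using lin_sol_unique[OF ab q lin_sol_comb[OF y w, of 1 "- 1"] c(1) _ _ x] c by auto

text \<open>Real and imaginary parts solve the same real equation, so complex solutions are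
  combinations of the real fundamental system with complex coefficients.\<close>

lemma complex_lin_sol:
  fixes \<psi> \<psi>' :: "real \<Rightarrow> complex"
  assumes ab: "a < b" and q: "continuous_on {a..b} q" and s: "lin_sol {a..b} q s s'" and t: "lin_sol {a..b} q t t'"
    and c: "c \<in> {a..b}" "s c = 1" "s' c = 0" "t c = 0" "t' c = 1"
    and d: "\<And>x. x \<in> {a..b} \<Longrightarrow> (\<psi> has_vector_derivative \<psi>' x) (at x within {a..b})"
    and d': "\<And>x. x \<in> {a..b} \<Longrightarrow> (\<psi>' has_vector_derivative q x *\<^sub>R \<psi> x) (at x within {a..b})"
    and x: "x \<in> {a..b}"
  shows "\<psi> x = s x *\<^sub>R \<psi> c + t x *\<^sub>R \<psi>' c" "\<psi>' x = s' x *\<^sub>R \<psi> c + t' x *\<^sub>R \<psi>' c"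
proof -
  have re: "lin_sol {a..b} q (\<lambda>x. Re (\<psi> x)) (\<lambda>x. Re (\<psi>' x))"
    unfolding lin_sol_def has_real_derivative_iff_has_vector_derivative
    using bounded_linear.has_vector_derivative[OF bounded_linear_Re d] bounded_linear.has_vector_derivative[OF bounded_linear_Re d'] by simp
  have im: "lin_sol {a..b} q (\<lambda>x. Im (\<psi> x)) (\<lambda>x. Im (\<psi>' x))"
    unfolding lin_sol_def has_real_derivative_iff_has_vector_derivative
    using bounded_linear.has_vector_derivative[OF bounded_linear_Im d] bounded_linear.has_vector_derivative[OF bounded_linear_Im d'] by simp
  note R = lin_sol_eq[OF ab q re lin_sol_comb[OF s t, of "Re (\<psi> c)" "Re (\<psi>' c)"] c(1) _ _ x]
  note I = lin_sol_eq[OF ab q im lin_sol_comb[OF s t, of "Im (\<psi> c)" "Im (\<psi>' c)"] c(1) _ _ x]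
  show "\<psi> x = s x *\<^sub>R \<psi> c + t x *\<^sub>R \<psi>' c" "\<psi>' x = s' x *\<^sub>R \<psi> c + t' x *\<^sub>R \<psi>' c"
    using R I c by (auto intro!: complex_eqI simp: mult.commute)
qed

section \<open>Explicit eigenfunctions and the vertex conditions\<close>

locale flower_state =
  loop: loop_profile "1 / (2 * real N)" \<epsilon> z u p + half: halfline_profile \<epsilon> \<tau>
  for N :: nat and \<epsilon> z :: real and u p \<tau> :: "real \<Rightarrow> real" +
  fixes \<omega> :: real and \<Phi> :: "nat \<Rightarrow> real \<Rightarrow> real"
  assumes N: "2 \<le> N" and \<omega>: "- \<omega> = \<epsilon>\<^sup>2" and \<tau>0: "\<tau> 0 = sqrt (1 - z)"
    and loops: "\<And>j x. j \<in> {1..N} \<Longrightarrow> x \<in> {- pi..pi} \<Longrightarrow> \<Phi> j x = \<epsilon> * u \<bar>x\<bar>"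
    and halfline: "\<And>x. 0 \<le> x \<Longrightarrow> (\<Phi> 0 x)\<^sup>2 = - \<omega> * (1 - (\<tau> x)\<^sup>2)"
begin

definition Vf :: "real \<Rightarrow> real" where "Vf x = loop.V \<bar>x\<bar>"

lemma Vf_cont: "continuous_on {- pi..pi} (\<lambda>x. Vf x - \<mu>)"
  unfolding Vf_def loop.V_def
  by (intro continuous_intros continuous_on_compose2[OF loop.cont_u, of _ abs]) auto

text \<open>One choice yields a solution together with its derivative; the data (1, 0) give the even
  and (0, 1) the odd solution about the midpoint of the loop.\<close>

definition sols :: "real \<Rightarrow> real \<Rightarrow> real \<Rightarrow> (real \<Rightarrow> real) \<times> (real \<Rightarrow> real)" where
  "sols A B \<mu> = (SOME q. lin_sol {- pi..pi} (\<lambda>x. Vf x - \<mu>) (fst q) (snd q) \<and> fst q 0 = A \<and> snd q 0 = B)"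

abbreviation s :: "real \<Rightarrow> real \<Rightarrow> real" where "s \<mu> \<equiv> fst (sols 1 0 \<mu>)"
abbreviation s' :: "real \<Rightarrow> real \<Rightarrow> real" where "s' \<mu> \<equiv> snd (sols 1 0 \<mu>)"
abbreviation t :: "real \<Rightarrow> real \<Rightarrow> real" where "t \<mu> \<equiv> fst (sols 0 1 \<mu>)"
abbreviation t' :: "real \<Rightarrow> real \<Rightarrow> real" where "t' \<mu> \<equiv> snd (sols 0 1 \<mu>)"

lemma sols: "lin_sol {- pi..pi} (\<lambda>x. Vf x - \<mu>) (fst (sols A B \<mu>)) (snd (sols A B \<mu>))" "fst (sols A B \<mu>) 0 = A" "snd (sols A B \<mu>) 0 = B"
proof -
  have lt: "- pi < pi" and mem: "0 \<in> {- pi..pi}" by auto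
  obtain y y' where "lin_sol {- pi..pi} (\<lambda>x. Vf x - \<mu>) y y'" "y 0 = A" "y' 0 = B"
    using linear_ode[OF lt Vf_cont mem] by blast
  then have "\<exists>q. lin_sol {- pi..pi} (\<lambda>x. Vf x - \<mu>) (fst q) (snd q) \<and> fst q 0 = A \<and> snd q 0 = B"
    by (intro exI[of _ "(y, y')"]) simp
  from someI_ex[OF this] show "lin_sol {- pi..pi} (\<lambda>x. Vf x - \<mu>) (fst (sols A B \<mu>)) (snd (sols A B \<mu>))"
    "fst (sols A B \<mu>) 0 = A" "snd (sols A B \<mu>) 0 = B" unfolding sols_def by auto
qed

lemma sols_reflect:
  assumes x: "x \<in> {- pi..pi}"
  shows "s \<mu> (- x) = s \<mu> x" "s' \<mu> (- x) = - s' \<mu> x" "t \<mu> (- x) = - t \<mu> x"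
proof -
  have lt: "- pi < pi" and mem: "0 \<in> {- pi..pi}" by auto
  have q: "Vf (- x) - \<mu> = Vf x - \<mu>" for x by (simp add: Vf_def)
  have "s \<mu> x = s \<mu> (- x)"
    by (rule lin_sol_eq(1)[OF lt Vf_cont sols(1) lin_sol_reflect[OF sols(1) q] mem _ _ x]) (simp_all add: sols)
  then show "s \<mu> (- x) = s \<mu> x" by simp
  have "s' \<mu> x = - s' \<mu> (- x)"
    by (rule lin_sol_eq(2)[OF lt Vf_cont sols(1) lin_sol_reflect[OF sols(1) q] mem _ _ x]) (simp_all add: sols)
  then show "s' \<mu> (- x) = - s' \<mu> x" by simp
  have "0 * t \<mu> x + (- 1) * t \<mu> x = t \<mu> (- x)"
    by (rule lin_sol_eq(1)[OF lt Vf_cont lin_sol_comb[OF sols(1) sols(1)] lin_sol_reflect[OF sols(1) q] mem _ _ x]) (simp_all add: sols)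
  then show "t \<mu> (- x) = - t \<mu> x" by simp
qed

lemma restrict_sol: "lin_sol {0..pi} (\<lambda>x. loop.V x - \<mu>) (fst (sols A B \<mu>)) (snd (sols A B \<mu>))"
  by (rule lin_sol_cong[OF lin_sol_subset[OF sols(1)]]) (auto simp: Vf_def)

lemma V_cont: "continuous_on {0..pi} loop.V"
  unfolding loop.V_def by (intro continuous_intros loop.cont_u)

sublocale lp: loop_problem pi loop.V "\<lambda>x. - p x" "\<lambda>x. - (\<epsilon> * (u x - 2 * u x ^ 3))" s s'
  by unfold_locales (use V_cont loop.translation_sol loop.p0 loop.p_neg restrict_sol sols in auto)

text \<open>\<open>positive_after_zero\<close> at x1 = 0. An odd part of an eigenfunction would
  break continuity at the vertex, since its values at pi and - pi would be opposite and
  nonzero.\<close>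

lemma t_end_pos: "\<mu> \<le> 0 \<Longrightarrow> 0 < t \<mu> pi"
  using lp.positive_after_zero[OF _ restrict_sol[of \<mu> 0 1], of 0 pi] by (simp add: sols)

definition Psi :: "real \<Rightarrow> (nat \<Rightarrow> complex) \<Rightarrow> complex \<Rightarrow> nat \<Rightarrow> real \<Rightarrow> complex" where
  "Psi \<mu> C k j x = (if j = 0 then (if 0 \<le> x then half.f (half.\<kappa> \<mu>) x *\<^sub>R k else 0)
     else if j \<le> N \<and> x \<in> {- pi..pi} then s \<mu> x *\<^sub>R C j else 0)"

text \<open>Continuity and Kirchhoff's condition for \<open>Psi\<close>; s' is odd, so the two ends
  of a loop contribute 2 s'(pi).\<close>

definition vertex_conditions :: "real \<Rightarrow> (nat \<Rightarrow> complex) \<Rightarrow> complex \<Rightarrow> bool" where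
  "vertex_conditions \<mu> C k \<longleftrightarrow> (\<forall>j\<in>{1..N}. s \<mu> pi *\<^sub>R C j = half.f (half.\<kappa> \<mu>) 0 *\<^sub>R k) \<and>
     (2 * s' \<mu> pi) *\<^sub>R (\<Sum>j=1..N. C j) = half.f' (half.\<kappa> \<mu>) 0 *\<^sub>R k"

text \<open>The coefficient in \<Psi>'' = pot \<Psi>, equivalent to the eigenvalue equation for
  \<mu> \<le> 0. On the half-line it is written with \<kappa> to match the equation of the Jost
  solution.\<close>

definition pot :: "real \<Rightarrow> nat \<Rightarrow> real \<Rightarrow> real" where
  "pot \<mu> j x = (if j = 0 then \<epsilon>\<^sup>2 * ((half.\<kappa> \<mu>)\<^sup>2 - 6 * (1 - (\<tau> x)\<^sup>2)) else Vf x - \<mu>)"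

lemma pot_eq:
  assumes "\<mu> \<le> 0" "j \<le> N" "x \<in> edge j"
  shows "pot \<mu> j x = - \<omega> - 6 * (\<Phi> j x)\<^sup>2 - \<mu>"
proof (cases "j = 0")
  case True
  then have "0 \<le> x" using assms by (simp add: edge_def)
  then show ?thesis unfolding True pot_def using half.\<kappa>_props(2)[OF assms(1)] halfline[of x] by (simp add: \<omega> algebra_simps)
next
  case False
  then have "\<Phi> j x = \<epsilon> * u \<bar>x\<bar>" using loops[of j x] assms by (simp add: edge_def)
  then show ?thesis using False by (simp add: pot_def Vf_def loop.V_def \<omega> power_mult_distrib algebra_simps)
qed

lemma pot_cont: "continuous_on (edge j) (pot \<mu> j)"
proof (cases "j = 0")
  case True
  have "continuous_on {0..} (\<lambda>x. \<epsilon>\<^sup>2 * ((half.\<kappa> \<mu>)\<^sup>2 - 6 * (1 - (\<tau> x)\<^sup>2)))" by (intro continuous_intros half.\<tau>_cont)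
  then show ?thesis using True by (simp add: pot_def[abs_def] edge_def)
next
  case False
  then show ?thesis using Vf_cont by (simp add: pot_def[abs_def] edge_def)
qed

lemma eigen_equation:
  assumes \<mu>: "\<mu> \<le> 0" and j: "j \<le> N"
  shows "(AE x in lebesgue_on (edge j). linearized_op \<omega> \<Phi> \<Psi> j x = of_real \<mu> * \<Psi> j x) \<longleftrightarrow>
    (AE x in lebesgue. x \<in> edge j \<longrightarrow> weak_deriv (edge j) (weak_deriv (edge j) (\<Psi> j)) x = pot \<mu> j x *\<^sub>R \<Psi> j x)"
  unfolding AE_edge
proof (rule AE_cong, rule imp_cong[OF refl])
  fix x assume x: "x \<in> edge j"
  have gen: "(- W - a - b = m) = (W = - a - b - m)" for W a b m :: complex
    by (auto simp: complex_eq_iff)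
  have e: "pot \<mu> j x *\<^sub>R \<Psi> j x = - (of_real \<omega> * \<Psi> j x) - 6 * (of_real (\<Phi> j x))\<^sup>2 * \<Psi> j x - of_real \<mu> * \<Psi> j x"
    unfolding pot_eq[OF \<mu> j x] by (simp add: scaleR_conv_of_real algebra_simps)
  show "(linearized_op \<omega> \<Phi> \<Psi> j x = of_real \<mu> * \<Psi> j x) = (weak_deriv (edge j) (weak_deriv (edge j) (\<Psi> j)) x = pot \<mu> j x *\<^sub>R \<Psi> j x)"
    unfolding linearized_op_def laplacian_def e by (rule gen)
qed

text \<open>Regularity makes an eigenfunction classical; on a loop it is a combination of s and t,
  and on the half-line \<open>decaying_unique\<close> leaves one constant.\<close>

lemma eigenspace_subset:
  assumes \<mu>: "\<mu> \<le> 0" and \<Psi>: "\<Psi> \<in> eigenspace N \<omega> \<Phi> \<mu>"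
  shows "\<exists>C k. \<Psi> = Psi \<mu> C k \<and> vertex_conditions \<mu> C k"
proof -
  have H2: "\<And>j. j \<le> N \<Longrightarrow> \<Psi> j \<in> H2_on (edge j)" "\<And>j. j \<le> N \<Longrightarrow> continuous_on (edge j) (\<Psi> j)"
    and out: "\<And>j x. j > N \<or> x \<notin> edge j \<Longrightarrow> \<Psi> j x = 0"
    and vert: "\<And>j. j \<in> {1..N} \<Longrightarrow> \<Psi> j pi = \<Psi> 0 0 \<and> \<Psi> j (- pi) = \<Psi> 0 0"
    and kirch: "(\<Sum>j=1..N. edge_deriv \<Psi> j pi - edge_deriv \<Psi> j (- pi)) = edge_deriv \<Psi> 0 0"
    and ae: "flower_ae_eq N (linearized_op \<omega> \<Phi> \<Psi>) (\<lambda>j x. of_real \<mu> * \<Psi> j x)"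
    using \<Psi> unfolding eigenspace_def flower_H2_NK_def flower_H2_def by blast+
  have reg: "\<exists>\<psi>'. (\<forall>x\<in>edge j. (\<Psi> j has_vector_derivative \<psi>' x) (at x within edge j)) \<and>
      (\<forall>x\<in>edge j. (\<psi>' has_vector_derivative pot \<mu> j x *\<^sub>R \<Psi> j x) (at x within edge j)) \<and> \<psi>' \<in> L2_on (edge j)" if j: "j \<le> N" for j
  proof -
    have cc: "continuous_on (edge j) (\<lambda>x. pot \<mu> j x *\<^sub>R \<Psi> j x)" by (intro continuous_intros pot_cont H2(2) j)
    have e: "AE x in lebesgue. x \<in> edge j \<longrightarrow> weak_deriv (edge j) (weak_deriv (edge j) (\<Psi> j)) x = pot \<mu> j x *\<^sub>R \<Psi> j x"
      using ae j unfolding flower_ae_eq_def eigen_equation[OF \<mu> j, symmetric] by blast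
    obtain \<psi>' where "\<And>x. x \<in> edge j \<Longrightarrow> (\<Psi> j has_vector_derivative \<psi>' x) (at x within edge j)"
      "\<And>x. x \<in> edge j \<Longrightarrow> (\<psi>' has_vector_derivative pot \<mu> j x *\<^sub>R \<Psi> j x) (at x within edge j)" "\<psi>' \<in> L2_on (edge j)"
      using H2_regularity[OF edge_cases H2(1)[OF j] H2(2)[OF j] cc e] by blast
    then show ?thesis by blast
  qed
  have "\<exists>\<psi>'. \<forall>j\<le>N. (\<forall>x\<in>edge j. (\<Psi> j has_vector_derivative \<psi>' j x) (at x within edge j)) \<and>
      (\<forall>x\<in>edge j. (\<psi>' j has_vector_derivative pot \<mu> j x *\<^sub>R \<Psi> j x) (at x within edge j)) \<and> \<psi>' j \<in> L2_on (edge j)"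
    using reg by (intro choice) blast
  then obtain \<psi>' where \<psi>': "\<forall>j\<le>N. (\<forall>x\<in>edge j. (\<Psi> j has_vector_derivative \<psi>' j x) (at x within edge j)) \<and>
      (\<forall>x\<in>edge j. (\<psi>' j has_vector_derivative pot \<mu> j x *\<^sub>R \<Psi> j x) (at x within edge j)) \<and> \<psi>' j \<in> L2_on (edge j)" ..
  have lt: "- pi < pi" and mem: "0 \<in> {- pi..pi}" and mpi: "pi \<in> {- pi..pi}" "- pi \<in> {- pi..pi}" by auto
  define C where "C j = \<Psi> j 0" for j
  have loop: "\<Psi> j x = s \<mu> x *\<^sub>R C j \<and> \<psi>' j x = s' \<mu> x *\<^sub>R C j" if j: "j \<in> {1..N}" and x: "x \<in> {- pi..pi}" for j x
  proof -
    have jN: "j \<le> N" "edge j = {- pi..pi}" "pot \<mu> j = (\<lambda>x. Vf x - \<mu>)" using j by (auto simp: edge_def pot_def[abs_def])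
    have d: "(\<Psi> j has_vector_derivative \<psi>' j x) (at x within {- pi..pi})"
      "(\<psi>' j has_vector_derivative (Vf x - \<mu>) *\<^sub>R \<Psi> j x) (at x within {- pi..pi})" if "x \<in> {- pi..pi}" for x
      using \<psi>'[rule_format, OF jN(1)] that unfolding jN(2,3) by blast+
    have S: "\<Psi> j y = s \<mu> y *\<^sub>R \<Psi> j 0 + t \<mu> y *\<^sub>R \<psi>' j 0" "\<psi>' j y = s' \<mu> y *\<^sub>R \<Psi> j 0 + t' \<mu> y *\<^sub>R \<psi>' j 0"
      if "y \<in> {- pi..pi}" for y
      using complex_lin_sol[OF lt Vf_cont sols(1)[of \<mu> 1 0] sols(1)[of \<mu> 0 1] mem sols(2,3) sols(2,3) d that] by auto
    \<comment> \<open>Both ends of a loop sit at the same vertex. The even parts agree there, so the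
      odd coefficient times t(pi) must vanish.\<close>
    have "\<Psi> j pi = \<Psi> j (- pi)" using vert[OF j] by simp
    then have "t \<mu> pi *\<^sub>R \<psi>' j 0 = - (t \<mu> pi *\<^sub>R \<psi>' j 0)"
      using S(1)[OF mpi(1)] S(1)[OF mpi(2)] sols_reflect[OF mpi(1), of \<mu>] by simp
    then have "t \<mu> pi *\<^sub>R \<psi>' j 0 = 0" by simp
    then have "\<psi>' j 0 = 0" using t_end_pos[OF \<mu>] by simp
    then show ?thesis using S[OF x] by (simp add: C_def)
  qed
  have \<psi>0: "(\<Psi> 0 has_vector_derivative \<psi>' 0 x) (at x within {0..})"
    "(\<psi>' 0 has_vector_derivative (\<epsilon>\<^sup>2 * ((half.\<kappa> \<mu>)\<^sup>2 - 6 * (1 - (\<tau> x)\<^sup>2))) *\<^sub>R \<Psi> 0 x) (at x within {0..})" if "0 \<le> x" for x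
    using \<psi>'[rule_format, of 0] that by (auto simp: edge_def pot_def)
  have L2: "\<Psi> 0 \<in> L2_on {0..}" "\<psi>' 0 \<in> L2_on {0..}"
    using H2(1)[of 0] \<psi>'[rule_format, of 0] by (auto simp: edge_def H2_on_def H1_on_def)
  obtain k where k: "\<And>x. 0 \<le> x \<Longrightarrow> \<Psi> 0 x = half.f (half.\<kappa> \<mu>) x *\<^sub>R k" "\<And>x. 0 \<le> x \<Longrightarrow> \<psi>' 0 x = half.f' (half.\<kappa> \<mu>) x *\<^sub>R k"
    using half.decaying_unique[OF half.\<kappa>_props(1)[OF \<mu>] \<psi>0 L2] by blast
  have "\<Psi> = Psi \<mu> C k"
  proof (intro ext)
    fix j x show "\<Psi> j x = Psi \<mu> C k j x"
    proof (cases "j \<le> N \<and> x \<in> edge j")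
      case False
      then show ?thesis using out[of j x] by (auto simp: Psi_def edge_def)
    next
      case True
      then show ?thesis using k(1)[of x] loop[of j x] by (cases "j = 0") (auto simp: Psi_def edge_def)
    qed
  qed
  moreover have "vertex_conditions \<mu> C k"
    unfolding vertex_conditions_def
  proof
    show "\<forall>j\<in>{1..N}. s \<mu> pi *\<^sub>R C j = half.f (half.\<kappa> \<mu>) 0 *\<^sub>R k"
      using loop[OF _ mpi(1)] vert k(1)[of 0] by fastforce
    have ed: "edge_deriv \<Psi> j x = s' \<mu> x *\<^sub>R C j" if j: "j \<in> {1..N}" and x: "x \<in> {- pi..pi}" for j x
    proof -
      have "(\<Psi> j has_vector_derivative \<psi>' j x) (at x within edge j)" using \<psi>'[rule_format, of j] j x by (auto simp: edge_def)
      from vector_derivative_edge[OF this] show ?thesis using j x loop[OF j x] by auto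
    qed
    have "edge_deriv \<Psi> 0 0 = half.f' (half.\<kappa> \<mu>) 0 *\<^sub>R k"
      using vector_derivative_edge[of "\<Psi> 0" "\<psi>' 0 0" 0 0] \<psi>0(1)[of 0] k(2)[of 0] by (simp add: edge_def)
    then have "half.f' (half.\<kappa> \<mu>) 0 *\<^sub>R k = (\<Sum>j=1..N. edge_deriv \<Psi> j pi - edge_deriv \<Psi> j (- pi))" using kirch by simp
    also have "\<dots> = (\<Sum>j=1..N. (2 * s' \<mu> pi) *\<^sub>R C j)"
      by (intro sum.cong refl) (simp add: ed sols_reflect[OF mpi(1)] scaleR_left_distrib[symmetric])
    finally show "(2 * s' \<mu> pi) *\<^sub>R (\<Sum>j=1..N. C j) = half.f' (half.\<kappa> \<mu>) 0 *\<^sub>R k" by (simp add: scaleR_sum_right)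
  qed
  ultimately show ?thesis by blast
qed

text \<open>Membership in H2 needs square integrability: continuity suffices on a loop, and on the
  half-line multiples of exp (- \<epsilon> x) bound the function and its first two
  derivatives.\<close>

lemma Psi_in_eigenspace:
  assumes \<mu>: "\<mu> \<le> 0" and vc: "vertex_conditions \<mu> C k"
  shows "Psi \<mu> C k \<in> eigenspace N \<omega> \<Phi> \<mu>"
proof -
  define \<kappa> where "\<kappa> = half.\<kappa> \<mu>"
  have \<kappa>1: "1 \<le> \<kappa>" using half.\<kappa>_props(1)[OF \<mu>] by (simp add: \<kappa>_def)
  have P0: "Psi \<mu> C k 0 x = half.f \<kappa> x *\<^sub>R k" if "0 \<le> x" for x using that by (simp add: Psi_def \<kappa>_def)
  have Pj: "Psi \<mu> C k j x = s \<mu> x *\<^sub>R C j" if "j \<in> {1..N}" "x \<in> {- pi..pi}" for j x using that by (simp add: Psi_def)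
  define D where "D j x = (if j = 0 then half.f' \<kappa> x *\<^sub>R k else s' \<mu> x *\<^sub>R C j)" for j x
  have d: "(Psi \<mu> C k j has_vector_derivative D j x) (at x within edge j)"
    "(D j has_vector_derivative pot \<mu> j x *\<^sub>R Psi \<mu> C k j x) (at x within edge j)" if j: "j \<le> N" and x: "x \<in> edge j" for j x
  proof -
    have "(Psi \<mu> C k j has_vector_derivative D j x) (at x within edge j) \<and>
      (D j has_vector_derivative pot \<mu> j x *\<^sub>R Psi \<mu> C k j x) (at x within edge j)"
    proof (cases "j = 0")
      case True
      then have x0: "0 \<le> x" and e: "edge j = {0..}" using x by (auto simp: edge_def)
      have "((\<lambda>x. half.f \<kappa> x *\<^sub>R k) has_vector_derivative half.f' \<kappa> x *\<^sub>R k) (at x within {0..})"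
        using has_vector_derivative_scaleR[OF half.f_deriv(1)[OF x0] has_vector_derivative_const[of k]] by simp
      then have "(Psi \<mu> C k 0 has_vector_derivative half.f' \<kappa> x *\<^sub>R k) (at x within {0..})"
        by (rule has_vector_derivative_transform[rotated -1]) (use x0 P0 in auto)
      moreover have "((\<lambda>x. half.f' \<kappa> x *\<^sub>R k) has_vector_derivative (pot \<mu> 0 x * half.f \<kappa> x) *\<^sub>R k) (at x within {0..})"
        using has_vector_derivative_scaleR[OF half.f_deriv(2)[OF x0] has_vector_derivative_const[of k]] by (simp add: pot_def \<kappa>_def)
      ultimately show ?thesis unfolding True by (simp add: e[unfolded True] D_def[abs_def] P0[OF x0])
    next
      case False
      then have j1: "j \<in> {1..N}" and e: "edge j = {- pi..pi}" and xI: "x \<in> {- pi..pi}" using x j by (auto simp: edge_def)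
      have "((\<lambda>x. s \<mu> x *\<^sub>R C j) has_vector_derivative s' \<mu> x *\<^sub>R C j) (at x within {- pi..pi})"
        using has_vector_derivative_scaleR[OF lin_solD(1)[OF sols(1) xI] has_vector_derivative_const[of "C j"]] by simp
      then have "(Psi \<mu> C k j has_vector_derivative s' \<mu> x *\<^sub>R C j) (at x within {- pi..pi})"
        by (rule has_vector_derivative_transform[rotated -1]) (use xI Pj[OF j1] in auto)
      moreover have "((\<lambda>x. s' \<mu> x *\<^sub>R C j) has_vector_derivative ((Vf x - \<mu>) * s \<mu> x) *\<^sub>R C j) (at x within {- pi..pi})"
        using has_vector_derivative_scaleR[OF lin_solD(2)[OF sols(1) xI] has_vector_derivative_const[of "C j"]] by simp
      ultimately show ?thesis using False by (simp add: e D_def[abs_def] pot_def Pj[OF j1 xI])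
    qed
    then show "(Psi \<mu> C k j has_vector_derivative D j x) (at x within edge j)"
      "(D j has_vector_derivative pot \<mu> j x *\<^sub>R Psi \<mu> C k j x) (at x within edge j)" by auto
  qed
  have cP: "continuous_on (edge j) (Psi \<mu> C k j)" and cD: "continuous_on (edge j) (D j)" if "j \<le> N" for j
    by (rule continuous_on_vector_derivative[OF d(1)[OF that]], assumption,
        rule continuous_on_vector_derivative[OF d(2)[OF that]], assumption)
  have cc: "continuous_on (edge j) (\<lambda>x. pot \<mu> j x *\<^sub>R Psi \<mu> C k j x)" if "j \<le> N" for j
    by (intro continuous_intros pot_cont cP that)
  have L2: "Psi \<mu> C k j \<in> L2_on (edge j)" "D j \<in> L2_on (edge j)" "(\<lambda>x. pot \<mu> j x *\<^sub>R Psi \<mu> C k j x) \<in> L2_on (edge j)" if j: "j \<le> N" for j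
  proof -
    have "Psi \<mu> C k j \<in> L2_on (edge j) \<and> D j \<in> L2_on (edge j) \<and> (\<lambda>x. pot \<mu> j x *\<^sub>R Psi \<mu> C k j x) \<in> L2_on (edge j)"
    proof (cases "j = 0")
      case False
      then have e: "edge j = {- pi..pi}" by (simp add: edge_def)
      show ?thesis using cP[OF j] cD[OF j] cc[OF j] unfolding e by (intro conjI cont_L2)
    next
      case True
      have e: "edge 0 = {0..}" by (simp add: edge_def)
      define B where "B = \<epsilon>\<^sup>2 * (\<kappa>\<^sup>2 + 6)"
      have pb: "\<bar>pot \<mu> 0 x\<bar> \<le> B" if "0 \<le> x" for x
      proof -
        have gen: "\<bar>k - 6 * (1 - y)\<bar> \<le> k + 6" if "0 \<le> y" "y \<le> 1" "0 \<le> k" for k y :: real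
          using that by (simp add: abs_le_iff)
        have b: "(\<tau> x)\<^sup>2 \<le> 1" "0 \<le> (\<tau> x)\<^sup>2" using half.\<tau>_bounds[OF that] by (auto simp: abs_square_le_1)
        have "\<bar>\<kappa>\<^sup>2 - 6 * (1 - (\<tau> x)\<^sup>2)\<bar> \<le> \<kappa>\<^sup>2 + 6"
          by (rule gen[OF b(2,1)]) simp
        then show ?thesis by (simp add: pot_def B_def \<kappa>_def abs_mult mult_left_mono)
      qed
      define A1 where "A1 = 3 + 3 * \<kappa> + \<kappa>\<^sup>2"
      define A2 where "A2 = \<epsilon> * (\<kappa> * (3 + 3 * \<kappa> + \<kappa>\<^sup>2) + 3 * (\<kappa> + 2))"
      have fb: "\<bar>half.f \<kappa> x\<bar> \<le> A1 * exp (- \<epsilon> * x)" "\<bar>half.f' \<kappa> x\<bar> \<le> A2 * exp (- \<epsilon> * x)" if "0 \<le> x" for x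
        using half.f_bounds[OF that \<kappa>1] by (auto simp: A1_def A2_def)
      have "Psi \<mu> C k 0 \<in> L2_on {0..}"
      proof (rule exp_bound_L2[OF _ half.\<epsilon>, where C="A1 * norm k"])
        show "continuous_on {0..} (Psi \<mu> C k 0)" using cP[of 0] by (simp add: e)
        show "norm (Psi \<mu> C k 0 x) \<le> A1 * norm k * exp (- \<epsilon> * x)" if "0 \<le> x" for x
          using mult_right_mono[OF fb(1)[OF that], of "norm k"] by (simp add: P0[OF that] mult_ac)
      qed
      moreover have "D 0 \<in> L2_on {0..}"
      proof (rule exp_bound_L2[OF _ half.\<epsilon>, where C="A2 * norm k"])
        show "continuous_on {0..} (D 0)" using cD[of 0] by (simp add: e)
        show "norm (D 0 x) \<le> A2 * norm k * exp (- \<epsilon> * x)" if "0 \<le> x" for x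
          using mult_right_mono[OF fb(2)[OF that], of "norm k"] by (simp add: D_def mult_ac)
      qed
      moreover have "(\<lambda>x. pot \<mu> 0 x *\<^sub>R Psi \<mu> C k 0 x) \<in> L2_on {0..}"
      proof (rule exp_bound_L2[OF _ half.\<epsilon>, where C="B * A1 * norm k"])
        show "continuous_on {0..} (\<lambda>x. pot \<mu> 0 x *\<^sub>R Psi \<mu> C k 0 x)" using cc[of 0] by (simp add: e)
        show "norm (pot \<mu> 0 x *\<^sub>R Psi \<mu> C k 0 x) \<le> B * A1 * norm k * exp (- \<epsilon> * x)" if x: "0 \<le> x" for x
        proof -
          have "\<bar>pot \<mu> 0 x\<bar> * \<bar>half.f \<kappa> x\<bar> \<le> B * (A1 * exp (- \<epsilon> * x))"
            using pb[OF x] fb(1)[OF x] by (intro mult_mono) auto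
          from mult_right_mono[OF this, of "norm k"] show ?thesis by (simp add: P0[OF x] abs_mult mult_ac)
        qed
      qed
      ultimately show ?thesis unfolding True e by blast
    qed
    then show "Psi \<mu> C k j \<in> L2_on (edge j)" "D j \<in> L2_on (edge j)" "(\<lambda>x. pot \<mu> j x *\<^sub>R Psi \<mu> C k j x) \<in> L2_on (edge j)" by auto
  qed
  note CH = classical_H2[OF edge_cases d cc L2]
  have mpi: "pi \<in> {- pi..pi}" "- pi \<in> {- pi..pi}" by auto
  have "Psi \<mu> C k \<in> flower_H2 N"
    unfolding flower_H2_def using CH(1) cP by (auto simp: Psi_def edge_def)
  moreover have "\<forall>j\<in>{1..N}. Psi \<mu> C k j pi = Psi \<mu> C k 0 0 \<and> Psi \<mu> C k j (- pi) = Psi \<mu> C k 0 0"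
    using vc Pj mpi sols_reflect(1)[OF mpi(1), of \<mu>] by (auto simp: P0 vertex_conditions_def \<kappa>_def)
  moreover have "(\<Sum>j=1..N. edge_deriv (Psi \<mu> C k) j pi - edge_deriv (Psi \<mu> C k) j (- pi)) = edge_deriv (Psi \<mu> C k) 0 0"
  proof -
    have ed: "edge_deriv (Psi \<mu> C k) j x = s' \<mu> x *\<^sub>R C j" if j: "j \<in> {1..N}" and x: "x \<in> {- pi..pi}" for j x
      using vector_derivative_edge[of "Psi \<mu> C k j" "D j x" x j] d(1)[of j x] j x by (auto simp: edge_def D_def)
    have "edge_deriv (Psi \<mu> C k) 0 0 = half.f' \<kappa> 0 *\<^sub>R k"
      using vector_derivative_edge[of "Psi \<mu> C k 0" "D 0 0" 0 0] d(1)[of 0 0] by (simp add: edge_def D_def)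
    moreover have "(\<Sum>j=1..N. edge_deriv (Psi \<mu> C k) j pi - edge_deriv (Psi \<mu> C k) j (- pi)) = (\<Sum>j=1..N. (2 * s' \<mu> pi) *\<^sub>R C j)"
      by (intro sum.cong refl) (simp add: ed sols_reflect[OF mpi(1)] scaleR_left_distrib[symmetric])
    ultimately show ?thesis using vc by (simp add: vertex_conditions_def scaleR_sum_right \<kappa>_def)
  qed
  moreover have "flower_ae_eq N (linearized_op \<omega> \<Phi> (Psi \<mu> C k)) (\<lambda>j x. of_real \<mu> * Psi \<mu> C k j x)"
    unfolding flower_ae_eq_def using CH(2) eigen_equation[OF \<mu>] by blast
  ultimately show ?thesis unfolding eigenspace_def flower_H2_NK_def by blast
qed

lemma eigenspace_eq:
  assumes "\<mu> \<le> 0"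
  shows "eigenspace N \<omega> \<Phi> \<mu> = {Psi \<mu> C k | C k. vertex_conditions \<mu> C k}"
  using eigenspace_subset[OF assms] Psi_in_eigenspace[OF assms] by blast

end

section \<open>Counting eigenvalues\<close>

lemma sum_fun2_apply: "(\<Sum>a\<in>A. F a) j x = (\<Sum>a\<in>A. F a j x)" for F :: "'a \<Rightarrow> 'b \<Rightarrow> 'c \<Rightarrow> 'd::comm_monoid_add"
  by (induction A rule: infinite_finite_induct) auto

lemma cdimension_span:
  assumes "finite B" "cfun.independent B"
  shows "cdimension (cfun.span B) = enat (card B)"
  using assms cfun.dim_span_eq_card_independent[OF assms(2)] unfolding cdimension_def by auto

context flower_state
begin

definition matching :: "real \<Rightarrow> real" where
  "matching \<mu> = (2 * real N) * s' \<mu> pi - s \<mu> pi * half.g \<mu>"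

lemma f0_pos: "\<mu> \<le> 0 \<Longrightarrow> 0 < half.f (half.\<kappa> \<mu>) 0"
  using half.f_pos half.\<kappa>_props(1) by simp

lemma f'0: "\<mu> \<le> 0 \<Longrightarrow> half.f' (half.\<kappa> \<mu>) 0 = half.g \<mu> * half.f (half.\<kappa> \<mu>) 0"
  using f0_pos[of \<mu>] by (simp add: half.g_def)

lemma Psi_zero: "Psi \<mu> (\<lambda>_. 0) 0 = 0"
  by (simp add: Psi_def fun_eq_iff)

lemma zero_in_eigenspace: "\<mu> \<le> 0 \<Longrightarrow> 0 \<in> eigenspace N \<omega> \<Phi> \<mu>"
  using Psi_in_eigenspace[of \<mu> "\<lambda>_. 0" 0] by (simp add: vertex_conditions_def Psi_zero)

text \<open>Normalized to coefficient 1 on the half-line, where it is visibly nonzero; the loop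
  coefficient then follows from continuity at the vertex, provided that s(pi) is nonzero.\<close>

definition sym_fun :: "real \<Rightarrow> nat \<Rightarrow> real \<Rightarrow> complex" where
  "sym_fun \<mu> = Psi \<mu> (\<lambda>_. of_real (half.f (half.\<kappa> \<mu>) 0 / s \<mu> pi)) 1"

text \<open>Continuity makes every loop coefficient the same multiple of k, and Kirchhoff's
  condition becomes k times \<open>matching\<close> times a nonzero factor equal to zero.\<close>

lemma symmetric_sector:
  assumes \<mu>: "\<mu> \<le> 0" and s0: "s \<mu> pi \<noteq> 0"
  shows "eigenspace N \<omega> \<Phi> \<mu> = {cscale k (sym_fun \<mu>) | k. k = 0 \<or> matching \<mu> = 0}"
proof -
  define a where "a = half.f (half.\<kappa> \<mu>) 0 / s \<mu> pi"
  have as: "s \<mu> pi * a = half.f (half.\<kappa> \<mu>) 0" using s0 by (simp add: a_def)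
  have Psi_eq: "Psi \<mu> C k = cscale k (sym_fun \<mu>)" if "\<And>j. j \<in> {1..N} \<Longrightarrow> C j = of_real a * k" for C k
    using that by (auto simp: Psi_def cscale_def sym_fun_def a_def[symmetric] fun_eq_iff scaleR_conv_of_real)
  have key: "(2 * s' \<mu> pi) *\<^sub>R (of_nat N * (of_real a * k)) = half.f' (half.\<kappa> \<mu>) 0 *\<^sub>R k \<longleftrightarrow> k = 0 \<or> matching \<mu> = 0" for k :: complex
  proof -
    have "(2 * s' \<mu> pi) *\<^sub>R (of_nat N * (of_real a * k)) - half.f' (half.\<kappa> \<mu>) 0 *\<^sub>R k = of_real (a * matching \<mu>) * k"
      unfolding matching_def f'0[OF \<mu>] as[symmetric] by (simp add: scaleR_conv_of_real algebra_simps)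
    moreover have "a \<noteq> 0" using s0 f0_pos[OF \<mu>] by (simp add: a_def)
    ultimately show ?thesis by (metis eq_iff_diff_eq_0 mult_eq_0_iff of_real_eq_0_iff)
  qed
  have sumC: "(\<Sum>j=1..N. C j) = of_nat N * (of_real a * k)" if "\<And>j. j \<in> {1..N} \<Longrightarrow> C j = of_real a * k" for C :: "nat \<Rightarrow> complex" and k
    using that by simp
  show ?thesis
  proof (intro equalityI subsetI)
    fix \<Psi> assume "\<Psi> \<in> eigenspace N \<omega> \<Phi> \<mu>"
    then obtain C k where \<Psi>: "\<Psi> = Psi \<mu> C k" and vc: "vertex_conditions \<mu> C k" unfolding eigenspace_eq[OF \<mu>] by blast
    have C: "C j = of_real a * k" if "j \<in> {1..N}" for j
    proof -
      have "s \<mu> pi *\<^sub>R C j = s \<mu> pi *\<^sub>R (of_real a * k)"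
        using vc that as by (simp add: vertex_conditions_def scaleR_conv_of_real mult.assoc[symmetric] of_real_mult[symmetric] del: of_real_mult)
      then show ?thesis using s0 by simp
    qed
    have "k = 0 \<or> matching \<mu> = 0" using vc sumC[OF C] key[of k] unfolding vertex_conditions_def by simp
    moreover have "\<Psi> = cscale k (sym_fun \<mu>)" unfolding \<Psi> by (rule Psi_eq) (rule C)
    ultimately show "\<Psi> \<in> {cscale k (sym_fun \<mu>) | k. k = 0 \<or> matching \<mu> = 0}" by blast
  next
    fix \<Psi> assume "\<Psi> \<in> {cscale k (sym_fun \<mu>) | k. k = 0 \<or> matching \<mu> = 0}"
    then obtain k where \<Psi>: "\<Psi> = cscale k (sym_fun \<mu>)" and k: "k = 0 \<or> matching \<mu> = 0" by blast
    have "vertex_conditions \<mu> (\<lambda>_. of_real a * k) k"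
      unfolding vertex_conditions_def
      using key[of k] k sumC[of "\<lambda>_. of_real a * k" k] as
      by (simp add: scaleR_conv_of_real mult.assoc[symmetric] of_real_mult[symmetric] del: of_real_mult)
    from Psi_in_eigenspace[OF \<mu> this] show "\<Psi> \<in> eigenspace N \<omega> \<Phi> \<mu>" unfolding \<Psi> using Psi_eq by simp
  qed
qed

lemma eigenspace_trivial:
  assumes "\<mu> \<le> 0" "s \<mu> pi \<noteq> 0" "matching \<mu> \<noteq> 0"
  shows "eigenspace N \<omega> \<Phi> \<mu> = {0}"
  unfolding symmetric_sector[OF assms(1,2)] using assms(3) by (auto simp: cscale_def fun_eq_iff)

lemma eigenspace_symmetric:
  assumes "\<mu> \<le> 0" "s \<mu> pi \<noteq> 0" "matching \<mu> = 0"
  shows "cdimension (eigenspace N \<omega> \<Phi> \<mu>) = 1" "\<exists>\<Psi>\<in>eigenspace N \<omega> \<Phi> \<mu>. \<Psi> \<noteq> 0"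
proof -
  have E: "eigenspace N \<omega> \<Phi> \<mu> = cfun.span {sym_fun \<mu>}"
    unfolding symmetric_sector[OF assms(1,2)] cfun.span_singleton using assms(3) by auto
  have "sym_fun \<mu> 0 0 \<noteq> 0" using f0_pos[OF assms(1)] by (simp add: sym_fun_def Psi_def)
  then have ne: "sym_fun \<mu> \<noteq> 0" by auto
  then have "cfun.independent {sym_fun \<mu>}" by (simp add: cfun.dependent_single)
  then show "cdimension (eigenspace N \<omega> \<Phi> \<mu>) = 1" unfolding E by (subst cdimension_span) (auto simp: one_enat_def)
  show "\<exists>\<Psi>\<in>eigenspace N \<omega> \<Phi> \<mu>. \<Psi> \<noteq> 0" unfolding E using ne cfun.span_base[of "sym_fun \<mu>" "{sym_fun \<mu>}"] by blast
qed

text \<open>The coefficient vectors e_i - e_1 for i = 2, ..., N form a basis of the vectors with sum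
  zero.\<close>

definition diff_fun :: "real \<Rightarrow> nat \<Rightarrow> nat \<Rightarrow> real \<Rightarrow> complex" where
  "diff_fun \<mu> i = Psi \<mu> (\<lambda>j. if j = 1 then - 1 else if j = i then 1 else 0) 0"

text \<open>Since s = 1 at the midpoint, values at x = 0 read off the coefficient vector;
  injectivity and independence follow from this.\<close>

lemma diff_fun_zero: "i \<in> {2..N} \<Longrightarrow> j \<in> {2..N} \<Longrightarrow> diff_fun \<mu> i j 0 = (if j = i then 1 else 0)"
  by (auto simp: diff_fun_def Psi_def sols)

text \<open>If s(pi) = 0, continuity gives f(0) k = 0, so k = 0; and s'(pi) is then nonzero, so
  Kirchhoff's condition says that the loop coefficients sum to zero.\<close>

lemma Dirichlet_sector:
  assumes \<mu>: "\<mu> \<le> 0" and s0: "s \<mu> pi = 0"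
  shows "eigenspace N \<omega> \<Phi> \<mu> = cfun.span (diff_fun \<mu> ` {2..N})"
proof -
  have split: "{1..N} = insert 1 {2..N}" using N by auto
  have vc: "vertex_conditions \<mu> C k \<longleftrightarrow> k = 0 \<and> (\<Sum>j=1..N. C j) = 0" for C k
  proof -
    have "1 \<in> {1..N}" using N by simp
    then show ?thesis unfolding vertex_conditions_def using s0 f0_pos[OF \<mu>] lp.even_nondegenerate[OF s0] by auto
  qed
  have comb: "Psi \<mu> C 0 = (\<Sum>i\<in>{2..N}. cscale (C i) (diff_fun \<mu> i))" if C: "(\<Sum>j=1..N. C j) = 0" for C
  proof (intro ext)
    fix j x
    have C1: "C 1 = - (\<Sum>i\<in>{2..N}. C i)" using C unfolding split by (simp add: eq_neg_iff_add_eq_0)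
    have e: "(\<Sum>i\<in>{2..N}. cscale (C i) (diff_fun \<mu> i)) j x = (\<Sum>i\<in>{2..N}. C i * diff_fun \<mu> i j x)"
      by (simp add: sum_fun2_apply cscale_def)
    consider "j = 0 \<or> \<not> (j \<le> N \<and> x \<in> {- pi..pi})" | "j = 1" "x \<in> {- pi..pi}" | "j \<in> {2..N}" "x \<in> {- pi..pi}" by fastforce
    then show "Psi \<mu> C 0 j x = (\<Sum>i\<in>{2..N}. cscale (C i) (diff_fun \<mu> i)) j x"
      unfolding e
    proof cases
      case 1
      then have "diff_fun \<mu> i j x = 0" for i by (auto simp: diff_fun_def Psi_def)
      then show "Psi \<mu> C 0 j x = (\<Sum>i\<in>{2..N}. C i * diff_fun \<mu> i j x)" using 1 by (auto simp: Psi_def)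
    next
      case 2
      then have "diff_fun \<mu> i j x = - of_real (s \<mu> x)" for i using N by (simp add: diff_fun_def Psi_def scaleR_conv_of_real)
      then show "Psi \<mu> C 0 j x = (\<Sum>i\<in>{2..N}. C i * diff_fun \<mu> i j x)" using 2 N
        by (simp add: Psi_def scaleR_conv_of_real C1[unfolded One_nat_def] mult.commute sum_distrib_right[symmetric] sum_negf)
    next
      case 3
      have "C i * diff_fun \<mu> i j x = (if i = j then of_real (s \<mu> x) * C j else 0)" for i
        using 3 by (auto simp: diff_fun_def Psi_def scaleR_conv_of_real)
      then show "Psi \<mu> C 0 j x = (\<Sum>i\<in>{2..N}. C i * diff_fun \<mu> i j x)" using 3
        by (simp add: Psi_def scaleR_conv_of_real)
    qed
  qed
  show ?thesis
  proof (intro equalityI subsetI)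
    fix \<Psi> assume "\<Psi> \<in> eigenspace N \<omega> \<Phi> \<mu>"
    then obtain C where \<Psi>: "\<Psi> = Psi \<mu> C 0" "(\<Sum>j=1..N. C j) = 0" unfolding eigenspace_eq[OF \<mu>] vc by blast
    show "\<Psi> \<in> cfun.span (diff_fun \<mu> ` {2..N})"
      unfolding \<Psi>(1) comb[OF \<Psi>(2)] by (intro cfun.span_sum cfun.span_scale cfun.span_base) auto
  next
    fix \<Psi> assume "\<Psi> \<in> cfun.span (diff_fun \<mu> ` {2..N})"
    moreover have "cfun.span (diff_fun \<mu> ` {2..N}) \<subseteq> eigenspace N \<omega> \<Phi> \<mu>"
    proof (rule cfun.span_minimal)
      show "diff_fun \<mu> ` {2..N} \<subseteq> eigenspace N \<omega> \<Phi> \<mu>"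
      proof
        fix x assume "x \<in> diff_fun \<mu> ` {2..N}"
        then obtain i where i: "i \<in> {2..N}" "x = diff_fun \<mu> i" by blast
        have "(\<Sum>j=1..N. if j = 1 then - 1 else if j = i then 1 else 0 :: complex) = - 1 + (\<Sum>j\<in>{2..N}. if j = 1 then - 1 else if j = i then 1 else 0)"
          unfolding split by (subst sum.insert) auto
        also have "(\<Sum>j\<in>{2..N}. if j = 1 then - 1 else if j = i then 1 else 0 :: complex) = (\<Sum>j\<in>{2..N}. if j = i then 1 else 0)"
          by (intro sum.cong) auto
        also have "\<dots> = 1" using i by simp
        finally have "vertex_conditions \<mu> (\<lambda>j. if j = 1 then - 1 else if j = i then 1 else 0) 0" unfolding vc by simp
        then show "x \<in> eigenspace N \<omega> \<Phi> \<mu>" unfolding i(2) diff_fun_def by (rule Psi_in_eigenspace[OF \<mu>])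
      qed
      show "cfun.subspace (eigenspace N \<omega> \<Phi> \<mu>)"
        unfolding cfun.subspace_def
      proof (intro conjI allI ballI)
        show "0 \<in> eigenspace N \<omega> \<Phi> \<mu>" by (rule zero_in_eigenspace[OF \<mu>])
      next
        fix x y assume "x \<in> eigenspace N \<omega> \<Phi> \<mu>" "y \<in> eigenspace N \<omega> \<Phi> \<mu>"
        then obtain C D where x: "x = Psi \<mu> C 0" "(\<Sum>j=1..N. C j) = 0" and y: "y = Psi \<mu> D 0" "(\<Sum>j=1..N. D j) = 0"
          unfolding eigenspace_eq[OF \<mu>] vc by blast
        have "x + y = Psi \<mu> (\<lambda>j. C j + D j) 0" unfolding x y by (auto simp: Psi_def fun_eq_iff scaleR_right_distrib)
        then show "x + y \<in> eigenspace N \<omega> \<Phi> \<mu>"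
          using Psi_in_eigenspace[OF \<mu>, of "\<lambda>j. C j + D j" 0] x y by (simp add: vc sum.distrib)
      next
        fix c x assume "x \<in> eigenspace N \<omega> \<Phi> \<mu>"
        then obtain C where x: "x = Psi \<mu> C 0" "(\<Sum>j=1..N. C j) = 0" unfolding eigenspace_eq[OF \<mu>] vc by blast
        have "cscale c x = Psi \<mu> (\<lambda>j. c * C j) 0" unfolding x by (auto simp: Psi_def fun_eq_iff cscale_def)
        then show "cscale c x \<in> eigenspace N \<omega> \<Phi> \<mu>"
          using Psi_in_eigenspace[OF \<mu>, of "\<lambda>j. c * C j" 0] x by (simp add: vc sum_distrib_left[symmetric])
      qed
    qed
    ultimately show "\<Psi> \<in> eigenspace N \<omega> \<Phi> \<mu>" by blast
  qed
qed

lemma diff_fun_inj: "inj_on (diff_fun \<mu>) {2..N}"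
proof (rule inj_onI)
  fix i j assume ij: "i \<in> {2..N}" "j \<in> {2..N}" "diff_fun \<mu> i = diff_fun \<mu> j"
  show "i = j" using diff_fun_zero[OF ij(1,1), of \<mu>] diff_fun_zero[OF ij(2,1), of \<mu>] ij(3) by (simp split: if_splits)
qed

lemma diff_fun_independent: "cfun.independent (diff_fun \<mu> ` {2..N})"
proof (rule cfun.independent_if_scalars_zero)
  show "finite (diff_fun \<mu> ` {2..N})" by simp
  fix a x assume 0: "(\<Sum>x\<in>diff_fun \<mu> ` {2..N}. cscale (a x) x) = 0" and x: "x \<in> diff_fun \<mu> ` {2..N}"
  obtain j where j: "j \<in> {2..N}" "x = diff_fun \<mu> j" using x by blast
  have "0 = (\<Sum>x\<in>diff_fun \<mu> ` {2..N}. cscale (a x) x) j 0" unfolding 0 by simp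
  also have "\<dots> = (\<Sum>i\<in>{2..N}. a (diff_fun \<mu> i) * diff_fun \<mu> i j 0)"
    by (simp add: sum.reindex[OF diff_fun_inj] sum_fun2_apply cscale_def)
  also have "\<dots> = (\<Sum>i\<in>{2..N}. if i = j then a (diff_fun \<mu> j) else 0)"
    by (rule sum.cong[OF refl]) (use diff_fun_zero[OF _ j(1)] in auto)
  also have "\<dots> = a x" using j by simp
  finally show "a x = 0" by simp
qed

lemma eigenspace_Dirichlet:
  assumes "\<mu> \<le> 0" "s \<mu> pi = 0"
  shows "cdimension (eigenspace N \<omega> \<Phi> \<mu>) = enat (N - 1)" "\<exists>\<Psi>\<in>eigenspace N \<omega> \<Phi> \<mu>. \<Psi> \<noteq> 0"
proof -
  show "cdimension (eigenspace N \<omega> \<Phi> \<mu>) = enat (N - 1)"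
    unfolding Dirichlet_sector[OF assms]
    by (subst cdimension_span[OF _ diff_fun_independent]) (auto simp: card_image[OF diff_fun_inj])
  have m: "diff_fun \<mu> 2 \<in> eigenspace N \<omega> \<Phi> \<mu>" unfolding Dirichlet_sector[OF assms] using N by (intro cfun.span_base) auto
  have "diff_fun \<mu> 2 2 0 \<noteq> 0" using diff_fun_zero[of 2 2 \<mu>] N by simp
  then have "diff_fun \<mu> 2 \<noteq> 0" by auto
  then show "\<exists>\<Psi>\<in>eigenspace N \<omega> \<Phi> \<mu>. \<Psi> \<noteq> 0" using m by blast
qed

lemma negative_eigenvalues_eq: "negative_eigenvalues N \<omega> \<Phi> = {\<mu>. \<mu> < 0 \<and> (s \<mu> pi = 0 \<or> matching \<mu> = 0)}"
proof -
  have "(\<exists>\<Psi>\<in>eigenspace N \<omega> \<Phi> \<mu>. \<Psi> \<noteq> 0) \<longleftrightarrow> s \<mu> pi = 0 \<or> matching \<mu> = 0" if "\<mu> < 0" for \<mu>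
  proof -
    have \<mu>: "\<mu> \<le> 0" using that by simp
    consider "s \<mu> pi = 0" | "s \<mu> pi \<noteq> 0" "matching \<mu> = 0" | "s \<mu> pi \<noteq> 0" "matching \<mu> \<noteq> 0" by blast
    then show ?thesis
    proof cases
      case 1
      then show ?thesis using eigenspace_Dirichlet(2)[OF \<mu> 1] by simp
    next
      case 2
      then show ?thesis using eigenspace_symmetric(2)[OF \<mu> 2] by simp
    next
      case 3
      then show ?thesis unfolding eigenspace_trivial[OF \<mu> 3] by simp
    qed
  qed
  then show ?thesis unfolding negative_eigenvalues_def by auto
qed

text \<open>The even solution at energy 0 is w / w 0, by uniqueness at the midpoint. The second
  claim is \<open>w'_end\<close> divided by the negative number w 0.\<close>

lemma zero_energy:
  shows "s 0 pi = u pi * sqrt (1 - z) * loop.H z / loop.w 0" "matching 0 < 0"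
proof -
  note w0 = loop.w_start
  have zp: "0 < z" "z < 1" using loop.z_pos loop.z(2) by auto
  have cV: "continuous_on {0..pi} (\<lambda>x. loop.V x - 0)" using V_cont by simp
  have w: "lin_sol {0..pi} (\<lambda>x. loop.V x - 0) (\<lambda>x. 1 / loop.w 0 * loop.w x + 0 * loop.w x) (\<lambda>x. 1 / loop.w 0 * loop.w' x + 0 * loop.w' x)"
    using lin_sol_comb[OF loop.w_sol loop.w_sol, of "1 / loop.w 0" 0] by simp
  have mem: "0 \<in> {0..pi}" "pi \<in> {0..pi}" by auto
  have ic: "s 0 0 = 1 / loop.w 0 * loop.w 0 + 0 * loop.w 0" "s' 0 0 = 1 / loop.w 0 * loop.w' 0 + 0 * loop.w' 0"
    using w0 by (simp_all add: sols)
  have e: "s 0 pi = loop.w pi / loop.w 0" "s' 0 pi = loop.w' pi / loop.w 0"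
    using lin_sol_eq[OF pi_gt_zero cV restrict_sol[of 0 1 0] w mem(1) ic mem(2)] by simp_all
  show "s 0 pi = u pi * sqrt (1 - z) * loop.H z / loop.w 0" unfolding e(1) loop.w_end ..
  have sq: "(sqrt (1 - z))\<^sup>2 = 1 - z" using zp by simp
  have g0: "half.g 0 = \<epsilon> * (2 * z - 1) / sqrt (1 - z)" unfolding half.g_zero \<tau>0 sq by (simp add: algebra_simps)
  have "matching 0 = (loop.w' pi / (1 / (2 * real N)) - loop.w pi * (\<epsilon> * (2 * z - 1) / sqrt (1 - z))) / loop.w 0"
    unfolding matching_def e g0 by (simp add: diff_divide_distrib mult_ac)
  also have "\<dots> = (\<epsilon> * u pi * loop.k2 / (1 / (2 * real N)) * loop.K z) / loop.w 0" unfolding loop.w'_end ..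
  also have "\<dots> < 0"
  proof (rule divide_pos_neg)
    have "0 < loop.k2" using loop.k2_bounds(1) by simp
    then show "0 < \<epsilon> * u pi * loop.k2 / (1 / (2 * real N)) * loop.K z"
      using loop.K_pos[OF zp] loop.u_pos[of pi] loop.\<epsilon> loop.c0 by (intro mult_pos_pos divide_pos_pos) auto
  qed (fact w0(1))
  finally show "matching 0 < 0" .
qed

text \<open>The symmetric eigenvalue \<mu>D is always present, negative and simple, and s(pi) is
  positive there, so it never coincides with the Dirichlet eigenvalue of multiplicity N - 1. The
  latter is negative, zero or absent among nonpositive energies according as H is positive, zero or
  negative; in the middle case it counts for the kernel and not for n.\<close>

lemma counts:
  shows "0 < loop.H z \<Longrightarrow> n_neg N \<omega> \<Phi> = enat N" "loop.H z \<le> 0 \<Longrightarrow> n_neg N \<omega> \<Phi> = 1"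
    "loop.H z \<noteq> 0 \<Longrightarrow> z_zero N \<omega> \<Phi> = 0" "loop.H z = 0 \<Longrightarrow> z_zero N \<omega> \<Phi> = enat (N - 1)"
proof -
  have pos: "0 < u pi * sqrt (1 - z)" using loop.u_pos[of pi] loop.z(2) by simp
  note w0 = loop.w_start(1)
  have N2: "0 < 2 * real N" using N by simp
  have m0: "2 * real N * s' 0 pi - s 0 pi * half.g 0 < 0" using zero_energy(2) by (simp add: matching_def)
  obtain \<mu>D where \<mu>D: "\<mu>D < 0" "0 < s \<mu>D pi" "matching \<mu>D = 0" "\<And>\<mu>. \<mu> \<le> 0 \<Longrightarrow> matching \<mu> = 0 \<Longrightarrow> \<mu> = \<mu>D"
    using lp.matching_unique[OF N2 half.g_cont half.g_mono half.g_neg m0] unfolding matching_def by blast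
  have dimD: "cdimension (eigenspace N \<omega> \<Phi> \<mu>D) = 1" using eigenspace_symmetric(1)[of \<mu>D] \<mu>D by simp
  show "n_neg N \<omega> \<Phi> = enat N" if H: "0 < loop.H z"
  proof -
    have "0 < u pi * sqrt (1 - z) * loop.H z" using pos H by simp
    then have "s 0 pi < 0" unfolding zero_energy(1) using w0 by (rule divide_pos_neg)
    then obtain \<mu>1 where \<mu>1: "\<mu>1 < 0" "s \<mu>1 pi = 0" using lp.Dirichlet_exists by blast
    have ne: "\<mu>1 \<noteq> \<mu>D" using \<mu>1 \<mu>D by auto
    have "negative_eigenvalues N \<omega> \<Phi> = {\<mu>1, \<mu>D}"
      unfolding negative_eigenvalues_eq
    proof (intro equalityI subsetI)
      fix \<mu> assume "\<mu> \<in> {\<mu>. \<mu> < 0 \<and> (s \<mu> pi = 0 \<or> matching \<mu> = 0)}"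
      then have \<mu>: "\<mu> \<le> 0" "s \<mu> pi = 0 \<or> matching \<mu> = 0" by auto
      then show "\<mu> \<in> {\<mu>1, \<mu>D}"
        using \<mu>D(4)[OF \<mu>(1)] lp.Dirichlet_unique[OF \<mu>(1) _ less_imp_le[OF \<mu>1(1)] \<mu>1(2)] by blast
    qed (use \<mu>1 \<mu>D(1,3) in auto)
    then have "n_neg N \<omega> \<Phi> = enat (N - 1) + 1"
      unfolding n_neg_def using ne dimD eigenspace_Dirichlet(1)[of \<mu>1] \<mu>1 by simp
    also have "\<dots> = enat N" using N by (simp add: one_enat_def)
    finally show ?thesis .
  qed
  show "n_neg N \<omega> \<Phi> = 1" if H: "loop.H z \<le> 0"
  proof -
    have "u pi * sqrt (1 - z) * loop.H z \<le> 0" using pos H by (intro mult_nonneg_nonpos) auto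
    then have "0 \<le> s 0 pi" unfolding zero_energy(1) using w0 by (intro divide_nonpos_neg)
    then have p: "0 < s \<mu> pi" if "\<mu> < 0" for \<mu> by (rule lp.Dirichlet_none[OF _ that])
    have "negative_eigenvalues N \<omega> \<Phi> = {\<mu>D}"
      unfolding negative_eigenvalues_eq
    proof (intro equalityI subsetI)
      fix \<mu> assume "\<mu> \<in> {\<mu>. \<mu> < 0 \<and> (s \<mu> pi = 0 \<or> matching \<mu> = 0)}"
      then have \<mu>: "\<mu> < 0" "s \<mu> pi = 0 \<or> matching \<mu> = 0" by auto
      then have "matching \<mu> = 0" using p[OF \<mu>(1)] by auto
      then show "\<mu> \<in> {\<mu>D}" using \<mu>D(4)[OF less_imp_le[OF \<mu>(1)]] by simp
    qed (use \<mu>D(1,3) in auto)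
    then show ?thesis unfolding n_neg_def using dimD by simp
  qed
  show "z_zero N \<omega> \<Phi> = 0" if H: "loop.H z \<noteq> 0"
  proof -
    have "s 0 pi \<noteq> 0" unfolding zero_energy(1) using pos H w0 by auto
    then have E: "eigenspace N \<omega> \<Phi> 0 = cfun.span {}" using eigenspace_trivial[of 0] zero_energy(2) by simp
    show ?thesis unfolding z_zero_def E by (subst cdimension_span) (auto simp: cfun.independent_empty zero_enat_def)
  qed
  show "z_zero N \<omega> \<Phi> = enat (N - 1)" if H: "loop.H z = 0"
    unfolding z_zero_def by (rule eigenspace_Dirichlet(1)) (simp_all add: zero_energy(1) H)
qed

end

section \<open>Transfer from the parameter z to the frequency\<close>

theorem theorem2:
  fixes N :: nat and \<Phi> :: "real \<Rightarrow> nat \<Rightarrow> real \<Rightarrow> real"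
  assumes "N \<ge> 2"
    and "\<And>\<omega>. \<omega> < 0 \<Longrightarrow> positive_single_lobe_symmetric_state N \<omega> (\<Phi> \<omega>)"
  shows "\<exists>\<omega>\<^sub>s. \<omega>\<^sub>s < 0 \<and>
    z_zero N \<omega>\<^sub>s (\<Phi> \<omega>\<^sub>s) = enat (N - 1) \<and>
    (\<forall>\<omega><0. \<omega> \<noteq> \<omega>\<^sub>s \<longrightarrow> z_zero N \<omega> (\<Phi> \<omega>) = 0) \<and>
    (\<forall>\<omega><\<omega>\<^sub>s. n_neg N \<omega> (\<Phi> \<omega>) = enat N) \<and>
    (\<forall>\<omega>\<in>{\<omega>\<^sub>s..<0}. n_neg N \<omega> (\<Phi> \<omega>) = 1)"
proof -
  define c where "c = 1 / (2 * real N)"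
  interpret pc: period_curve c
    by unfold_locales (use assms(1) in \<open>auto simp: c_def field_simps\<close>)
  obtain zs where zs: "0 < zs" "zs < 1" "pc.H zs = 0" "\<And>z. 0 < z \<Longrightarrow> z < zs \<Longrightarrow> 0 < pc.H z"
    "\<And>z. zs < z \<Longrightarrow> z < 1 \<Longrightarrow> pc.H z < 0"
    using pc.H_sign by blast
  have state: "\<exists>z. 0 < z \<and> z < 1 \<and> pc.T z = sqrt (- \<omega>) * pi \<and>
      (0 < pc.H z \<longrightarrow> n_neg N \<omega> (\<Phi> \<omega>) = enat N) \<and> (pc.H z \<le> 0 \<longrightarrow> n_neg N \<omega> (\<Phi> \<omega>) = 1) \<and>
      (pc.H z \<noteq> 0 \<longrightarrow> z_zero N \<omega> (\<Phi> \<omega>) = 0) \<and> (pc.H z = 0 \<longrightarrow> z_zero N \<omega> (\<Phi> \<omega>) = enat (N - 1))" if \<omega>: "\<omega> < 0" for \<omega>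
  proof -
    have "\<exists>z u p \<tau>. flower_state N (sqrt (- \<omega>)) z u p \<tau> \<omega> (\<Phi> \<omega>)"
    proof (rule state_profiles[OF assms(1) \<omega> assms(2)[OF \<omega>]])
      fix u p \<tau> z
      assume A: "loop_profile (1 / (2 * real N)) (sqrt (- \<omega>)) z u p" "halfline_profile (sqrt (- \<omega>)) \<tau>"
        "\<tau> 0 = sqrt (1 - z)" "\<And>j x. j \<in> {1..N} \<Longrightarrow> x \<in> {- pi..pi} \<Longrightarrow> \<Phi> \<omega> j x = sqrt (- \<omega>) * u \<bar>x\<bar>"
        "\<And>x. 0 \<le> x \<Longrightarrow> (\<Phi> \<omega> 0 x)\<^sup>2 = - \<omega> * (1 - (\<tau> x)\<^sup>2)"
      have "flower_state N (sqrt (- \<omega>)) z u p \<tau> \<omega> (\<Phi> \<omega>)"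
        by (intro flower_state.intro flower_state_axioms.intro A) (use assms(1) \<omega> in auto)
      then show ?thesis by blast
    qed
    then obtain z u p \<tau> where "flower_state N (sqrt (- \<omega>)) z u p \<tau> \<omega> (\<Phi> \<omega>)" by blast
    then interpret fs: flower_state N "sqrt (- \<omega>)" z u p \<tau> \<omega> "\<Phi> \<omega>" .
    show ?thesis
      unfolding c_def
      by (rule exI[of _ z]) (intro conjI impI fs.loop.z_pos fs.loop.z(2) fs.loop.T_value fs.counts; assumption)
  qed
  \<comment> \<open>The frequency whose scaled half-loop length sqrt (- \<omega>) pi equals T at the
    sign change of H.\<close>
  define \<omega>s where "\<omega>s = - (pc.T zs / pi)\<^sup>2"
  have Tpos: "0 < pc.T zs"
  proof -
    \<comment> \<open>T is nonnegative at a larger argument and strictly decreasing, hence positive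
      at zs.\<close>
    have "0 \<le> pc.T ((zs + 1) / 2)" by (rule pc.T_nonneg) (use zs in auto)
    also have "\<dots> < pc.T zs" by (rule pc.T_strict_antimono) (use zs in auto)
    finally show ?thesis .
  qed
  have \<omega>s: "\<omega>s < 0" "sqrt (- \<omega>s) * pi = pc.T zs" using Tpos by (auto simp: \<omega>s_def)
  \<comment> \<open>A larger |\<omega>| means a longer scaled loop, hence a smaller z: strict
    monotonicity of T turns the sign of \<omega> - \<omega>s into the sign of z - zs, which decides
    the sign of H.\<close>
  have trich: "(\<omega> < \<omega>s \<longrightarrow> 0 < pc.H z) \<and> (\<omega> = \<omega>s \<longrightarrow> pc.H z = 0) \<and> (\<omega>s < \<omega> \<longrightarrow> pc.H z < 0)"
    if \<omega>: "\<omega> < 0" and z: "0 < z" "z < 1" and T: "pc.T z = sqrt (- \<omega>) * pi" for \<omega> z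
  proof -
    consider "z < zs" | "z = zs" | "zs < z" by linarith
    then show ?thesis
    proof cases
      case 1
      then have "sqrt (- \<omega>s) * pi < sqrt (- \<omega>) * pi" using pc.T_strict_antimono[OF z(1) 1 zs(2)] \<omega>s(2) T by simp
      then show ?thesis using zs(4)[OF z(1) 1] by auto
    next
      case 2
      then have "sqrt (- \<omega>s) * pi = sqrt (- \<omega>) * pi" using \<omega>s(2) T by simp
      then show ?thesis using zs(3) 2 by auto
    next
      case 3
      then have "sqrt (- \<omega>) * pi < sqrt (- \<omega>s) * pi" using pc.T_strict_antimono[OF zs(1) 3 z(2)] \<omega>s(2) T by simp
      then show ?thesis using zs(5)[OF 3 z(2)] by auto
    qed
  qed
  have main: "(\<omega> < \<omega>s \<longrightarrow> n_neg N \<omega> (\<Phi> \<omega>) = enat N) \<and> (\<omega>s \<le> \<omega> \<longrightarrow> n_neg N \<omega> (\<Phi> \<omega>) = 1) \<and>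
      (\<omega> \<noteq> \<omega>s \<longrightarrow> z_zero N \<omega> (\<Phi> \<omega>) = 0) \<and> (\<omega> = \<omega>s \<longrightarrow> z_zero N \<omega> (\<Phi> \<omega>) = enat (N - 1))" if \<omega>: "\<omega> < 0" for \<omega>
  proof -
    obtain z where z: "0 < z" "z < 1" "pc.T z = sqrt (- \<omega>) * pi" and
      n: "0 < pc.H z \<longrightarrow> n_neg N \<omega> (\<Phi> \<omega>) = enat N" "pc.H z \<le> 0 \<longrightarrow> n_neg N \<omega> (\<Phi> \<omega>) = 1"
      "pc.H z \<noteq> 0 \<longrightarrow> z_zero N \<omega> (\<Phi> \<omega>) = 0" "pc.H z = 0 \<longrightarrow> z_zero N \<omega> (\<Phi> \<omega>) = enat (N - 1)"
      using state[OF \<omega>] by blast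
    consider "\<omega> < \<omega>s" | "\<omega> = \<omega>s" | "\<omega>s < \<omega>" by linarith
    then show ?thesis
    proof cases
      case 1
      then have "0 < pc.H z" using trich[OF \<omega> z] by blast
      then show ?thesis using 1 n(1,3) by simp
    next
      case 2
      then have "pc.H z = 0" using trich[OF \<omega> z] by blast
      then show ?thesis using 2 n(2,4) by simp
    next
      case 3
      then have "pc.H z < 0" using trich[OF \<omega> z] by blast
      then show ?thesis using 3 n(2,3) by simp
    qed
  qed
  show ?thesis
  proof (intro exI[of _ \<omega>s] conjI allI ballI impI)
    show "\<omega>s < 0" by (fact \<omega>s(1))
    show "z_zero N \<omega>s (\<Phi> \<omega>s) = enat (N - 1)" using main[OF \<omega>s(1)] by blast
  next
    fix \<omega> assume "\<omega> < 0" "\<omega> \<noteq> \<omega>s"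
    then show "z_zero N \<omega> (\<Phi> \<omega>) = 0" using main[of \<omega>] by blast
  next
    fix \<omega> assume "\<omega> < \<omega>s"
    then show "n_neg N \<omega> (\<Phi> \<omega>) = enat N" using main[of \<omega>] \<omega>s(1) by simp
  next
    fix \<omega> assume "\<omega> \<in> {\<omega>s..<0}"
    then show "n_neg N \<omega> (\<Phi> \<omega>) = 1" using main[of \<omega>] by simp
  qed
qed

end
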